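(* Let $\beta>-d/2$ and assume that $d(\operatorname{supp}g, \partial W)>0$, that $$\limsup_{r\to 0} \frac{\operatorname{Vol}(\{x\in W: d(x,\partial W)\leq r\})}{r}<\infty$$ and that $n^2 r_n^d\to\infty$ and $nr_n^{d+1}\to0$ as $n\to\infty$. Then the following assertions hold: (a) If $n r_n^{d/2}a_n^2\to \gamma\in[0,\infty)$ as $n\to\infty$, then $$\widetilde{T}_{e,n}(\beta) \overset{\mathcal{D}}{\longrightarrow} \left( Z + \frac{\sqrt{d\kappa_d(2\beta+d)}}{\sqrt{2}(\beta+d)} \,\gamma\int_W g(x)^2 \, \mathrm{d}x \right)^2 \quad \text{as} \quad n\to\infty$$ with $Z \sim N(0,1)$. (b) If $n r_n^{d/2}a_n^2\to \infty$ as $n\to\infty$, then $\widetilde{T}_{e,n}(\beta) \overset{\mathbb{P}}{\longrightarrow}\infty$ as $n\to\infty$. (c) If, additionally, $n^2r_n^{d+2}\to 0$ as $n\to\infty$, then the statements of (a) and (b) also hold with $\widetilde{T}_{a,n}(\beta)$ in place of $\widetilde{T}_{e,n}(\beta)$.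
   Context: Let $d\ge 1$ and let $W\subset\mathbb{R}^d$ be a measurable set with volume (Lebesgue measure) $\operatorname{Vol}(W)=1$. Let $(r_n)$ be a sequence of positive real numbers with $r_n\to0$ as $n\to\infty$. Let $g\in L^3(W)$ (i.e. $g$ measurable on $W$ with $\int_W|g|^3<\infty$) be such that $g\not\equiv0$ (not almost everywhere zero) and $\int_W g(x)\,\mathrm{d}x=0$, and let $(a_n)$ be a positive sequence with $a_n\to0$ as $n\to\infty$, such that $1+a_ng(x)\ge0$ for all $x\in W$ and $n\in\mathbb{N}$; thus $\mathbf{1}_W+a_ng$ is a probability density on $W$. For each $n$ let $\widetilde{X}_1,\ldots,\widetilde{X}_n$ be i.i.d. random vectors with density $\mathbf{1}_W+a_n g$ (a triangular scheme), and let $$\widetilde L_n(\beta):=\frac12\sum_{i\ne j}\mathbf{1}\{\|\widetilde X_i-\widetilde X_j\|\le r_n\}\,\|\widetilde X_i-\widetilde X_j\|^\beta ,$$ the sum being over ordered pairs $(i,j)$ of distinct indices in $\{1,\dots,n\}$ and $\|\cdot\|$ the Euclidean norm. With $\kappa_d=\pi^{d/2}/\Gamma(d/2+1)$ the volume of the $d$-dimensional unit ball, define for $\beta>-d/2$ $$\widetilde T_{e,n}(\beta)=\left(\frac{\widetilde L_n(\beta)- \frac{1}{2}n(n-1)\int_{W^2} \mathbf{1}\{\|x-y\|\leq r_n\} \, \|x-y\|^\beta\, \mathrm{d}(x,y)}{\sqrt{\frac{d\kappa_d}{2(2\beta+d)} }\,n r_n^{\beta+d/2}}\right)^2,$$ $$\widetilde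 T_{a,n}(\beta)=\left(\frac{\widetilde L_n(\beta)-\frac{d\kappa_d}{2(\beta+d)} \, n(n-1) r_n^{\beta+d}}{\sqrt{\frac{d\kappa_d}{2(2\beta+d)} }\,n r_n^{\beta+d/2}}\right)^2.$$ $\operatorname{supp} g$ is the set of all $x\in W$ with $g(x)\ne0$. $\partial W$ is the boundary of $W$, $d(x,A):=\inf_{y\in A}\|x-y\|$ and $d(A,B):=\inf_{x\in A,y\in B}\|x-y\|$. $\overset{\mathcal{D}}{\longrightarrow}$ denotes convergence in distribution; $\overset{\mathbb{P}}{\longrightarrow}\infty$ denotes convergence in probability to infinity (for every $K>0$ the probability of exceeding $K$ tends to $1$). *)

theory Defs
  imports "HOL-Probability.Probability"
begin

text \<open>The Euclidean space \<open>\<real>\<^sup>d\<close> is an arbitrary type of class \<open>euclidean_space\<close>, with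
  \<open>d = DIM('a)\<close>, and \<open>\<kappa>\<^sub>d\<close> is \<open>unit_ball_vol (real DIM('a))\<close>. Volume is \<open>lebesgue\<close>, the completion
  of \<open>lborel\<close>, so that Lebesgue measurable sets and functions are admitted.\<close>

text \<open>\<open>distributed M lebesgue X f\<close> would ask \<open>X\<close> to be measurable with respect to all
  Lebesgue sets; here \<open>X\<close> is an ordinary Borel random vector, while its density only
  needs to be Lebesgue measurable.\<close>

definition has_lebesgue_density ::
    "'b measure \<Rightarrow> ('b \<Rightarrow> 'a::euclidean_space) \<Rightarrow> ('a \<Rightarrow> real) \<Rightarrow> bool" where
  "has_lebesgue_density M X f \<longleftrightarrow>
     X \<in> borel_measurable M \<and> f \<in> borel_measurable lebesgue \<and>
     (\<forall>A\<in>sets borel. emeasure M (X -` A \<inter> space M) = (\<integral>\<^sup>+x\<in>A. ennreal (f x) \<partial>lebesgue))"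

text \<open>Since \<open>0 powr \<beta> = 0\<close>, coinciding points contribute \<open>0\<close> for every \<open>\<beta>\<close>. For \<open>\<beta> \<le> 0\<close> this
  may differ from other conventions for \<open>0\<close> to the power \<open>\<beta>\<close>, but only on a null set, both for
  the integrals and for random vectors having a density.\<close>

definition edge_weight :: "real \<Rightarrow> real \<Rightarrow> 'a::euclidean_space \<Rightarrow> 'a \<Rightarrow> real" where
  "edge_weight r \<beta> x y = of_bool (norm (x - y) \<le> r) * norm (x - y) powr \<beta>"

definition length_power :: "real \<Rightarrow> real \<Rightarrow> nat \<Rightarrow> (nat \<Rightarrow> 'a::euclidean_space) \<Rightarrow> real" where
  "length_power r \<beta> n x =
     1 / 2 * (\<Sum>(i, j) \<in> {(i, j). i \<in> {1..n} \<and> j \<in> {1..n} \<and> i \<noteq> j}. edge_weight r \<beta> (x i) (x j))"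

definition T_scale :: "'a::euclidean_space itself \<Rightarrow> real \<Rightarrow> real \<Rightarrow> nat \<Rightarrow> real" where
  "T_scale _ r \<beta> n =
     sqrt (real DIM('a) * unit_ball_vol (real DIM('a)) / (2 * (2 * \<beta> + real DIM('a))))
       * real n * r powr (\<beta> + real DIM('a) / 2)"

definition T_e ::
    "'a::euclidean_space set \<Rightarrow> real \<Rightarrow> real \<Rightarrow> nat \<Rightarrow> (nat \<Rightarrow> 'a) \<Rightarrow> real" where
  "T_e W r \<beta> n x =
     ((length_power r \<beta> n x
        - 1 / 2 * real n * (real n - 1)
          * (LINT (x, y)|(lebesgue_on W \<Otimes>\<^sub>M lebesgue_on W). edge_weight r \<beta> x y))
      / T_scale TYPE('a) r \<beta> n)\<^sup>2"

definition T_a :: "real \<Rightarrow> real \<Rightarrow> nat \<Rightarrow> (nat \<Rightarrow> 'a::euclidean_space) \<Rightarrow> real" where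
  "T_a r \<beta> n x =
     ((length_power r \<beta> n x
        - real DIM('a) * unit_ball_vol (real DIM('a)) / (2 * (\<beta> + real DIM('a)))
          * real n * (real n - 1) * r powr (\<beta> + real DIM('a)))
      / T_scale TYPE('a) r \<beta> n)\<^sup>2"

text \<open>The \<open>n\<close>-th random variable may live on its own probability space \<open>M n\<close>.\<close>

definition tendsto_infinity_in_prob ::
    "(nat \<Rightarrow> 'b measure) \<Rightarrow> (nat \<Rightarrow> 'b \<Rightarrow> real) \<Rightarrow> bool" where
  "tendsto_infinity_in_prob M T \<longleftrightarrow>
     (\<forall>K>0. (\<lambda>n. measure (M n) {\<omega> \<in> space (M n). T n \<omega> > K}) \<longlonglongrightarrow> 1)"

text \<open>The law of \<open>(Z + c \<gamma> \<integral>\<^sub>W g\<^sup>2)\<^sup>2\<close> for standard normal \<open>Z\<close>, with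
  \<open>c = \<surd>(d \<kappa>\<^sub>d (2\<beta> + d)) / (\<surd>2 (\<beta> + d))\<close>.\<close>

definition limit_law ::
    "'a::euclidean_space set \<Rightarrow> ('a \<Rightarrow> real) \<Rightarrow> real \<Rightarrow> real \<Rightarrow> real measure" where
  "limit_law W g \<beta> \<gamma> = distr std_normal_distribution borel
     (\<lambda>z. (z + sqrt (real DIM('a) * unit_ball_vol (real DIM('a)) * (2 * \<beta> + real DIM('a)))
                 / (sqrt 2 * (\<beta> + real DIM('a)))
               * \<gamma> * (LINT x|lebesgue_on W. (g x)\<^sup>2))\<^sup>2)"

end

theory Submission
  imports Defs
begin

text \<open>
  Let \<open>w\<close> be the kernel \<open>\<parallel>x - y\<parallel>\<^sup>\<beta>\<close> restricted to \<open>\<parallel>x - y\<parallel> \<le> r\<^sub>n\<close>. Hoeffding's decomposition splits the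
  centred statistic into a degenerate U-statistic and a linear part. Up to the boundary strip and
  a term of order \<open>a\<^sub>n\<close>, the projection of \<open>w\<close> is constant on \<open>W\<close>, so the linear part is negligible
  when \<open>n r\<^sub>n\<^sup>d\<^sup>+\<^sup>1\<close> and \<open>n r\<^sub>n\<^sup>d a\<^sub>n\<^sup>2\<close> vanish. The degenerate part is a martingale in the sample size.
  Conditioning on all but the last point and expanding the characteristic function to second order
  gives an explicit error in terms of the fluctuation of the conditional variance and of the fourth
  moments of the increments; both are small because every point sees only mass \<open>O (r\<^sub>n\<^sup>2\<^sup>d\<^sup>/\<^sup>3)\<close>, by
  \<open>g \<in> L\<^sup>3\<close>. As \<open>w\<close> need not have four moments, pairs at distance below \<open>\<epsilon> r\<^sub>n\<close> are first cut off.
  The shift of the mean is \<open>a\<^sub>n\<^sup>2\<close> times the quadratic form of \<open>w\<close> at \<open>g\<close>, since the cross term with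
  the uniform density integrates \<open>g\<close> against a constant, and it is evaluated by an approximate
  identity. In the divergent regime Chebyshev's inequality suffices.
\<close>

section \<open>Degenerate U-statistics\<close>

text \<open>The density is only in L3 and the kernel only in L2, so neither a bounded density nor
  four moments of the kernel are at hand. What saves the argument is an exponent. With
  \<open>d\<close> the dimension, a point sees mass \<open>r powr (2/3 * d)\<close>, so its
  truncated edges weigh on average \<open>n * r powr (b + 2/3 * d)\<close>; divided by the scale
  \<open>n * r powr (b + d/2)\<close> this leaves \<open>r powr (d/6)\<close>, which vanishes.
  Cutting at \<open>\<epsilon> * r\<close> costs the fraction
  \<open>\<epsilon> powr (2 * b + d)\<close> of the variance uniformly in \<open>n\<close>; hence
  \<open>\<epsilon>\<close> is fixed by the tolerance before \<open>n\<close> grows. The statistic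
  is centred at its true mean. This writes \<open>T_e\<close> and \<open>T_a\<close> as squares of
  \<open>Y + shift\<close> and \<open>Y + shift + bias\<close> with the same \<open>Y\<close>:
  \<open>shift\<close> is the effect of \<open>g\<close> on the mean, \<open>bias\<close> that of
  the boundary on the closed formula. Put \<open>x = n * r powr (d/2) * a^2\<close>. The shift is of
  order \<open>x\<close>, and the linear part has relative variance of order at most
  \<open>n * r^(d+1) + x * r powr (d/2)\<close>. If \<open>x\<close> converges, this vanishes. If
  \<open>x\<close> diverges, it may be unbounded, but it is small against \<open>x^2\<close>, which
  is all that Chebyshev's inequality asks.\<close>

lemma Cauchy_Schwarz_integral:
  fixes f g :: "'a \<Rightarrow> real"
  assumes [measurable]: "f \<in> borel_measurable M" "g \<in> borel_measurable M"
    and f2: "integrable M (\<lambda>x. (f x)\<^sup>2)" and g2: "integrable M (\<lambda>x. (g x)\<^sup>2)"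
  shows "integrable M (\<lambda>x. f x * g x)"
    and "(\<integral>x. f x * g x \<partial>M)\<^sup>2 \<le> (\<integral>x. (f x)\<^sup>2 \<partial>M) * (\<integral>x. (g x)\<^sup>2 \<partial>M)"
proof -
  show fg: "integrable M (\<lambda>x. f x * g x)"
  proof (rule Bochner_Integration.integrable_bound)
    show "integrable M (\<lambda>x. (f x)\<^sup>2 + (g x)\<^sup>2)" using f2 g2 by simp
    show "AE x in M. norm (f x * g x) \<le> norm ((f x)\<^sup>2 + (g x)\<^sup>2)"
    proof (rule AE_I2)
      fix x
      have "0 \<le> (\<bar>f x\<bar> - \<bar>g x\<bar>)\<^sup>2" "0 \<le> \<bar>f x * g x\<bar>" by simp_all
      then have "\<bar>f x * g x\<bar> \<le> (f x)\<^sup>2 + (g x)\<^sup>2"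
        unfolding power2_diff power2_abs abs_mult by linarith
      then show "norm (f x * g x) \<le> norm ((f x)\<^sup>2 + (g x)\<^sup>2)" by simp
    qed
  qed measurable
  define a b c where "a = (\<integral>x. (f x)\<^sup>2 \<partial>M)" and "b = (\<integral>x. f x * g x \<partial>M)" and "c = (\<integral>x. (g x)\<^sup>2 \<partial>M)"
  have a0: "a \<ge> 0" unfolding a_def by simp
  have "b\<^sup>2 \<le> a * c"
  proof (cases "a = 0")
    case True
    then have "AE x in M. (f x)\<^sup>2 = 0"
      unfolding a_def using integral_nonneg_eq_0_iff_AE[OF f2] by simp
    then have "AE x in M. f x * g x = 0" by eventually_elim simp
    then have "b = 0" unfolding b_def by (rule integral_eq_zero_AE)
    then show ?thesis using True by simp
  next
    case False
    \<comment> \<open>The combination is \<open>-a\<close> times the residual of projecting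
      \<open>g\<close> onto \<open>f\<close>, so its squared norm factors as
      \<open>a * (a * c - b^2)\<close>.\<close>
    have "0 \<le> (\<integral>x. (b * f x - a * g x)\<^sup>2 \<partial>M)" by simp
    also have "\<dots> = (\<integral>x. b\<^sup>2 * (f x)\<^sup>2 - 2 * a * b * (f x * g x) + a\<^sup>2 * (g x)\<^sup>2 \<partial>M)"
      by (simp add: power2_diff power_mult_distrib algebra_simps)
    also have "\<dots> = b\<^sup>2 * a - 2 * a * b * b + a\<^sup>2 * c"
      using f2 g2 fg by (simp add: a_def b_def c_def)
    also have "\<dots> = a * (a * c - b\<^sup>2)" by (simp add: power2_eq_square algebra_simps)
    finally show ?thesis using False a0 by (simp add: zero_le_mult_iff)
  qed
  then show "(\<integral>x. f x * g x \<partial>M)\<^sup>2 \<le> (\<integral>x. (f x)\<^sup>2 \<partial>M) * (\<integral>x. (g x)\<^sup>2 \<partial>M)"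
    unfolding a_def b_def c_def .
qed

lemma integrable_power2_add:
  fixes f g :: "'a \<Rightarrow> real"
  assumes "f \<in> borel_measurable M" "g \<in> borel_measurable M"
    and "integrable M (\<lambda>x. (f x)\<^sup>2)" "integrable M (\<lambda>x. (g x)\<^sup>2)"
  shows "integrable M (\<lambda>x. (f x + g x)\<^sup>2)"
  using assms Cauchy_Schwarz_integral(1)[OF assms] by (simp add: power2_sum mult.assoc)

lemma integrable_sum_power2:
  fixes f :: "'i \<Rightarrow> 'a \<Rightarrow> real"
  assumes "finite I" and "\<And>i. i \<in> I \<Longrightarrow> f i \<in> borel_measurable M"
    and "\<And>i. i \<in> I \<Longrightarrow> integrable M (\<lambda>x. (f i x)\<^sup>2)"
  shows "integrable M (\<lambda>x. (\<Sum>i\<in>I. f i x)\<^sup>2)"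
    and "(\<integral>x. (\<Sum>i\<in>I. f i x)\<^sup>2 \<partial>M) = (\<Sum>i\<in>I. \<Sum>j\<in>I. \<integral>x. f i x * f j x \<partial>M)"
proof -
  have eq: "(\<lambda>x. (\<Sum>i\<in>I. f i x)\<^sup>2) = (\<lambda>x. \<Sum>i\<in>I. \<Sum>j\<in>I. f i x * f j x)"
    by (simp add: power2_eq_square sum_product)
  have *: "integrable M (\<lambda>x. f i x * f j x)" if "i \<in> I" "j \<in> I" for i j
    by (intro Cauchy_Schwarz_integral assms that)
  show "integrable M (\<lambda>x. (\<Sum>i\<in>I. f i x)\<^sup>2)"
    unfolding eq by (intro Bochner_Integration.integrable_sum *)
  show "(\<integral>x. (\<Sum>i\<in>I. f i x)\<^sup>2 \<partial>M) = (\<Sum>i\<in>I. \<Sum>j\<in>I. \<integral>x. f i x * f j x \<partial>M)"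
    unfolding eq using * by (simp add: Bochner_Integration.integral_sum)
qed

lemma (in prob_space) power2_integral_le:
  fixes f :: "'a \<Rightarrow> real"
  assumes "f \<in> borel_measurable M" and "integrable M (\<lambda>x. (f x)\<^sup>2)"
  shows "integrable M f" and "(\<integral>x. f x \<partial>M)\<^sup>2 \<le> (\<integral>x. (f x)\<^sup>2 \<partial>M)"
  using Cauchy_Schwarz_integral[of f M "\<lambda>_. 1"] assms by (auto simp: prob_space)

lemma (in prob_space) integral_abs_le_sqrt:
  fixes f :: "'a \<Rightarrow> real"
  assumes [measurable]: "f \<in> borel_measurable M" and "integrable M (\<lambda>x. (f x)\<^sup>2)"
  shows "(\<integral>x. \<bar>f x\<bar> \<partial>M) \<le> sqrt (\<integral>x. (f x)\<^sup>2 \<partial>M)"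
  using power2_integral_le(2)[of "\<lambda>x. \<bar>f x\<bar>"] assms by (intro real_le_rsqrt) auto

lemma iexp_quadratic_approx:
  fixes x :: real
  shows "cmod (iexp x - (1 + \<i> * x - x\<^sup>2 / 2)) \<le> \<bar>x\<bar> ^ 3 / 6"
proof -
  have "(\<Sum>k\<le>2. (\<i> * complex_of_real x) ^ k / fact k) = 1 + \<i> * x - x\<^sup>2 / 2"
    by (simp add: eval_nat_numeral power_mult_distrib)
  then show ?thesis using iexp_approx1[of x 2] by (simp add: fact_numeral numeral_3_eq_3)
qed

lemma exp_minus_linear_approx:
  fixes u :: real
  assumes "u \<ge> 0"
  shows "\<bar>exp (- u) - (1 - u)\<bar> \<le> u\<^sup>2 / 2"
proof -
  have 1: "1 - u \<le> exp (- u)" using exp_ge_add_one_self[of "- u"] by simp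
  have "(\<lambda>x. 1 - x + x\<^sup>2 / 2 - exp (- x)) 0 \<le> (\<lambda>x. 1 - x + x\<^sup>2 / 2 - exp (- x)) u"
  proof (rule DERIV_nonneg_imp_nondecreasing[OF assms])
    fix x :: real assume "0 \<le> x" "x \<le> u"
    show "\<exists>y. ((\<lambda>x. 1 - x + x\<^sup>2 / 2 - exp (- x)) has_real_derivative y) (at x) \<and> 0 \<le> y"
      using exp_ge_add_one_self[of "- x"]
      by (intro exI[of _ "- 1 + x + exp (- x)"] conjI) (auto intro!: derivative_eq_intros)
  qed
  then show ?thesis using 1 by simp
qed

lemma abs_power_le:
  fixes a b :: real
  assumes "\<bar>a\<bar> \<le> b"
  shows "\<bar>a ^ k\<bar> \<le> b ^ k"
  using power_mono[OF assms abs_ge_zero, of k] by (simp add: power_abs)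

lemma greaterThanAtMost_0_Suc: "{0<..Suc m} = insert (Suc m) {0<..m}"
  by auto

section \<open>Samples extended one point at a time\<close>

locale iid_sample = prob_space Q for Q :: "'a measure" +
  assumes space_UNIV [simp]: "space Q = UNIV"
begin

text \<open>Half-open index intervals make \<open>{0<..Suc m}\<close> the insertion of one index
  into \<open>{0<..m}\<close>, the shape required by Fubini's theorem for finite products.\<close>

abbreviation P :: "nat \<Rightarrow> (nat \<Rightarrow> 'a) measure" where
  "P m \<equiv> Pi\<^sub>M {0<..m} (\<lambda>_. Q)"

lemma prob_UNIV [simp]: "prob UNIV = 1"
  using prob_space by simp

lemma prob_space_P: "prob_space (P m)"
  by (intro prob_space_PiM prob_space_axioms)

lemma measure_P [simp]: "measure (P m) (space (P m)) = 1"
  by (rule prob_space.prob_space[OF prob_space_P])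

lemma finite_measure_P: "finite_measure (P m)"
  using prob_space_P by (rule prob_space.axioms)

lemma integrable_const_P [simp]: "integrable (P m) (\<lambda>_. c)"
  by (rule finite_measure.integrable_const[OF finite_measure_P])

lemma sigma_finite_P: "sigma_finite_measure (P m)"
  using prob_space_P by (rule prob_space_imp_sigma_finite)

lemmas measurable_integral_P [measurable (raw)] =
  sigma_finite_measure.borel_measurable_lebesgue_integral[OF sigma_finite_P]

lemma pair_sigma_finite_PQ: "pair_sigma_finite (P m) Q"
  using sigma_finite_P sigma_finite_measure_axioms by (rule pair_sigma_finite.intro)

lemma pair_sigma_finite_QQ: "pair_sigma_finite Q Q"
  using sigma_finite_measure_axioms sigma_finite_measure_axioms by (rule pair_sigma_finite.intro)

lemma prob_space_PQ: "prob_space (P m \<Otimes>\<^sub>M Q)"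
  by (rule prob_space_pair[OF prob_space_P prob_space_axioms])

lemma prob_space_QQ: "prob_space (Q \<Otimes>\<^sub>M Q)"
  by (rule prob_space_pair[OF prob_space_axioms prob_space_axioms])

lemma bounded_integrable:
  fixes f :: "'b \<Rightarrow> 'c::{banach, second_countable_topology}"
  assumes "finite_measure M" "f \<in> borel_measurable M" "\<And>x. norm (f x) \<le> B"
  shows "integrable M f"
  using assms by (intro finite_measure.integrable_const_bound[of M f B]) auto

text \<open>Conditioning on the first \<open>m\<close> points is realised concretely as integrating
  out the new coordinate first; every martingale step below has this form.\<close>

lemma integral_P_Suc:
  fixes F :: "(nat \<Rightarrow> 'a) \<Rightarrow> 'b::{banach, second_countable_topology}"
  assumes "integrable (P (Suc m)) F"
  shows "(\<integral>x. F x \<partial>P (Suc m)) = (\<integral>x. \<integral>z. F (x(Suc m := z)) \<partial>Q \<partial>P m)"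
proof -
  interpret PS: product_sigma_finite "\<lambda>_::nat. Q" by unfold_locales
  show ?thesis
    unfolding greaterThanAtMost_0_Suc
    by (rule PS.product_integral_insert) (use assms[unfolded greaterThanAtMost_0_Suc] in simp_all)
qed

end

text \<open>Degeneracy makes the U-statistic a martingale in the sample size.\<close>

locale degenerate_kernel = iid_sample Q for Q :: "'a measure" +
  fixes H :: "'a \<Rightarrow> 'a \<Rightarrow> real" and B :: real
  assumes H_measurable [measurable]: "case_prod H \<in> borel_measurable (Q \<Otimes>\<^sub>M Q)"
    and H_bounded: "\<bar>H x y\<bar> \<le> B"
    and H_sym: "H x y = H y x"
    and H_degenerate: "(\<integral>y. H x y \<partial>Q) = 0"
begin

text \<open>The increment of the U-statistic when the point \<open>z\<close> is added to the sample \<open>x\<close> of size \<open>m\<close>.\<close>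

definition A :: "nat \<Rightarrow> (nat \<Rightarrow> 'a) \<Rightarrow> 'a \<Rightarrow> real" where
  "A m x z = (\<Sum>i\<in>{0<..m}. H (x i) z)"

lemma A_measurable [measurable]: "case_prod (A m) \<in> borel_measurable (P m \<Otimes>\<^sub>M Q)"
  unfolding A_def by measurable

lemma A_measurable1 [measurable]: "(\<lambda>x. A m x z) \<in> borel_measurable (P m)"
  unfolding A_def by measurable

lemma A_measurable2 [measurable]: "A m x \<in> borel_measurable Q"
  unfolding A_def by measurable

lemma B_nonneg: "0 \<le> B"
  using H_bounded[of undefined undefined] by linarith

lemma A_bounded: "\<bar>A m x z\<bar> \<le> m * B"
proof -
  have "\<bar>A m x z\<bar> \<le> (\<Sum>i\<in>{0<..m}. \<bar>H (x i) z\<bar>)" unfolding A_def by (rule sum_abs)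
  also have "\<dots> \<le> (\<Sum>i\<in>{0<..m}. B)" by (intro sum_mono H_bounded)
  finally show ?thesis by simp
qed

lemma A_update [simp]: "A m (x(Suc m := y)) z = A m x z"
  unfolding A_def by (intro sum.cong) auto

lemma A_Suc: "A (Suc m) (x(Suc m := y)) z = A m x z + H y z"
proof -
  have "A (Suc m) (x(Suc m := y)) z = A m (x(Suc m := y)) z + H y z"
    by (simp add: A_def greaterThanAtMost_0_Suc)
  then show ?thesis by simp
qed

lemma integrable_bdd_P:
  fixes f :: "(nat \<Rightarrow> 'a) \<Rightarrow> 'b::{banach, second_countable_topology}"
  assumes "f \<in> borel_measurable (P m)" "\<And>x. norm (f x) \<le> C"
  shows "integrable (P m) f"
  by (rule bounded_integrable[OF finite_measure_P assms])

lemma integrable_bdd_Q: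
  fixes f :: "'a \<Rightarrow> 'b::{banach, second_countable_topology}"
  assumes "f \<in> borel_measurable Q" "\<And>x. norm (f x) \<le> C"
  shows "integrable Q f"
  by (rule bounded_integrable[OF finite_measure_axioms assms])

lemma integrable_bdd_PQ:
  fixes f :: "(nat \<Rightarrow> 'a) \<times> 'a \<Rightarrow> 'b::{banach, second_countable_topology}"
  assumes "f \<in> borel_measurable (P m \<Otimes>\<^sub>M Q)" "\<And>x. norm (f x) \<le> C"
  shows "integrable (P m \<Otimes>\<^sub>M Q) f"
  by (rule bounded_integrable[OF _ assms]) (rule prob_space.axioms(1)[OF prob_space_PQ])

lemma integral_bdd_le:
  fixes f :: "'b \<Rightarrow> real"
  assumes "prob_space M" "f \<in> borel_measurable M" "\<And>x. \<bar>f x\<bar> \<le> C"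
  shows "\<bar>\<integral>x. f x \<partial>M\<bar> \<le> C"
proof -
  interpret M: prob_space M by fact
  have i: "integrable M f" by (rule bounded_integrable[of M f C]) (use assms in \<open>auto intro: M.finite_measure_axioms\<close>)
  have "\<bar>\<integral>x. f x \<partial>M\<bar> \<le> (\<integral>x. \<bar>f x\<bar> \<partial>M)" by (rule integral_abs_bound)
  also have "\<dots> \<le> C"
    by (rule M.integral_le_const) (use i assms in auto)
  finally show ?thesis .
qed

lemma A_power_integrable:
  shows "integrable (P m) (\<lambda>x. A m x z ^ k)" "integrable Q (\<lambda>z. A m x z ^ k)"
    "integrable (P m \<Otimes>\<^sub>M Q) (\<lambda>p. A m (fst p) (snd p) ^ k)"
  using A_bounded[of m]
  by (auto intro!: integrable_bdd_P[where C="(m * B) ^ k"] integrable_bdd_Q[where C="(m * B) ^ k"]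
      integrable_bdd_PQ[where C="(m * B) ^ k"] simp: power_abs intro!: power_mono)

lemma H_power_integrable: "integrable Q (\<lambda>y. H y z ^ k)" "integrable Q (\<lambda>z. H y z ^ k)"
  using H_bounded
  by (auto intro!: integrable_bdd_Q[where C="B ^ k"] simp: power_abs intro!: power_mono)

lemma H_degenerate': "(\<integral>y. H y z \<partial>Q) = 0"
  using H_degenerate[of z] H_sym by simp

lemma integral_A_Suc_power:
  "(\<integral>x. A (Suc m) x z ^ k \<partial>P (Suc m)) = (\<integral>x. \<integral>y. (A m x z + H y z) ^ k \<partial>Q \<partial>P m)"
  by (subst integral_P_Suc[OF A_power_integrable(1)]) (simp only: A_Suc)

lemma integral_A: "(\<integral>x. A m x z \<partial>P m) = 0"
proof (induction m)
  case (Suc m)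
  have "(\<integral>y. A m x z + H y z \<partial>Q) = A m x z" for x
    using H_power_integrable(1)[of z 1] by (simp add: H_degenerate' prob_space)
  then show ?case using integral_A_Suc_power[of m z 1] Suc by simp
qed (simp add: A_def)

section \<open>Moments of the increments\<close>

definition D :: "'a \<Rightarrow> real" where "D z = (\<integral>y. (H y z)\<^sup>2 \<partial>Q)"

lemma D_measurable [measurable]: "D \<in> borel_measurable Q" unfolding D_def by measurable

lemma D_nonneg: "0 \<le> D z" unfolding D_def by simp

lemma H_power2_le: "(H y z)\<^sup>2 \<le> B\<^sup>2"
  using power_mono[OF H_bounded abs_ge_zero, of y z 2] by simp

lemma D_le: "D z \<le> B\<^sup>2"
  using integral_bdd_le[OF prob_space_axioms, of "\<lambda>y. (H y z)\<^sup>2" "B\<^sup>2"] H_power2_le by (auto simp: D_def)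

lemma integral_A2: "(\<integral>x. (A m x z)\<^sup>2 \<partial>P m) = m * D z"
proof (induction m)
  case (Suc m)
  have "(\<integral>y. (A m x z + H y z)\<^sup>2 \<partial>Q) = (A m x z)\<^sup>2 + D z" for x
    using H_power_integrable(1)[of z 1] H_power_integrable(1)[of z 2]
    by (simp add: power2_sum H_degenerate' prob_space D_def mult.assoc)
  then show ?case using integral_A_Suc_power[of m z 2] Suc A_power_integrable(1)[of m z 2]
    by (simp add: algebra_simps)
qed (simp add: A_def)

text \<open>For fixed \<open>z\<close> the summands \<open>H (x i) z\<close> are independent and
  centred, so only equal or paired indices survive in the fourth power. Each step of the induction
  adds \<open>6 * m * (D z)^2\<close>, and these terms sum to less than
  \<open>3 * m^2 * (D z)^2\<close>.\<close>

lemma integral_A4: "(\<integral>x. A m x z ^ 4 \<partial>P m) \<le> m * (\<integral>y. H y z ^ 4 \<partial>Q) + 3 * (real m)\<^sup>2 * (D z)\<^sup>2"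
proof (induction m)
  case (Suc m)
  define K where "K = (\<integral>y. H y z ^ 4 \<partial>Q)"
  define T where "T = (\<integral>y. H y z ^ 3 \<partial>Q)"
  have e: "(a + b) ^ 4 = a ^ 4 + 4 * a ^ 3 * b + 6 * a\<^sup>2 * b\<^sup>2 + 4 * a * b ^ 3 + b ^ 4" for a b :: real
    by (simp add: power4_eq_xxxx power2_eq_square power3_eq_cube algebra_simps)
  \<comment> \<open>The term with the third moment \<open>T\<close> is still present here; it
    disappears only after averaging over the old sample, because \<open>A\<close> is
    centred.\<close>
  have "(\<integral>y. (A m x z + H y z) ^ 4 \<partial>Q) = A m x z ^ 4 + 6 * (A m x z)\<^sup>2 * D z + 4 * A m x z * T + K" for x
    unfolding e
    using H_power_integrable(1)[of z 1] H_power_integrable(1)[of z 2]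
      H_power_integrable(1)[of z 3] H_power_integrable(1)[of z 4]
    by (simp add: H_degenerate' prob_space D_def mult.assoc K_def T_def)
  then have "(\<integral>x. A (Suc m) x z ^ 4 \<partial>P (Suc m))
      = (\<integral>x. A m x z ^ 4 \<partial>P m) + 6 * (m * D z) * D z + K"
    using integral_A_Suc_power[of m z 4] A_power_integrable(1)[of m z 2] A_power_integrable(1)[of m z 4]
      A_power_integrable(1)[of m z 1]
    by (simp add: integral_A2 integral_A)
  also have "\<dots> \<le> m * K + 3 * (real m)\<^sup>2 * (D z)\<^sup>2 + 6 * (m * D z) * D z + K"
    using Suc by (simp add: K_def)
  also have "\<dots> \<le> Suc m * K + 3 * (real (Suc m))\<^sup>2 * (D z)\<^sup>2"
    by (simp add: power2_eq_square algebra_simps)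
  finally show ?case unfolding K_def .
qed (simp add: A_def)

text \<open>Together with \<open>g2\<close> below, these are the only features of the kernel that
  enter the error of the normal approximation: its squared L2 norm, its fourth moment, and the
  second moment of its conditional second moment.\<close>

definition s :: real where "s = (\<integral>z. D z \<partial>Q)"
definition q4 :: real where "q4 = (\<integral>z. \<integral>y. H y z ^ 4 \<partial>Q \<partial>Q)"
definition d2 :: real where "d2 = (\<integral>z. (D z)\<^sup>2 \<partial>Q)"

lemma D_integrable: "integrable Q D" "integrable Q (\<lambda>z. (D z)\<^sup>2)"
proof -
  show "integrable Q D"
    by (rule integrable_bdd_Q[where C="B\<^sup>2"]) (use D_le D_nonneg in \<open>auto simp: abs_of_nonneg\<close>)
  show "integrable Q (\<lambda>z. (D z)\<^sup>2)"
    by (rule integrable_bdd_Q[where C="(B\<^sup>2)\<^sup>2"])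
       (use power_mono[OF D_le D_nonneg, of _ 2] in auto)
qed

lemma H4_integrable: "integrable Q (\<lambda>z. \<integral>y. H y z ^ 4 \<partial>Q)"
proof (rule integrable_bdd_Q[where C="B ^ 4"])
  fix z show "norm (\<integral>y. H y z ^ 4 \<partial>Q) \<le> B ^ 4"
    unfolding real_norm_def
    by (intro integral_bdd_le[OF prob_space_axioms] abs_power_le H_bounded) measurable
qed measurable

lemma A_power_swap: "(\<integral>x. \<integral>z. A m x z ^ k \<partial>Q \<partial>P m) = (\<integral>z. \<integral>x. A m x z ^ k \<partial>P m \<partial>Q)"
  by (rule pair_sigma_finite.Fubini_integral[OF pair_sigma_finite_PQ, symmetric]) (use A_power_integrable(3)[of m k] in \<open>simp add: case_prod_beta'\<close>)

lemma integral_integral_A2: "(\<integral>x. \<integral>z. (A m x z)\<^sup>2 \<partial>Q \<partial>P m) = m * s"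
  unfolding A_power_swap by (simp add: integral_A2 s_def)

lemma integral_integral_A4:
  "(\<integral>x. \<integral>z. A m x z ^ 4 \<partial>Q \<partial>P m) \<le> m * q4 + 3 * (real m)\<^sup>2 * d2"
proof -
  have "(\<integral>x. \<integral>z. A m x z ^ 4 \<partial>Q \<partial>P m) \<le> (\<integral>z. m * (\<integral>y. H y z ^ 4 \<partial>Q) + 3 * (real m)\<^sup>2 * (D z)\<^sup>2 \<partial>Q)"
    unfolding A_power_swap
  proof (rule integral_mono)
    show "integrable Q (\<lambda>z. \<integral>x. A m x z ^ 4 \<partial>P m)"
    proof (rule integrable_bdd_Q[where C="(m * B) ^ 4"])
      fix z show "norm (\<integral>x. A m x z ^ 4 \<partial>P m) \<le> (m * B) ^ 4"
        unfolding real_norm_def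
        by (intro integral_bdd_le[OF prob_space_P] abs_power_le A_bounded) measurable
    qed measurable
  qed (use H4_integrable D_integrable integral_A4 in auto)
  also have "\<dots> = m * q4 + 3 * (real m)\<^sup>2 * d2"
    using H4_integrable D_integrable by (simp add: q4_def d2_def)
  finally show ?thesis .
qed

text \<open>Interpolation by Cauchy-Schwarz between the second and fourth moments, for which
  recursions are available: the cube is split as \<open>|A| * A^2\<close>.\<close>

lemma integral_integral_abs_A3:
  "(\<integral>x. \<integral>z. \<bar>A m x z\<bar> ^ 3 \<partial>Q \<partial>P m) \<le> sqrt (m * s * (m * q4 + 3 * (real m)\<^sup>2 * d2))"
proof -
  let ?R = "P m \<Otimes>\<^sub>M Q"
  let ?a = "\<lambda>p. \<bar>A m (fst p) (snd p)\<bar>"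
  have int: "integrable ?R (\<lambda>p. ?a p ^ k)" for k
    using integrable_abs[OF A_power_integrable(3)[of m k]] by (simp add: power_abs)
  have it: "(\<integral>p. ?a p ^ k \<partial>?R) = (\<integral>x. \<integral>z. \<bar>A m x z\<bar> ^ k \<partial>Q \<partial>P m)" for k
    using pair_sigma_finite.integral_fst'[OF pair_sigma_finite_PQ int[of k]] by simp
  have "(\<integral>p. ?a p * (?a p)\<^sup>2 \<partial>?R)\<^sup>2 \<le> (\<integral>p. (?a p)\<^sup>2 \<partial>?R) * (\<integral>p. ((?a p)\<^sup>2)\<^sup>2 \<partial>?R)"
    by (rule Cauchy_Schwarz_integral) (use int[of 2] int[of 4] in \<open>auto simp: power_mult[symmetric]\<close>)
  moreover have "?a p * (?a p)\<^sup>2 = ?a p ^ 3" "((?a p)\<^sup>2)\<^sup>2 = ?a p ^ 4" for p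
    by (simp_all only: power3_eq_cube power4_eq_xxxx power2_eq_square mult.assoc)
  ultimately have "(\<integral>p. ?a p ^ 3 \<partial>?R)\<^sup>2 \<le> (\<integral>p. (?a p)\<^sup>2 \<partial>?R) * (\<integral>p. ?a p ^ 4 \<partial>?R)"
    by simp
  also have "\<dots> \<le> m * s * (m * q4 + 3 * (real m)\<^sup>2 * d2)"
    unfolding it using integral_integral_A2[of m] integral_integral_A4[of m]
    by (auto simp: s_def D_nonneg intro!: mult_left_mono mult_nonneg_nonneg)
  finally show ?thesis unfolding it by (rule real_le_rsqrt)
qed

section \<open>Fluctuation of the conditional variance\<close>

definition G :: "'a \<Rightarrow> 'a \<Rightarrow> real" where "G x y = (\<integral>z. H x z * H y z \<partial>Q)"
text \<open>\<open>G\<close> is the kernel of the square of the integral operator with kernel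
  \<open>H\<close>, and \<open>g2\<close> is its squared Hilbert-Schmidt norm, the sum of the fourth
  powers of the eigenvalues of \<open>H\<close>. Its smallness relative to \<open>s^2\<close>
  separates a Gaussian limit from a weighted sum of chi-square variables.\<close>

definition g2 :: real where "g2 = (\<integral>y. \<integral>x. (G x y)\<^sup>2 \<partial>Q \<partial>Q)"

lemma HH_le: "\<bar>H x z * H y w\<bar> \<le> B\<^sup>2"
  using mult_mono[OF H_bounded H_bounded] B_nonneg by (simp add: abs_mult power2_eq_square)

text \<open>Degenerate kernels are closed under this composition, so everything proved for
  \<open>H\<close> can be reused for \<open>G\<close>; that is how the fluctuation of
  \<open>V\<close> gets controlled.\<close>

lemma G_kernel: "degenerate_kernel Q G (B\<^sup>2)"
proof unfold_locales
  show "case_prod G \<in> borel_measurable (Q \<Otimes>\<^sub>M Q)"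
    unfolding G_def by measurable
  show "\<bar>G x y\<bar> \<le> B\<^sup>2" for x y
    unfolding G_def by (intro integral_bdd_le[OF prob_space_axioms] HH_le) measurable
  show "G x y = G y x" for x y unfolding G_def by (simp add: mult.commute)
  fix x
  have "(\<integral>y. G x y \<partial>Q) = (\<integral>z. \<integral>y. H x z * H y z \<partial>Q \<partial>Q)"
    unfolding G_def
    by (rule pair_sigma_finite.Fubini_integral[OF pair_sigma_finite_QQ], rule bounded_integrable[OF prob_space.axioms(1)[OF prob_space_QQ], where B="B\<^sup>2"])
       (use HH_le in \<open>auto simp: split_beta\<close>)
  then show "(\<integral>y. G x y \<partial>Q) = 0" by (simp add: H_degenerate')
qed


text \<open>The conditional variance of the next increment. Its mean is \<open>m s\<close>, and its deviation from the
  mean is again a martingale, whose increments are controlled by \<open>D\<close> and \<open>G\<close>.\<close>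

definition V :: "nat \<Rightarrow> (nat \<Rightarrow> 'a) \<Rightarrow> real" where "V m x = (\<integral>z. (A m x z)\<^sup>2 \<partial>Q)"

lemma V_measurable [measurable]: "V m \<in> borel_measurable (P m)"
  unfolding V_def by measurable

lemma V_bounded: "\<bar>V m x\<bar> \<le> (m * B)\<^sup>2"
  unfolding V_def using power_mono[OF A_bounded abs_ge_zero, of m _ _ 2]
  by (intro integral_bdd_le[OF prob_space_axioms]) (auto simp: power2_eq_square[symmetric])

lemma V_integrable: "integrable (P m) (\<lambda>x. V m x ^ k)"
  by (rule integrable_bdd_P[where C="((m * B)\<^sup>2) ^ k"]) (auto intro!: abs_power_le V_bounded simp del: power_abs)

lemma A3_integrable: "integrable (P m) (\<lambda>x. \<integral>z. \<bar>A m x z\<bar> ^ 3 \<partial>Q)"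
proof (rule integrable_bdd_P)
  fix x show "norm (\<integral>z. \<bar>A m x z\<bar> ^ 3 \<partial>Q) \<le> (m * B) ^ 3"
    unfolding real_norm_def
    by (intro integral_bdd_le[OF prob_space_axioms] abs_power_le) (auto simp: A_bounded)
qed measurable

lemma V_nonneg: "0 \<le> V m x" unfolding V_def by simp

lemma integral_V: "(\<integral>x. V m x \<partial>P m) = m * s"
  unfolding V_def by (rule integral_integral_A2)

text \<open>The square of \<open>A m x z + H y z\<close> is expanded under the integral: the cross
  terms are \<open>G\<close> by definition and the last square is \<open>D\<close>. Since
  \<open>G\<close> is degenerate, the average increase over the new point \<open>y\<close> is
  exactly \<open>s\<close>.\<close>

lemma V_Suc:
  "V (Suc m) (x(Suc m := y)) = V m x + 2 * (\<Sum>i\<in>{0<..m}. G (x i) y) + D y"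
proof -
  have i: "integrable Q (\<lambda>z. H (x i) z * H y z)" for i
    using HH_le by (intro integrable_bdd_Q[where C="B\<^sup>2"]) auto
  have "V (Suc m) (x(Suc m := y)) = (\<integral>z. (A m x z)\<^sup>2 + 2 * (\<Sum>i\<in>{0<..m}. H (x i) z * H y z) + (H y z)\<^sup>2 \<partial>Q)"
    unfolding V_def A_Suc
    by (intro Bochner_Integration.integral_cong refl)
       (simp add: power2_sum A_def sum_distrib_left sum_distrib_right mult.assoc)
  also have "\<dots> = V m x + 2 * (\<Sum>i\<in>{0<..m}. G (x i) y) + D y"
    using A_power_integrable(2)[of m x 2] H_power_integrable(2)[of y 2] i H_sym[of y]
    by (simp add: V_def G_def D_def integral_sum)
  finally show ?thesis .
qed

lemma d2_nonneg: "0 \<le> d2"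
  unfolding d2_def by simp

text \<open>The increment of the deviation is \<open>(D y - s) + 2 * GK.A m x y\<close>, which is
  centred in \<open>y\<close>, so there is no cross term with the old deviation. Its second moment
  is at most \<open>2 * d2 + 8 * GK.V m x\<close>, where \<open>GK.V\<close> is the same conditional
  variance formed with the kernel \<open>G\<close> and has mean \<open>m * g2\<close>. Summation
  over the steps turns \<open>8 * m * g2\<close> into less than \<open>4 * m^2 * g2\<close>.\<close>

lemma integral_V_deviation:
  "(\<integral>x. (V m x - m * s)\<^sup>2 \<partial>P m) \<le> 2 * real m * d2 + 4 * (real m)\<^sup>2 * g2"
proof -
  interpret GK: degenerate_kernel Q G "B\<^sup>2" by (rule G_kernel)
  have g2: "GK.s = g2" by (simp add: GK.s_def GK.D_def g2_def)
  have s0: "0 \<le> s" by (simp add: s_def D_nonneg)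
  have s_le: "s \<le> B\<^sup>2" using integral_bdd_le[OF prob_space_axioms, of D "B\<^sup>2"] D_le D_nonneg by (simp add: s_def)
  have R_int: "integrable (P m) (\<lambda>x. (V m x - m * s) ^ k)" for m k
  proof (rule integrable_bdd_P)
    fix x have "\<bar>V m x - m * s\<bar> \<le> (m * B)\<^sup>2 + m * s"
      using V_bounded[of m x] s0 by (simp add: abs_le_iff) (smt (verit) mult_nonneg_nonneg of_nat_0_le_iff)
    then show "norm ((V m x - m * s) ^ k) \<le> ((m * B)\<^sup>2 + m * s) ^ k"
      by (simp add: power_abs power_mono)
  qed measurable
  show ?thesis
  proof (induction m)
    case 0
    then show ?case by (simp add: V_def A_def)
  next
    case (Suc m)
    have inner: "(\<integral>y. (V (Suc m) (x(Suc m := y)) - Suc m * s)\<^sup>2 \<partial>Q)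
        \<le> (V m x - m * s)\<^sup>2 + 2 * d2 + 8 * GK.V m x" for x
    proof -
      define R where "R = V m x - m * s"
      have e: "V (Suc m) (x(Suc m := y)) - Suc m * s = R + ((D y - s) + 2 * GK.A m x y)" for y
        by (simp add: V_Suc GK.A_def R_def algebra_simps)
      have iA: "integrable Q (\<lambda>y. (GK.A m x y) ^ k)" for k by (rule GK.A_power_integrable(2))
      have iD: "integrable Q (\<lambda>y. D y - s)" using D_integrable by simp
      have iDA: "integrable Q (\<lambda>y. D y - s + 2 * GK.A m x y)" using iD iA[of 1] by simp
      have iD2: "integrable Q (\<lambda>y. (D y - s)\<^sup>2)" using D_integrable by (simp add: power2_diff)
      have iDA2: "integrable Q (\<lambda>y. (D y - s + 2 * GK.A m x y)\<^sup>2)"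
        using iD2 iA[of 2] by (intro integrable_power2_add) (auto simp: power_mult_distrib)
      have A0: "(\<integral>y. GK.A m x y \<partial>Q) = 0"
        unfolding GK.A_def using GK.H_power_integrable(2)[of _ 1] by (simp add: integral_sum GK.H_degenerate)
      have m0: "(\<integral>y. D y - s + 2 * GK.A m x y \<partial>Q) = 0"
        using D_integrable iA[of 1] by (simp add: A0 s_def prob_space)
      have "(\<integral>y. (D y - s + 2 * GK.A m x y)\<^sup>2 \<partial>Q) \<le> (\<integral>y. 2 * (D y - s)\<^sup>2 + 8 * (GK.A m x y)\<^sup>2 \<partial>Q)"
      proof (rule integral_mono[OF iDA2])
        show "integrable Q (\<lambda>y. 2 * (D y - s)\<^sup>2 + 8 * (GK.A m x y)\<^sup>2)" using iD2 iA[of 2] by simp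
        fix y
        have "0 \<le> (D y - s - 2 * GK.A m x y)\<^sup>2" by simp
        then show "(D y - s + 2 * GK.A m x y)\<^sup>2 \<le> 2 * (D y - s)\<^sup>2 + 8 * (GK.A m x y)\<^sup>2"
          by (simp add: power2_eq_square algebra_simps)
      qed
      also have "\<dots> = 2 * (\<integral>y. (D y - s)\<^sup>2 \<partial>Q) + 8 * GK.V m x"
        using iD2 iA[of 2] by (simp add: GK.V_def)
      also have "(\<integral>y. (D y - s)\<^sup>2 \<partial>Q) = (\<integral>y. (D y)\<^sup>2 - 2 * s * D y + s\<^sup>2 \<partial>Q)"
        by (simp add: power2_diff algebra_simps)
      also have "\<dots> = d2 - 2 * s * s + s\<^sup>2"
        using D_integrable by (simp add: d2_def s_def[symmetric])
      also have "\<dots> = d2 - s\<^sup>2" by (simp add: power2_eq_square)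
      finally have b: "(\<integral>y. (D y - s + 2 * GK.A m x y)\<^sup>2 \<partial>Q) \<le> 2 * d2 + 8 * GK.V m x"
        by (rule order_trans) simp
      have "(\<integral>y. (R + ((D y - s) + 2 * GK.A m x y))\<^sup>2 \<partial>Q)
          = (\<integral>y. R\<^sup>2 + 2 * R * (D y - s + 2 * GK.A m x y) + (D y - s + 2 * GK.A m x y)\<^sup>2 \<partial>Q)"
        by (intro Bochner_Integration.integral_cong refl) (simp add: power2_eq_square algebra_simps)
      also have "\<dots> = R\<^sup>2 + (\<integral>y. (D y - s + 2 * GK.A m x y)\<^sup>2 \<partial>Q)"
        using iDA iDA2 m0 by (simp add: prob_space)
      finally show ?thesis unfolding e using b by (simp add: R_def)
    qed
    have iV: "integrable (P m) (GK.V m)"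
      by (rule integrable_bdd_P[where C="(m * B\<^sup>2)\<^sup>2"]) (use GK.V_bounded[of m] in auto)
    have "(\<integral>x. (V (Suc m) x - Suc m * s)\<^sup>2 \<partial>P (Suc m))
        = (\<integral>x. \<integral>y. (V (Suc m) (x(Suc m := y)) - Suc m * s)\<^sup>2 \<partial>Q \<partial>P m)"
      by (rule integral_P_Suc[OF R_int])
    also have "\<dots> \<le> (\<integral>x. (V m x - m * s)\<^sup>2 + 2 * d2 + 8 * GK.V m x \<partial>P m)"
    proof (rule integral_mono_AE')
      show "integrable (P m) (\<lambda>x. (V m x - m * s)\<^sup>2 + 2 * d2 + 8 * GK.V m x)"
        using iV R_int[of m 2] by simp
    qed (use inner GK.V_nonneg d2_nonneg in auto)
    also have "\<dots> = (\<integral>x. (V m x - m * s)\<^sup>2 \<partial>P m) + 2 * d2 + 8 * (m * g2)"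
      using iV R_int[of m 2] GK.integral_V[of m] by (simp add: measure_P g2)
    also have "\<dots> \<le> 2 * real m * d2 + 4 * (real m)\<^sup>2 * g2 + 2 * d2 + 8 * (m * g2)"
      using Suc by simp
    also have "\<dots> \<le> 2 * real (Suc m) * d2 + 4 * (real (Suc m))\<^sup>2 * g2"
    proof -
      have "0 \<le> g2" unfolding g2_def by simp
      then show ?thesis by (simp add: power2_eq_square algebra_simps)
    qed
    finally show ?case .
  qed
qed

section \<open>Characteristic function of a degenerate U-statistic\<close>

definition S :: "nat \<Rightarrow> (nat \<Rightarrow> 'a) \<Rightarrow> real" where
  "S m x = (\<Sum>j\<in>{0<..m}. A (j - 1) x (x j))"

lemma S_measurable [measurable]: "S m \<in> borel_measurable (P m)"
  unfolding S_def A_def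
proof (intro borel_measurable_sum)
  fix j i assume "j \<in> {0<..m}" "i \<in> {0<..j - 1}"
  then have [measurable]: "j \<in> {0<..m}" "i \<in> {0<..m}" by auto
  show "(\<lambda>x. H (x i) (x j)) \<in> borel_measurable (P m)" by measurable
qed

text \<open>This is why pairs are grouped by their larger index: earlier groups do not see the new
  point. As \<open>j\<close> is positive, \<open>j - 1\<close> in \<open>S\<close> is a true
  predecessor.\<close>

lemma S_Suc: "S (Suc m) (x(Suc m := y)) = S m x + A m x y"
proof -
  have "A (j - 1) (x(Suc m := y)) z = A (j - 1) x z" if "j \<in> {0<..m}" for j z
    unfolding A_def using that by (intro sum.cong) auto
  then have "(\<Sum>j\<in>{0<..m}. A (j - 1) (x(Suc m := y)) ((x(Suc m := y)) j)) = S m x"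
    unfolding S_def by (intro sum.cong) auto
  then show ?thesis by (simp add: S_def greaterThanAtMost_0_Suc)
qed

text \<open>One summand for each approximation made when a point is added: the third-order Taylor
  remainder, the replacement of the conditional variance by its mean, and the replacement of
  \<open>1 - u\<close> by \<open>exp (- u)\<close> for \<open>u = t^2 * m * s / 2\<close>.\<close>

definition step_error :: "real \<Rightarrow> nat \<Rightarrow> real" where
  "step_error t m = \<bar>t\<bar> ^ 3 / 6 * sqrt (m * s * (m * q4 + 3 * (real m)\<^sup>2 * d2))
    + t\<^sup>2 / 2 * sqrt (2 * real m * d2 + 4 * (real m)\<^sup>2 * g2) + t ^ 4 * (real m)\<^sup>2 * s\<^sup>2 / 8"

text \<open>Degeneracy removes the linear term of the expansion, and the quadratic one integrates to
  \<open>V m x\<close>. The comparison factor is deterministic, so it can be pulled out of the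
  integral over the old sample afterwards.\<close>

lemma integral_iexp_A_approx:
  "cmod ((\<integral>z. iexp (t * A m x z) \<partial>Q) - exp (- (t\<^sup>2 * m * s / 2)))
    \<le> \<bar>t\<bar> ^ 3 / 6 * (\<integral>z. \<bar>A m x z\<bar> ^ 3 \<partial>Q) + t\<^sup>2 / 2 * \<bar>V m x - m * s\<bar> + t ^ 4 * (real m)\<^sup>2 * s\<^sup>2 / 8"
proof -
  have iA: "integrable Q (\<lambda>z. A m x z ^ k)" for k by (rule A_power_integrable(2))
  have iA3: "integrable Q (\<lambda>z. \<bar>A m x z\<bar> ^ 3)" using integrable_abs[OF iA[of 3]] by (simp add: power_abs)
  have ie: "integrable Q (\<lambda>z. iexp (t * A m x z))" by (rule integrable_bdd_Q[where C=1]) auto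
  have A0: "(\<integral>z. A m x z \<partial>Q) = 0"
    unfolding A_def using H_power_integrable(2)[of _ 1] by (simp add: integral_sum H_degenerate)
  let ?q = "\<lambda>z. 1 + \<i> * complex_of_real (t * A m x z) - complex_of_real ((t * A m x z)\<^sup>2) / 2"
  have iq1: "integrable Q (\<lambda>z. complex_of_real (t * A m x z))" using iA[of 1] by (intro integrable_of_real) simp
  have iq2: "integrable Q (\<lambda>z. complex_of_real ((t * A m x z)\<^sup>2))"
    using iA[of 2] by (intro integrable_of_real) (simp add: power_mult_distrib)
  have iq: "integrable Q ?q"
    using iq1 iq2 by (intro Bochner_Integration.integrable_add Bochner_Integration.integrable_diff) auto
  have "(\<integral>z. ?q z \<partial>Q) = 1 + \<i> * complex_of_real (\<integral>z. t * A m x z \<partial>Q) - complex_of_real (\<integral>z. (t * A m x z)\<^sup>2 \<partial>Q) / 2"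
    using iq1 iq2 by (simp add: prob_space integral_complex_of_real del: of_real_mult of_real_power)
  also have "\<dots> = complex_of_real (1 - t\<^sup>2 * V m x / 2)"
    by (simp add: A0 power_mult_distrib V_def)
  finally have eq: "(\<integral>z. ?q z \<partial>Q) = complex_of_real (1 - t\<^sup>2 * V m x / 2)" .
  have "cmod ((\<integral>z. iexp (t * A m x z) \<partial>Q) - (\<integral>z. ?q z \<partial>Q)) = cmod (\<integral>z. iexp (t * A m x z) - ?q z \<partial>Q)"
    by (simp only: Bochner_Integration.integral_diff[OF ie iq])
  also have "\<dots> \<le> (\<integral>z. cmod (iexp (t * A m x z) - ?q z) \<partial>Q)" by (rule integral_norm_bound)
  also have "\<dots> \<le> (\<integral>z. \<bar>t\<bar> ^ 3 / 6 * \<bar>A m x z\<bar> ^ 3 \<partial>Q)"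
  proof (rule integral_mono)
    show "integrable Q (\<lambda>z. cmod (iexp (t * A m x z) - ?q z))"
      by (rule integrable_norm[OF Bochner_Integration.integrable_diff[OF ie iq]])
    show "integrable Q (\<lambda>z. \<bar>t\<bar> ^ 3 / 6 * \<bar>A m x z\<bar> ^ 3)" using iA3 by simp
    fix z show "cmod (iexp (t * A m x z) - ?q z) \<le> \<bar>t\<bar> ^ 3 / 6 * \<bar>A m x z\<bar> ^ 3"
      using iexp_quadratic_approx[of "t * A m x z"] by (simp add: abs_mult power_mult_distrib)
  qed
  finally have 1: "cmod ((\<integral>z. iexp (t * A m x z) \<partial>Q) - complex_of_real (1 - t\<^sup>2 * V m x / 2))
      \<le> \<bar>t\<bar> ^ 3 / 6 * (\<integral>z. \<bar>A m x z\<bar> ^ 3 \<partial>Q)" unfolding eq using iA3 by simp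
  have "(1 - t\<^sup>2 * V m x / 2) - (1 - t\<^sup>2 * m * s / 2) = - (t\<^sup>2 / 2) * (V m x - m * s)"
    by (simp add: field_simps)
  then have "\<bar>(1 - t\<^sup>2 * V m x / 2) - (1 - t\<^sup>2 * m * s / 2)\<bar> = t\<^sup>2 / 2 * \<bar>V m x - m * s\<bar>"
    by (simp only: abs_mult abs_minus_cancel) simp
  moreover have "\<bar>exp (- (t\<^sup>2 * m * s / 2)) - (1 - t\<^sup>2 * m * s / 2)\<bar> \<le> (t\<^sup>2 * m * s / 2)\<^sup>2 / 2"
    by (rule exp_minus_linear_approx) (simp add: s_def D_nonneg)
  moreover have "(t\<^sup>2 * m * s / 2)\<^sup>2 / 2 = t ^ 4 * (real m)\<^sup>2 * s\<^sup>2 / 8"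
    by (simp add: power_mult_distrib power_divide)
  ultimately have "\<bar>(1 - t\<^sup>2 * V m x / 2) - exp (- (t\<^sup>2 * m * s / 2))\<bar>
      \<le> t\<^sup>2 / 2 * \<bar>V m x - m * s\<bar> + t ^ 4 * (real m)\<^sup>2 * s\<^sup>2 / 8" by linarith
  then have "cmod (complex_of_real (1 - t\<^sup>2 * V m x / 2) - complex_of_real (exp (- (t\<^sup>2 * m * s / 2))))
      \<le> t\<^sup>2 / 2 * \<bar>V m x - m * s\<bar> + t ^ 4 * (real m)\<^sup>2 * s\<^sup>2 / 8"
    by (simp only: norm_of_real of_real_diff[symmetric])
  with 1 show ?thesis
    using norm_triangle_ineq[of "(\<integral>z. iexp (t * A m x z) \<partial>Q) - complex_of_real (1 - t\<^sup>2 * V m x / 2)"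
        "complex_of_real (1 - t\<^sup>2 * V m x / 2) - complex_of_real (exp (- (t\<^sup>2 * m * s / 2)))"]
    by simp
qed

text \<open>The phase of the old sum has modulus one and does not involve the new point: it leaves
  the inner integral and costs nothing in absolute value. It does depend on the same points as
  \<open>V\<close>, which is why the deviation of \<open>V\<close> is needed in mean absolute value
  and the vanishing of its mean would not suffice.\<close>

lemma integral_iexp_S_step:
  "cmod ((\<integral>x. iexp (t * S (Suc m) x) \<partial>P (Suc m)) - exp (- (t\<^sup>2 * m * s / 2)) * (\<integral>x. iexp (t * S m x) \<partial>P m))
    \<le> step_error t m"
proof -
  let ?J = "\<lambda>x. \<integral>z. iexp (t * A m x z) \<partial>Q"
  let ?e = "complex_of_real (exp (- (t\<^sup>2 * m * s / 2)))"
  have iS: "integrable (P m) (\<lambda>x. iexp (t * S m x))" for m by (rule integrable_bdd_P[where C=1]) auto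
  have nJ: "cmod (?J x) \<le> 1" for x
  proof -
    have "cmod (?J x) \<le> (\<integral>z. cmod (iexp (t * A m x z)) \<partial>Q)" by (rule integral_norm_bound)
    then show ?thesis by (simp add: prob_space)
  qed
  have [measurable]: "?J \<in> borel_measurable (P m)" by measurable
  have iJ: "integrable (P m) (\<lambda>x. iexp (t * S m x) * ?J x)"
    using nJ by (intro integrable_bdd_P[where C=1]) (auto simp: norm_mult)
  have "(\<integral>x. iexp (t * S (Suc m) x) \<partial>P (Suc m)) = (\<integral>x. \<integral>z. iexp (t * (S m x + A m x z)) \<partial>Q \<partial>P m)"
    by (subst integral_P_Suc[OF iS]) (simp only: S_Suc)
  also have "\<dots> = (\<integral>x. iexp (t * S m x) * ?J x \<partial>P m)"
    by (simp add: distrib_left exp_add del: of_real_mult)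
  finally have "(\<integral>x. iexp (t * S (Suc m) x) \<partial>P (Suc m)) - ?e * (\<integral>x. iexp (t * S m x) \<partial>P m)
      = (\<integral>x. iexp (t * S m x) * ?J x \<partial>P m) - (\<integral>x. iexp (t * S m x) * ?e \<partial>P m)"
    using iS[of m] by (simp only: Bochner_Integration.integral_mult_left mult.commute)
  also have "\<dots> = (\<integral>x. iexp (t * S m x) * ?J x - iexp (t * S m x) * ?e \<partial>P m)"
    by (rule Bochner_Integration.integral_diff[symmetric]) (use iJ iS[of m] in auto)
  finally have eq: "(\<integral>x. iexp (t * S (Suc m) x) \<partial>P (Suc m)) - ?e * (\<integral>x. iexp (t * S m x) \<partial>P m)
      = (\<integral>x. iexp (t * S m x) * (?J x - ?e) \<partial>P m)"
    by (simp only: right_diff_distrib)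
  have "cmod (\<integral>x. iexp (t * S m x) * (?J x - ?e) \<partial>P m)
      \<le> (\<integral>x. cmod (iexp (t * S m x) * (?J x - ?e)) \<partial>P m)"
    by (rule integral_norm_bound)
  also have "\<dots> = (\<integral>x. cmod (?J x - ?e) \<partial>P m)" by (simp only: norm_mult norm_exp_i_times mult_1_left)
  also have "\<dots> \<le> (\<integral>x. \<bar>t\<bar> ^ 3 / 6 * (\<integral>z. \<bar>A m x z\<bar> ^ 3 \<partial>Q) + t\<^sup>2 / 2 * \<bar>V m x - m * s\<bar>
      + t ^ 4 * (real m)\<^sup>2 * s\<^sup>2 / 8 \<partial>P m)"
  proof (rule integral_mono_AE')
    show "integrable (P m) (\<lambda>x. \<bar>t\<bar> ^ 3 / 6 * (\<integral>z. \<bar>A m x z\<bar> ^ 3 \<partial>Q) + t\<^sup>2 / 2 * \<bar>V m x - m * s\<bar>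
      + t ^ 4 * (real m)\<^sup>2 * s\<^sup>2 / 8)" using V_integrable[of m 1] A3_integrable[of m] by simp
  qed (use integral_iexp_A_approx in auto)
  also have "\<dots> = \<bar>t\<bar> ^ 3 / 6 * (\<integral>x. \<integral>z. \<bar>A m x z\<bar> ^ 3 \<partial>Q \<partial>P m) + t\<^sup>2 / 2 * (\<integral>x. \<bar>V m x - m * s\<bar> \<partial>P m)
      + t ^ 4 * (real m)\<^sup>2 * s\<^sup>2 / 8"
  proof -
    show ?thesis using V_integrable[of m 1] A3_integrable[of m] by simp
  qed
  also have "\<dots> \<le> step_error t m"
  proof -
    have "(\<integral>x. \<bar>V m x - m * s\<bar> \<partial>P m) \<le> sqrt (\<integral>x. (V m x - m * s)\<^sup>2 \<partial>P m)"
    proof (rule prob_space.integral_abs_le_sqrt[OF prob_space_P])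
      show "integrable (P m) (\<lambda>x. (V m x - m * s)\<^sup>2)"
        using V_integrable[of m 1] V_integrable[of m 2] by (simp add: power2_diff)
    qed measurable
    also have "\<dots> \<le> sqrt (2 * real m * d2 + 4 * (real m)\<^sup>2 * g2)"
      by (intro real_sqrt_le_mono integral_V_deviation)
    finally show ?thesis
      unfolding step_error_def using integral_integral_abs_A3[of m]
      by (intro add_mono mult_left_mono order_refl) auto
  qed
  finally show ?thesis unfolding eq .
qed

text \<open>The deterministic factors multiply to the stated exponential because the
  \<open>m\<close> below \<open>n\<close> add up to \<open>n * (n - 1) / 2\<close>. Each factor is
  at most 1, so old errors are not amplified; monotonicity of \<open>step_error\<close> then bounds
  their sum.\<close>

theorem char_S_approx:
  "cmod ((\<integral>x. iexp (t * S n x) \<partial>P n) - exp (- (t\<^sup>2 * s * (real n * (real n - 1)) / 4))) \<le> n * step_error t n"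
proof -
  have q: "0 \<le> s" "0 \<le> q4" "0 \<le> d2" "0 \<le> g2" by (auto simp: s_def q4_def d2_def g2_def D_nonneg)
  have mono: "step_error t m \<le> step_error t n" if "m \<le> n" for m n
    unfolding step_error_def using that q
    by (intro add_mono mult_left_mono real_sqrt_le_mono mult_mono divide_right_mono power_mono mult_nonneg_nonneg add_nonneg_nonneg) auto
  have "cmod ((\<integral>x. iexp (t * S n x) \<partial>P n) - exp (- (t\<^sup>2 * s * (real n * (real n - 1)) / 4))) \<le> (\<Sum>m<n. step_error t m)"
  proof (induction n)
    case 0
    then show ?case using measure_P[of 0] by (simp add: S_def)
  next
    case (Suc n)
    let ?f = "\<lambda>n. \<integral>x. iexp (t * S n x) \<partial>P n"
    let ?E = "\<lambda>n. complex_of_real (exp (- (t\<^sup>2 * s * (real n * (real n - 1)) / 4)))"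
    let ?e = "complex_of_real (exp (- (t\<^sup>2 * n * s / 2)))"
    have "- (t\<^sup>2 * s * (real (Suc n) * (real (Suc n) - 1)) / 4) = - (t\<^sup>2 * n * s / 2) + - (t\<^sup>2 * s * (real n * (real n - 1)) / 4)"
      by (simp add: field_simps)
    then have E: "?E (Suc n) = ?e * ?E n"
      by (simp only: exp_add of_real_mult)
    have "?f (Suc n) - ?E (Suc n) = (?f (Suc n) - ?e * ?f n) + ?e * (?f n - ?E n)"
      unfolding E by (simp add: right_diff_distrib)
    then have "cmod (?f (Suc n) - ?E (Suc n)) \<le> cmod (?f (Suc n) - ?e * ?f n) + cmod (?e * (?f n - ?E n))"
      by (metis norm_triangle_ineq)
    also have "cmod (?e * (?f n - ?E n)) \<le> 1 * cmod (?f n - ?E n)"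
      unfolding norm_mult norm_of_real using q by (intro mult_right_mono) auto
    finally show ?case using integral_iexp_S_step[of n t] Suc by simp
  qed
  also have "\<dots> \<le> (\<Sum>m<n. step_error t n)" by (intro sum_mono mono) auto
  finally show ?thesis by simp
qed

end

section \<open>Hoeffding's decomposition\<close>

lemma (in iid_sample) distr_P_component:
  assumes "i \<in> {0<..n}"
  shows "distr (P n) Q (\<lambda>x. x i) = Q"
proof -
  interpret PS: product_prob_space "\<lambda>_::nat. Q" "{0<..n}" by unfold_locales
  show ?thesis using PS.PiM_component[OF assms] .
qed

lemma (in iid_sample) distr_P_pair:
  assumes i: "i \<in> {0<..n}" and j: "j \<in> {0<..n}" and ij: "i \<noteq> j"
  shows "distr (P n) (Q \<Otimes>\<^sub>M Q) (\<lambda>x. (x i, x j)) = Q \<Otimes>\<^sub>M Q"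
proof (rule pair_measure_eqI[symmetric])
  show "sigma_finite_measure Q" "sigma_finite_measure Q" by (rule sigma_finite_measure_axioms)+
  show "sets (Q \<Otimes>\<^sub>M Q) = sets (distr (P n) (Q \<Otimes>\<^sub>M Q) (\<lambda>x. (x i, x j)))" by simp
  fix A B assume [measurable]: "A \<in> sets Q" "B \<in> sets Q"
  interpret PS: product_prob_space "\<lambda>_::nat. Q" "{0<..n}" by unfold_locales
  have [measurable]: "(\<lambda>x. x i) \<in> measurable (P n) Q" "(\<lambda>x. x j) \<in> measurable (P n) Q"
    using i j by (auto intro!: measurable_component_singleton simp del: greaterThanAtMost_iff)
  have "emeasure (distr (P n) (Q \<Otimes>\<^sub>M Q) (\<lambda>x. (x i, x j))) (A \<times> B)
      = emeasure (P n) ((\<lambda>x. (x i, x j)) -` (A \<times> B) \<inter> space (P n))"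
    by (rule emeasure_distr) measurable
  also have "(\<lambda>x. (x i, x j)) -` (A \<times> B) \<inter> space (P n)
      = {x \<in> space (P n). \<forall>k\<in>{i, j}. x k \<in> (if k = i then A else B)}"
    using ij by auto
  also have "emeasure (P n) \<dots> = (\<Prod>k\<in>{i, j}. emeasure Q (if k = i then A else B))"
    by (rule PS.emeasure_PiM_Collect) (use i j in auto)
  finally show "emeasure Q A * emeasure Q B = emeasure (distr (P n) (Q \<Otimes>\<^sub>M Q) (\<lambda>x. (x i, x j))) (A \<times> B)"
    using ij by simp
qed

text \<open>Integrating coordinate \<open>i\<close> first annihilates \<open>G\<close> while
  \<open>F\<close> stays constant. All orthogonality relations between summands below are instances
  of this.\<close>

lemma (in iid_sample) integral_P_orthogonal:
  fixes F G :: "(nat \<Rightarrow> 'a) \<Rightarrow> real"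
  assumes i: "i \<in> {0<..n}" and FG: "integrable (P n) (\<lambda>x. F x * G x)"
    and F: "\<And>x z. F (x(i := z)) = F x" and G: "\<And>x. (\<integral>z. G (x(i := z)) \<partial>Q) = 0"
  shows "(\<integral>x. F x * G x \<partial>P n) = 0"
proof -
  interpret PS: product_sigma_finite "\<lambda>_::nat. Q" by unfold_locales
  have ins: "{0<..n} = insert i ({0<..n} - {i})" using i by auto
  have "(\<integral>x. F x * G x \<partial>P n) = (\<integral>x. \<integral>z. F (x(i := z)) * G (x(i := z)) \<partial>Q \<partial>Pi\<^sub>M ({0<..n} - {i}) (\<lambda>_. Q))"
    by (subst ins, rule PS.product_integral_insert) (use FG ins in auto)
  then show ?thesis by (simp add: F G)
qed

section \<open>Second moments of sums over pairs and over points\<close>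

definition ustat :: "('a \<Rightarrow> 'a \<Rightarrow> real) \<Rightarrow> nat \<Rightarrow> (nat \<Rightarrow> 'a) \<Rightarrow> real" where
  "ustat w n x = (\<Sum>j\<in>{0<..n}. \<Sum>i\<in>{0<..j - 1}. w (x i) (x j))"

lemma ustat_eq_sum_Sigma:
  "ustat w n x = (\<Sum>p\<in>Sigma {0<..n} (\<lambda>j. {0<..j - 1}). w (x (snd p)) (x (fst p)))"
  unfolding ustat_def by (subst sum.Sigma) (auto simp: case_prod_unfold)

lemma card_index_pairs:
  "real (card (Sigma {0<..n} (\<lambda>j. {0<..j - 1::nat}))) = real n * (real n - 1) / 2"
proof -
  have "real (card (Sigma {0<..n} (\<lambda>j. {0<..j - 1::nat}))) = (\<Sum>j\<in>{0<..n}. real (j - 1))"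
    by simp
  also have "\<dots> = real n * (real n - 1) / 2"
    by (induction n) (auto simp: greaterThanAtMost_0_Suc field_simps)
  finally show ?thesis .
qed

lemma ustat_add: "ustat (\<lambda>x y. v x y + w x y) n x = ustat v n x + ustat w n x"
  unfolding ustat_def by (simp add: sum.distrib)

lemma (in iid_sample) ustat_measurable:
  assumes [measurable]: "case_prod w \<in> borel_measurable (Q \<Otimes>\<^sub>M Q)"
  shows "ustat w n \<in> borel_measurable (P n)"
  unfolding ustat_def
proof (intro borel_measurable_sum)
  fix j i assume "j \<in> {0<..n}" "i \<in> {0<..j - 1}"
  then have [measurable]: "j \<in> {0<..n}" "i \<in> {0<..n}" by auto
  show "(\<lambda>x. w (x i) (x j)) \<in> borel_measurable (P n)" by measurable
qed

lemma (in degenerate_kernel) S_eq_ustat: "S n x = ustat H n x"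
  unfolding S_def A_def ustat_def ..

text \<open>Only square integrability is assumed, since this is applied to the full kernel and to
  its short edges, which are unbounded for negative exponents.\<close>

lemma (in iid_sample) integral_ustat_degenerate_power2:
  assumes H[measurable]: "case_prod H \<in> borel_measurable (Q \<Otimes>\<^sub>M Q)"
    and H2: "integrable (Q \<Otimes>\<^sub>M Q) (\<lambda>(x, y). (H x y)\<^sup>2)"
    and sym: "\<And>x y. H x y = H y x" and deg: "\<And>x. (\<integral>y. H x y \<partial>Q) = 0"
  shows "integrable (P n) (\<lambda>x. (ustat H n x)\<^sup>2)"
    and "(\<integral>x. (ustat H n x)\<^sup>2 \<partial>P n) = real n * (real n - 1) / 2 * (\<integral>(x, y). (H x y)\<^sup>2 \<partial>(Q \<Otimes>\<^sub>M Q))"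
proof -
  let ?I = "Sigma {0<..n} (\<lambda>j. {0<..j - 1})"
  let ?f = "\<lambda>p x. H (x (snd p)) (x (fst p))"
  let ?s = "\<integral>(x, y). (H x y)\<^sup>2 \<partial>(Q \<Otimes>\<^sub>M Q)"
  have mem: "fst p \<in> {0<..n}" "snd p \<in> {0<..n}" "snd p \<noteq> fst p" "snd p < fst p" if "p \<in> ?I" for p
    using that by auto
  have m: "?f p \<in> borel_measurable (P n)" if "p \<in> ?I" for p
    using mem[OF that, measurable] by measurable
  have mp: "(\<lambda>x. (x (snd p), x (fst p))) \<in> measurable (P n) (Q \<Otimes>\<^sub>M Q)" if "p \<in> ?I" for p
    using mem[OF that, measurable] by measurable
  have i2: "integrable (P n) (\<lambda>x. (?f p x)\<^sup>2)" if p: "p \<in> ?I" for p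
  proof -
    have "integrable (distr (P n) (Q \<Otimes>\<^sub>M Q) (\<lambda>x. (x (snd p), x (fst p)))) (\<lambda>(x, y). (H x y)\<^sup>2)"
      using H2 by (simp only: distr_P_pair[OF mem(2,1,3)[OF p]])
    then show ?thesis by (subst (asm) integrable_distr_eq[OF mp[OF p]]) auto
  qed
  have diag: "(\<integral>x. ?f p x * ?f p x \<partial>P n) = ?s" if p: "p \<in> ?I" for p
  proof -
    have "?s = (\<integral>(x, y). (H x y)\<^sup>2 \<partial>distr (P n) (Q \<Otimes>\<^sub>M Q) (\<lambda>x. (x (snd p), x (fst p))))"
      by (simp only: distr_P_pair[OF mem(2,1,3)[OF p]])
    also have "\<dots> = (\<integral>x. ?f p x * ?f p x \<partial>P n)"
      by (subst integral_distr[OF mp[OF p]]) (auto simp: power2_eq_square)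
    finally show ?thesis by simp
  qed
  have off: "(\<integral>x. ?f p x * ?f q x \<partial>P n) = 0" if p: "p \<in> ?I" and q: "q \<in> ?I" and pq: "p \<noteq> q" for p q
  proof -
    have int: "integrable (P n) (\<lambda>x. ?f p x * ?f q x)"
      by (rule Cauchy_Schwarz_integral(1)[OF m[OF p] m[OF q] i2[OF p] i2[OF q]])
    \<comment> \<open>Two distinct two-element sets of indices: one index of \<open>q\<close> is
      missing from \<open>p\<close>, and integrating out that coordinate gives 0.\<close>
    consider "fst q \<notin> {fst p, snd p}" | "snd q \<notin> {fst p, snd p}"
      using mem(4)[OF p] mem(4)[OF q] pq by (cases p; cases q) force
    then show ?thesis
    proof cases
      case 1
      then show ?thesis using mem[OF q] mem[OF p] deg
        by (intro integral_P_orthogonal[OF mem(1)[OF q] int]) auto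
    next
      case 2
      then show ?thesis using mem[OF q] mem[OF p] deg
        by (intro integral_P_orthogonal[OF mem(2)[OF q] int]) (auto simp: sym[of _ "_ (fst q)"])
    qed
  qed
  have fin: "finite ?I" by simp
  show "integrable (P n) (\<lambda>x. (ustat H n x)\<^sup>2)"
    unfolding ustat_eq_sum_Sigma by (rule integrable_sum_power2(1)[OF fin m i2])
  have "(\<integral>x. (ustat H n x)\<^sup>2 \<partial>P n) = (\<Sum>p\<in>?I. \<Sum>q\<in>?I. \<integral>x. ?f p x * ?f q x \<partial>P n)"
    unfolding ustat_eq_sum_Sigma by (rule integrable_sum_power2(2)[OF fin m i2])
  also have "\<dots> = (\<Sum>p\<in>?I. \<Sum>q\<in>?I. if p = q then ?s else 0)"
    using diag off by (intro sum.cong refl) auto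
  also have "\<dots> = real (card ?I) * ?s"
    using fin by (simp add: sum.delta')
  finally show "(\<integral>x. (ustat H n x)\<^sup>2 \<partial>P n) = real n * (real n - 1) / 2 * ?s"
    unfolding card_index_pairs .
qed

lemma (in iid_sample) integral_centred_sum_power2:
  fixes h :: "'a \<Rightarrow> real"
  assumes h[measurable]: "h \<in> borel_measurable Q" and h2: "integrable Q (\<lambda>x. (h x)\<^sup>2)"
    and h0: "(\<integral>x. h x \<partial>Q) = 0"
  shows "integrable (P n) (\<lambda>x. (\<Sum>i\<in>{0<..n}. h (x i))\<^sup>2)"
    and "(\<integral>x. (\<Sum>i\<in>{0<..n}. h (x i))\<^sup>2 \<partial>P n) = n * (\<integral>x. (h x)\<^sup>2 \<partial>Q)"
proof -
  have c: "(\<lambda>x. x i) \<in> measurable (P n) Q" if "i \<in> {0<..n}" for i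
    using that by (rule measurable_component_singleton)
  have m: "(\<lambda>x. h (x i)) \<in> borel_measurable (P n)" if "i \<in> {0<..n}" for i
    using c[OF that, measurable] by measurable
  have i2: "integrable (P n) (\<lambda>x. (h (x i))\<^sup>2)" if "i \<in> {0<..n}" for i
  proof -
    have "integrable (distr (P n) Q (\<lambda>x. x i)) (\<lambda>x. (h x)\<^sup>2)"
      using h2 by (simp only: distr_P_component[OF that])
    then show ?thesis by (subst (asm) integrable_distr_eq[OF c[OF that]]) auto
  qed
  have diag: "(\<integral>x. h (x i) * h (x i) \<partial>P n) = (\<integral>x. (h x)\<^sup>2 \<partial>Q)" if "i \<in> {0<..n}" for i
  proof -
    have "(\<integral>x. (h x)\<^sup>2 \<partial>Q) = (\<integral>x. (h x)\<^sup>2 \<partial>distr (P n) Q (\<lambda>x. x i))"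
      by (simp only: distr_P_component[OF that])
    also have "\<dots> = (\<integral>x. h (x i) * h (x i) \<partial>P n)"
      by (subst integral_distr[OF c[OF that]]) (auto simp: power2_eq_square)
    finally show ?thesis by simp
  qed
  have off: "(\<integral>x. h (x i) * h (x j) \<partial>P n) = 0" if "i \<in> {0<..n}" "j \<in> {0<..n}" "i \<noteq> j" for i j
    using that h0 by (intro integral_P_orthogonal[of j]
      Cauchy_Schwarz_integral(1)[OF m m i2 i2]) auto
  show "integrable (P n) (\<lambda>x. (\<Sum>i\<in>{0<..n}. h (x i))\<^sup>2)"
    by (rule integrable_sum_power2(1)[OF _ m i2]) auto
  have "(\<integral>x. (\<Sum>i\<in>{0<..n}. h (x i))\<^sup>2 \<partial>P n) = (\<Sum>i\<in>{0<..n}. \<Sum>j\<in>{0<..n}. \<integral>x. h (x i) * h (x j) \<partial>P n)"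
    by (rule integrable_sum_power2(2)[OF _ m i2]) auto
  also have "\<dots> = (\<Sum>i\<in>{0<..n}. \<Sum>j\<in>{0<..n}. if i = j then (\<integral>x. (h x)\<^sup>2 \<partial>Q) else 0)"
    using diag off by (intro sum.cong refl) auto
  finally show "(\<integral>x. (\<Sum>i\<in>{0<..n}. h (x i))\<^sup>2 \<partial>P n) = n * (\<integral>x. (h x)\<^sup>2 \<partial>Q)"
    by (simp add: sum.delta')
qed

text \<open>Integrability of \<open>w x\<close> is required at every \<open>x\<close> and not just
  almost everywhere, so that the degeneracy of \<open>hoeffding\<close> holds pointwise, as the
  lemmas on degenerate kernels ask.\<close>

locale square_integrable_kernel = iid_sample Q for Q :: "'a measure" +
  fixes w :: "'a \<Rightarrow> 'a \<Rightarrow> real"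
  assumes w_measurable [measurable]: "case_prod w \<in> borel_measurable (Q \<Otimes>\<^sub>M Q)"
    and w_sym: "w x y = w y x"
    and w_integrable: "integrable Q (w x)"
    and w2_integrable: "integrable (Q \<Otimes>\<^sub>M Q) (\<lambda>(x, y). (w x y)\<^sup>2)"
begin

definition h :: "'a \<Rightarrow> real" where "h x = (\<integral>y. w x y \<partial>Q)"
definition \<mu> :: real where "\<mu> = (\<integral>x. h x \<partial>Q)"
definition w2 :: real where "w2 = (\<integral>(x, y). (w x y)\<^sup>2 \<partial>(Q \<Otimes>\<^sub>M Q))"
definition hoeffding :: "'a \<Rightarrow> 'a \<Rightarrow> real" where
  "hoeffding x y = w x y - h x - h y + \<mu>"

lemma h_measurable [measurable]: "h \<in> borel_measurable Q"
  unfolding h_def by measurable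

lemma h_power2_le: "AE x in Q. (h x)\<^sup>2 \<le> (\<integral>y. (w x y)\<^sup>2 \<partial>Q)"
  using pair_sigma_finite.AE_integrable_fst'[OF pair_sigma_finite_QQ w2_integrable]
proof eventually_elim
  case (elim x)
  then show ?case
    unfolding h_def by (intro power2_integral_le(2)) auto
qed

lemma h2_integrable: "integrable Q (\<lambda>x. (h x)\<^sup>2)"
  by (rule Bochner_Integration.integrable_bound[OF pair_sigma_finite.integrable_fst'[OF pair_sigma_finite_QQ w2_integrable]])
     (use h_power2_le in auto)

lemma h_integrable: "integrable Q h"
  using power2_integral_le(1)[OF h_measurable h2_integrable] .

lemma mu_power2_le: "\<mu>\<^sup>2 \<le> (\<integral>x. (h x)\<^sup>2 \<partial>Q)"
  unfolding \<mu>_def by (rule power2_integral_le(2)[OF h_measurable h2_integrable])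

lemma hoeffding_measurable [measurable]: "case_prod hoeffding \<in> borel_measurable (Q \<Otimes>\<^sub>M Q)"
  unfolding hoeffding_def by measurable

lemma hoeffding_sym: "hoeffding x y = hoeffding y x"
  unfolding hoeffding_def using w_sym[of x y] by simp

lemma hoeffding_degenerate: "(\<integral>y. hoeffding x y \<partial>Q) = 0"
  unfolding hoeffding_def using w_integrable[of x] h_integrable
  by (simp add: h_def[symmetric] \<mu>_def)

lemma integrable_QQ_fst: "integrable Q f \<Longrightarrow> integrable (Q \<Otimes>\<^sub>M Q) (\<lambda>p. f (fst p))"
  and integrable_QQ_snd: "integrable Q f \<Longrightarrow> integrable (Q \<Otimes>\<^sub>M Q) (\<lambda>p. f (snd p))" for f :: "'a \<Rightarrow> real"
proof -
  show 1: "integrable (Q \<Otimes>\<^sub>M Q) (\<lambda>p. f (fst p))" if "integrable Q f" for f :: "'a \<Rightarrow> real"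
    using integrable_distr[of fst "Q \<Otimes>\<^sub>M Q" Q f] that by (simp add: distr_pair_fst)
  show "integrable (Q \<Otimes>\<^sub>M Q) (\<lambda>p. f (snd p))" if "integrable Q f" for f :: "'a \<Rightarrow> real"
    using pair_sigma_finite.integrable_product_swap[OF pair_sigma_finite_QQ 1[OF that]] by (simp add: case_prod_unfold)
qed

text \<open>Pythagoras for the Hoeffding projections. The exact value is recorded, not only an upper
  bound, because the lower bound on the limiting variance in \<open>s_bounds\<close> is read off
  from it.\<close>

lemma hoeffding_power2:
  "integrable (Q \<Otimes>\<^sub>M Q) (\<lambda>(x, y). (hoeffding x y)\<^sup>2)"
  "(\<integral>(x, y). (hoeffding x y)\<^sup>2 \<partial>(Q \<Otimes>\<^sub>M Q)) = w2 - 2 * (\<integral>x. (h x)\<^sup>2 \<partial>Q) + \<mu>\<^sup>2"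
proof -
  let ?R = "Q \<Otimes>\<^sub>M Q"
  interpret R: prob_space ?R by (rule prob_space_QQ)
  have i2: "integrable ?R (\<lambda>p. (w (fst p) (snd p))\<^sup>2)"
    "integrable ?R (\<lambda>p. (h (fst p))\<^sup>2)" "integrable ?R (\<lambda>p. (h (snd p))\<^sup>2)"
    using w2_integrable integrable_QQ_fst[OF h2_integrable] integrable_QQ_snd[OF h2_integrable]
    by (auto simp: case_prod_unfold)
  have i1: "integrable ?R (\<lambda>p. w (fst p) (snd p))" "integrable ?R (\<lambda>p. h (fst p))" "integrable ?R (\<lambda>p. h (snd p))"
    by (rule R.power2_integral_le(1)[OF _ i2(1)], measurable)
       (use integrable_QQ_fst[OF h_integrable] integrable_QQ_snd[OF h_integrable] in auto)
  have ip: "integrable ?R (\<lambda>p. w (fst p) (snd p) * h (fst p))" "integrable ?R (\<lambda>p. w (fst p) (snd p) * h (snd p))"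
     "integrable ?R (\<lambda>p. h (fst p) * h (snd p))"
    by (rule Cauchy_Schwarz_integral(1)[OF _ _ i2(1) i2(2)], measurable)
       (rule Cauchy_Schwarz_integral(1)[OF _ _ i2(1) i2(3)], measurable,
        rule Cauchy_Schwarz_integral(1)[OF _ _ i2(2) i2(3)], measurable)
  have e: "(\<lambda>p. (hoeffding (fst p) (snd p))\<^sup>2) = (\<lambda>p. (w (fst p) (snd p))\<^sup>2 + (h (fst p))\<^sup>2 + (h (snd p))\<^sup>2 + \<mu>\<^sup>2
      - 2 * (w (fst p) (snd p) * h (fst p)) - 2 * (w (fst p) (snd p) * h (snd p)) + 2 * \<mu> * w (fst p) (snd p)
      + 2 * (h (fst p) * h (snd p)) - 2 * \<mu> * h (fst p) - 2 * \<mu> * h (snd p))"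
    unfolding hoeffding_def by (intro ext) (simp add: power2_eq_square algebra_simps)
  have "integrable ?R (\<lambda>p. (hoeffding (fst p) (snd p))\<^sup>2)"
    unfolding e using i1 i2 ip by auto
  then show "integrable ?R (\<lambda>(x, y). (hoeffding x y)\<^sup>2)" by (simp add: case_prod_unfold)
  have fst: "(\<integral>p. f p \<partial>?R) = (\<integral>x. \<integral>y. f (x, y) \<partial>Q \<partial>Q)" if "integrable ?R f" for f :: "_ \<Rightarrow> real"
    using pair_sigma_finite.integral_fst'[OF pair_sigma_finite_QQ that] by simp
  have snd: "(\<integral>p. f p \<partial>?R) = (\<integral>y. \<integral>x. f (x, y) \<partial>Q \<partial>Q)" if "integrable ?R f" for f :: "_ \<Rightarrow> real"
    using pair_sigma_finite.integral_snd[OF pair_sigma_finite_QQ, of "\<lambda>x y. f (x, y)"] that by simp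
  have hs: "(\<integral>x. w x y \<partial>Q) = h y" for y unfolding h_def using w_sym by (intro Bochner_Integration.integral_cong) auto
  have v: "(\<integral>p. w (fst p) (snd p) * h (fst p) \<partial>?R) = (\<integral>x. (h x)\<^sup>2 \<partial>Q)"
    "(\<integral>p. w (fst p) (snd p) * h (snd p) \<partial>?R) = (\<integral>x. (h x)\<^sup>2 \<partial>Q)"
    "(\<integral>p. h (fst p) * h (snd p) \<partial>?R) = \<mu>\<^sup>2"
    "(\<integral>p. w (fst p) (snd p) \<partial>?R) = \<mu>"
    "(\<integral>p. h (fst p) \<partial>?R) = \<mu>" "(\<integral>p. h (snd p) \<partial>?R) = \<mu>"
    "(\<integral>p. (h (fst p))\<^sup>2 \<partial>?R) = (\<integral>x. (h x)\<^sup>2 \<partial>Q)" "(\<integral>p. (h (snd p))\<^sup>2 \<partial>?R) = (\<integral>x. (h x)\<^sup>2 \<partial>Q)"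
    "(\<integral>p. (w (fst p) (snd p))\<^sup>2 \<partial>?R) = w2"
            apply (subst fst[OF ip(1)], simp add: h_def[symmetric] power2_eq_square)
           apply (subst snd[OF ip(2)], simp add: hs power2_eq_square)
          apply (subst fst[OF ip(3)], simp add: \<mu>_def power2_eq_square)
         apply (subst fst[OF i1(1)], simp add: h_def[symmetric] \<mu>_def)
        apply (subst fst[OF i1(2)], simp add: \<mu>_def)
       apply (subst snd[OF i1(3)], simp add: \<mu>_def)
      apply (subst fst[OF i2(2)], simp)
     apply (subst snd[OF i2(3)], simp)
    apply (simp add: w2_def case_prod_unfold)
    done
  have "(\<integral>p. (hoeffding (fst p) (snd p))\<^sup>2 \<partial>?R) = w2 - 2 * (\<integral>x. (h x)\<^sup>2 \<partial>Q) + \<mu>\<^sup>2"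
    unfolding e using i1 i2 ip v R.prob_space by (simp add: power2_eq_square)
  then show "(\<integral>(x, y). (hoeffding x y)\<^sup>2 \<partial>?R) = w2 - 2 * (\<integral>x. (h x)\<^sup>2 \<partial>Q) + \<mu>\<^sup>2"
    by (simp add: case_prod_unfold)
qed

lemma hoeffding_power2_le: "(\<integral>(x, y). (hoeffding x y)\<^sup>2 \<partial>(Q \<Otimes>\<^sub>M Q)) \<le> w2"
  unfolding hoeffding_power2(2) using mu_power2_le by (smt (verit) zero_le_power2)

lemma w2_nonneg: "0 \<le> w2"
  unfolding w2_def by (auto simp: case_prod_unfold)

lemma ustat_hoeffding_power2:
  "integrable (P n) (\<lambda>x. (ustat hoeffding n x)\<^sup>2)"
  "(\<integral>x. (ustat hoeffding n x)\<^sup>2 \<partial>P n) \<le> (real n)\<^sup>2 / 2 * w2"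
proof -
  note * = integral_ustat_degenerate_power2[OF hoeffding_measurable hoeffding_power2(1) hoeffding_sym hoeffding_degenerate]
  show "integrable (P n) (\<lambda>x. (ustat hoeffding n x)\<^sup>2)" by (rule *)
  show "(\<integral>x. (ustat hoeffding n x)\<^sup>2 \<partial>P n) \<le> (real n)\<^sup>2 / 2 * w2"
    unfolding *(2)
    by (rule order_trans[OF mult_left_mono[OF hoeffding_power2_le] mult_right_mono])
       (cases n; auto simp: w2_nonneg power2_eq_square)+
qed

text \<open>The factor arises because each point lies in \<open>n - 1\<close> pairs.\<close>

definition linear_part :: "nat \<Rightarrow> (nat \<Rightarrow> 'a) \<Rightarrow> real" where
  "linear_part n x = (real n - 1) * (\<Sum>i\<in>{0<..n}. h (x i) - \<mu>)"

lemma ustat_decomposition: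
  "ustat w n x = ustat hoeffding n x + linear_part n x + real n * (real n - 1) / 2 * \<mu>"
proof -
  have "ustat w n x - ustat hoeffding n x = (\<Sum>j\<in>{0<..n}. \<Sum>i\<in>{0<..j - 1}. h (x i) + h (x j) - \<mu>)"
    unfolding ustat_def hoeffding_def sum_subtractf[symmetric] by (intro sum.cong refl) simp
  also have "\<dots> = linear_part n x + real n * (real n - 1) / 2 * \<mu>"
  proof (induction n)
    case 0
    then show ?case by (simp add: linear_part_def)
  next
    case (Suc n)
    have "(\<Sum>i\<in>{0<..n}. h (x i) + h (x (Suc n)) - \<mu>) = (\<Sum>i\<in>{0<..n}. h (x i) - \<mu>) + real n * h (x (Suc n))"
      by (simp add: sum.distrib sum_subtractf)
    then show ?case using Suc
      by (simp add: linear_part_def greaterThanAtMost_0_Suc) (simp add: field_simps)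
  qed
  finally show ?thesis by simp
qed

lemma linear_part_measurable [measurable]: "linear_part n \<in> borel_measurable (P n)"
  unfolding linear_part_def by measurable

text \<open>The mean minimises the mean squared deviation, so any constant \<open>c\<close> may
  replace \<open>\<mu>\<close>. Later \<open>c\<close> is the value that the projection takes away
  from the boundary, which is explicit.\<close>

lemma integral_linear_part_power2:
  "integrable (P n) (\<lambda>x. (linear_part n x)\<^sup>2)"
  "(\<integral>x. (linear_part n x)\<^sup>2 \<partial>P n) \<le> real n ^ 3 * (\<integral>x. (h x - c)\<^sup>2 \<partial>Q)"
proof -
  have h2: "integrable Q (\<lambda>x. (h x - b)\<^sup>2)" for b
    using h_integrable h2_integrable by (simp add: power2_diff)
  have h0: "(\<integral>x. h x - \<mu> \<partial>Q) = 0" using h_integrable by (simp add: \<mu>_def)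
  have m: "(\<lambda>x. h x - \<mu>) \<in> borel_measurable Q" by measurable
  note * = integral_centred_sum_power2[OF m h2 h0, of n]
  show "integrable (P n) (\<lambda>x. (linear_part n x)\<^sup>2)"
    unfolding linear_part_def power_mult_distrib using *(1) by simp
  have ev: "(\<integral>x. (h x - b)\<^sup>2 \<partial>Q) = (\<integral>x. (h x)\<^sup>2 \<partial>Q) - 2 * b * \<mu> + b\<^sup>2" for b
  proof -
    have "(\<integral>x. (h x - b)\<^sup>2 \<partial>Q) = (\<integral>x. (h x)\<^sup>2 - 2 * b * h x + b\<^sup>2 \<partial>Q)"
      by (simp add: power2_diff algebra_simps)
    then show ?thesis using h_integrable h2_integrable by (simp add: \<mu>_def[symmetric])
  qed
  have var: "(\<integral>x. (h x - \<mu>)\<^sup>2 \<partial>Q) \<le> (\<integral>x. (h x - c)\<^sup>2 \<partial>Q)"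
  proof -
    have "0 \<le> (c - \<mu>)\<^sup>2" by simp
    then show ?thesis unfolding ev by (simp add: power2_eq_square algebra_simps)
  qed
  have "(\<integral>x. (linear_part n x)\<^sup>2 \<partial>P n) = (real n - 1)\<^sup>2 * (n * (\<integral>x. (h x - \<mu>)\<^sup>2 \<partial>Q))"
    unfolding linear_part_def power_mult_distrib using * by simp
  also have "\<dots> \<le> (real n)\<^sup>2 * (n * (\<integral>x. (h x - c)\<^sup>2 \<partial>Q))"
    using var by (cases n) (auto intro!: mult_mono power_mono)
  finally show "(\<integral>x. (linear_part n x)\<^sup>2 \<partial>P n) \<le> real n ^ 3 * (\<integral>x. (h x - c)\<^sup>2 \<partial>Q)"
    by (simp add: power2_eq_square power3_eq_cube mult.assoc)
qed

end

text \<open>All moments entering the central limit theorem are controlled by \<open>B\<close> and by the bound \<open>\<eta>\<close> on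
  the mass that the kernel puts around a single point.\<close>

locale bounded_kernel = iid_sample Q for Q :: "'a measure" +
  fixes w :: "'a \<Rightarrow> 'a \<Rightarrow> real" and B \<eta> :: real
  assumes w_measurable [measurable]: "case_prod w \<in> borel_measurable (Q \<Otimes>\<^sub>M Q)"
    and w_sym: "w x y = w y x" and w_nonneg: "0 \<le> w x y" and w_le: "w x y \<le> B"
    and integral_w_le: "(\<integral>y. w x y \<partial>Q) \<le> \<eta>"
begin

lemma square_integrable: "square_integrable_kernel Q w"
proof unfold_locales
  show "integrable Q (w x)" for x
    by (rule bounded_integrable[OF finite_measure_axioms, where B=B]) (use w_nonneg w_le in auto)
  show "integrable (Q \<Otimes>\<^sub>M Q) (\<lambda>(x, y). (w x y)\<^sup>2)"
    by (rule bounded_integrable[OF prob_space.axioms(1)[OF prob_space_QQ], where B="B\<^sup>2"])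
       (use power_mono[OF w_le w_nonneg, of _ _ 2] in auto)
qed (rule w_measurable w_sym)+

sublocale square_integrable_kernel Q w by (rule square_integrable)

lemma h_nonneg: "0 \<le> h x" unfolding h_def using w_nonneg by simp
lemma h_le: "h x \<le> \<eta>" unfolding h_def by (rule integral_w_le)
lemma h_le_B: "h x \<le> B"
  unfolding h_def by (rule integral_le_const) (use w_integrable w_le in auto)
lemma mu_nonneg: "0 \<le> \<mu>" unfolding \<mu>_def using h_nonneg by simp
lemma mu_le_B: "\<mu> \<le> B"
  unfolding \<mu>_def by (rule integral_le_const) (use h_integrable h_le_B in auto)

lemma hoeffding_bounded: "\<bar>hoeffding x y\<bar> \<le> 2 * B"
  using w_nonneg[of x y] w_le[of x y] h_nonneg[of x] h_nonneg[of y] h_le_B[of x] h_le_B[of y] mu_nonneg mu_le_B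
  unfolding hoeffding_def by (simp add: abs_le_iff)

lemma hoeffding_kernel: "degenerate_kernel Q hoeffding (2 * B)"
  by unfold_locales (use hoeffding_measurable hoeffding_bounded hoeffding_degenerate hoeffding_sym in auto)

sublocale HK: degenerate_kernel Q hoeffding "2 * B" by (rule hoeffding_kernel)


lemma eta_nonneg: "0 \<le> \<eta>" using h_nonneg h_le order_trans by blast

lemma B_nonneg: "0 \<le> B" using w_nonneg w_le order_trans by blast

lemma integral_h_power2_le: "(\<integral>x. (h x)\<^sup>2 \<partial>Q) \<le> \<eta> * \<mu>" "(\<integral>x. (h x)\<^sup>2 \<partial>Q) \<le> B * \<eta>" "\<mu> \<le> \<eta>"
proof -
  have "(\<integral>x. (h x)\<^sup>2 \<partial>Q) \<le> (\<integral>x. \<eta> * h x \<partial>Q)"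
    by (rule integral_mono) (use h2_integrable h_integrable h_le h_nonneg in \<open>auto simp: power2_eq_square intro!: mult_right_mono\<close>)
  then show "(\<integral>x. (h x)\<^sup>2 \<partial>Q) \<le> \<eta> * \<mu>" by (simp add: \<mu>_def)
  also have "\<dots> \<le> \<eta> * B" using mu_le_B eta_nonneg by (rule mult_left_mono)
  finally show "(\<integral>x. (h x)\<^sup>2 \<partial>Q) \<le> B * \<eta>" by (simp add: mult.commute)
  show "\<mu> \<le> \<eta>" unfolding \<mu>_def by (rule integral_le_const) (use h_integrable h_le in auto)
qed

lemma s_eq: "HK.s = (\<integral>(x, y). (hoeffding x y)\<^sup>2 \<partial>(Q \<Otimes>\<^sub>M Q))"
  unfolding HK.s_def HK.D_def using pair_sigma_finite.integral_snd[OF pair_sigma_finite_QQ hoeffding_power2(1)] by simp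

text \<open>Removing the projections can only lower the second moment, and by at most
  \<open>2 * \<eta>^2\<close>, since the projection never exceeds \<open>\<eta>\<close>. For small
  \<open>\<eta>\<close> the variance is thus that of the raw kernel.\<close>

lemma s_bounds: "HK.s \<le> w2" "w2 - 2 * \<eta>\<^sup>2 \<le> HK.s"
proof -
  show "HK.s \<le> w2" unfolding s_eq by (rule hoeffding_power2_le)
  have "\<eta> * \<mu> \<le> \<eta> * \<eta>" using integral_h_power2_le(3) eta_nonneg by (rule mult_left_mono)
  then show "w2 - 2 * \<eta>\<^sup>2 \<le> HK.s"
  proof -
    define H2 where "H2 = (\<integral>x. (h x)\<^sup>2 \<partial>Q)"
    have "HK.s = w2 - 2 * H2 + \<mu>\<^sup>2" "H2 \<le> \<eta> * \<mu>"
      unfolding s_eq hoeffding_power2(2) H2_def using integral_h_power2_le(1) by simp_all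
    then show ?thesis
      using \<open>\<eta> * \<mu> \<le> \<eta> * \<eta>\<close> zero_le_power2[of \<mu>] unfolding power2_eq_square[of \<eta>] by linarith
  qed
qed

text \<open>Two of the four factors are bounded by the supremum \<open>2 * B\<close>.\<close>

lemma q4_le: "HK.q4 \<le> 4 * B\<^sup>2 * HK.s"
proof -
  have "HK.q4 \<le> (\<integral>z. 4 * B\<^sup>2 * HK.D z \<partial>Q)"
    unfolding HK.q4_def
  proof (rule integral_mono[OF HK.H4_integrable])
    show "integrable Q (\<lambda>z. 4 * B\<^sup>2 * HK.D z)" using HK.D_integrable by simp
    fix z
    have "(\<integral>y. hoeffding y z ^ 4 \<partial>Q) \<le> (\<integral>y. (2 * B)\<^sup>2 * (hoeffding y z)\<^sup>2 \<partial>Q)"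
    proof (rule integral_mono)
      fix y
      show "hoeffding y z ^ 4 \<le> (2 * B)\<^sup>2 * (hoeffding y z)\<^sup>2"
        using mult_right_mono[OF HK.H_power2_le zero_le_power2, of y z "hoeffding y z"]
        by (simp add: power4_eq_xxxx power2_eq_square mult.assoc)
    qed (use HK.H_power_integrable(1)[of z 2] HK.H_power_integrable(1)[of z 4] in auto)
    then show "(\<integral>y. hoeffding y z ^ 4 \<partial>Q) \<le> 4 * B\<^sup>2 * HK.D z"
      by (simp add: HK.D_def power_mult_distrib)
  qed
  then show ?thesis by (simp add: HK.s_def)
qed

text \<open>One factor \<open>w\<close> is bounded by \<open>B\<close>, the other integrates to at
  most \<open>\<eta>\<close>. The constant comes from splitting \<open>hoeffding\<close> into
  \<open>w y z - h z\<close> and \<open>h y - \<mu>\<close>: each part has second moment at most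
  \<open>B * \<eta>\<close> and is counted twice.\<close>

lemma D_le: "HK.D z \<le> 4 * B * \<eta>"
proof -
  have wi: "integrable Q (\<lambda>y. w y z ^ k)" for k
    by (rule bounded_integrable[OF finite_measure_axioms, where B="B ^ k"])
       (use power_mono[OF w_le w_nonneg, of _ _ k] w_nonneg in auto)
  have hi: "integrable Q (\<lambda>y. (h y) ^ k)" for k
    by (rule bounded_integrable[OF finite_measure_axioms, where B="B ^ k"])
       (use power_mono[OF h_le_B h_nonneg, of _ k] h_nonneg in auto)
  have wh: "(\<integral>y. w y z \<partial>Q) = h z"
    unfolding h_def using w_sym by (intro Bochner_Integration.integral_cong) auto
  have "HK.D z \<le> (\<integral>y. 2 * (w y z - h z)\<^sup>2 + 2 * (h y - \<mu>)\<^sup>2 \<partial>Q)"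
    unfolding HK.D_def
  proof (rule integral_mono)
    show "integrable Q (\<lambda>y. 2 * (w y z - h z)\<^sup>2 + 2 * (h y - \<mu>)\<^sup>2)"
      using wi[of 1] wi[of 2] hi[of 1] hi[of 2] by (simp add: power2_diff)
    fix y
    have "0 \<le> ((w y z - h z) + (h y - \<mu>))\<^sup>2" by simp
    then show "(hoeffding y z)\<^sup>2 \<le> 2 * (w y z - h z)\<^sup>2 + 2 * (h y - \<mu>)\<^sup>2"
      unfolding hoeffding_def by (simp add: power2_eq_square algebra_simps)
  qed (rule HK.H_power_integrable)
  also have "\<dots> = (\<integral>y. 2 * (w y z)\<^sup>2 - 4 * h z * w y z + 2 * (h z)\<^sup>2 + (2 * (h y)\<^sup>2 - 4 * \<mu> * h y + 2 * \<mu>\<^sup>2) \<partial>Q)"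
    by (intro Bochner_Integration.integral_cong refl) (simp add: power2_eq_square algebra_simps)
  also have "\<dots> = 2 * (\<integral>y. (w y z)\<^sup>2 \<partial>Q) - 2 * (h z)\<^sup>2 + (2 * (\<integral>y. (h y)\<^sup>2 \<partial>Q) - 2 * \<mu>\<^sup>2)"
    using wi[of 1] wi[of 2] hi[of 1] hi[of 2] by (simp add: wh \<mu>_def[symmetric] power2_eq_square)
  also have "(\<integral>y. (w y z)\<^sup>2 \<partial>Q) \<le> (\<integral>y. B * w y z \<partial>Q)"
    by (rule integral_mono) (use wi[of 1] wi[of 2] w_le w_nonneg in \<open>auto simp: power2_eq_square intro!: mult_right_mono\<close>)
  also have "\<dots> \<le> B * \<eta>" using h_le[of z] B_nonneg by (simp add: wh mult_left_mono)
  finally show ?thesis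
    using integral_h_power2_le(2) zero_le_power2[of "h z"] zero_le_power2[of \<mu>] by linarith
qed

lemma d2_le: "HK.d2 \<le> 4 * B * \<eta> * HK.s"
proof -
  have "HK.d2 \<le> (\<integral>z. 4 * B * \<eta> * HK.D z \<partial>Q)"
    unfolding HK.d2_def
    by (rule integral_mono)
       (use HK.D_integrable D_le HK.D_nonneg in \<open>auto simp: power2_eq_square intro!: mult_right_mono\<close>)
  then show ?thesis by (simp add: HK.s_def)
qed

text \<open>The integral operator with kernel \<open>w\<close> has norm at most
  \<open>\<eta>\<close> on L2, because its row integrals and, by symmetry, its column integrals are
  at most \<open>\<eta>\<close>. Bounded \<open>u\<close> suffices here and settles all
  integrability questions.\<close>

lemma schur_test:
  assumes [measurable]: "u \<in> borel_measurable Q" and u: "\<And>z. \<bar>u z\<bar> \<le> C"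
  shows "(\<integral>x. (\<integral>z. w x z * u z \<partial>Q)\<^sup>2 \<partial>Q) \<le> \<eta>\<^sup>2 * (\<integral>z. (u z)\<^sup>2 \<partial>Q)"
proof -
  have C: "0 \<le> C" using u[of undefined] by linarith
  have u2: "(u z)\<^sup>2 \<le> C\<^sup>2" for z using power_mono[OF u abs_ge_zero, of z 2] by simp
  have wu2: "0 \<le> w x z * (u z)\<^sup>2 \<and> w x z * (u z)\<^sup>2 \<le> B * C\<^sup>2" for x z
    using mult_mono[OF w_le[of x z] u2[of z] B_nonneg] w_nonneg by simp
  have i1: "integrable Q (\<lambda>z. w x z * (u z)\<^sup>2)" for x
    by (rule bounded_integrable[OF finite_measure_axioms, where B="B * C\<^sup>2"]) (use wu2 in auto)
  have i2: "integrable (Q \<Otimes>\<^sub>M Q) (\<lambda>(x, z). w x z * (u z)\<^sup>2)"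
    by (rule bounded_integrable[OF prob_space.axioms(1)[OF prob_space_QQ], where B="B * C\<^sup>2"]) (use wu2 in auto)
  have iu: "integrable Q (\<lambda>z. (u z)\<^sup>2)"
    by (rule bounded_integrable[OF finite_measure_axioms, where B="C\<^sup>2"]) (use u2 in auto)
  have 1: "(\<integral>z. w x z * u z \<partial>Q)\<^sup>2 \<le> \<eta> * (\<integral>z. w x z * (u z)\<^sup>2 \<partial>Q)" for x
  proof -
    \<comment> \<open>One square root of the kernel is spent on the row integral, the other is kept
      with \<open>u\<close>.\<close>
    have "(\<integral>z. sqrt (w x z) * (sqrt (w x z) * u z) \<partial>Q)\<^sup>2
        \<le> (\<integral>z. (sqrt (w x z))\<^sup>2 \<partial>Q) * (\<integral>z. (sqrt (w x z) * u z)\<^sup>2 \<partial>Q)"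
      by (rule Cauchy_Schwarz_integral) (use w_nonneg w_integrable i1 in \<open>auto simp: power_mult_distrib\<close>)
    also have "(\<integral>z. (sqrt (w x z) * u z)\<^sup>2 \<partial>Q) = (\<integral>z. w x z * (u z)\<^sup>2 \<partial>Q)"
      using w_nonneg by (simp add: power_mult_distrib)
    also have "(\<integral>z. (sqrt (w x z))\<^sup>2 \<partial>Q) * (\<integral>z. w x z * (u z)\<^sup>2 \<partial>Q) \<le> \<eta> * (\<integral>z. w x z * (u z)\<^sup>2 \<partial>Q)"
      using w_nonneg wu2 integral_w_le by (intro mult_right_mono) (auto intro!: integral_nonneg)
    finally show ?thesis using w_nonneg by (simp add: mult.assoc[symmetric])
  qed
  have "(\<integral>x. (\<integral>z. w x z * u z \<partial>Q)\<^sup>2 \<partial>Q) \<le> (\<integral>x. \<eta> * (\<integral>z. w x z * (u z)\<^sup>2 \<partial>Q) \<partial>Q)"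
    using 1 pair_sigma_finite.integrable_fst'[OF pair_sigma_finite_QQ i2] eta_nonneg wu2
    by (intro integral_mono_AE') (auto intro!: mult_nonneg_nonneg integral_nonneg)
  also have "(\<integral>x. \<eta> * (\<integral>z. w x z * (u z)\<^sup>2 \<partial>Q) \<partial>Q) = \<eta> * (\<integral>x. (\<integral>z. w x z * (u z)\<^sup>2 \<partial>Q) \<partial>Q)" by simp
  also have "(\<integral>x. (\<integral>z. w x z * (u z)\<^sup>2 \<partial>Q) \<partial>Q) = (\<integral>z. (\<integral>x. w x z * (u z)\<^sup>2 \<partial>Q) \<partial>Q)"
    by (rule pair_sigma_finite.Fubini_integral[OF pair_sigma_finite_QQ, symmetric]) (rule i2)
  also have "\<dots> = (\<integral>z. h z * (u z)\<^sup>2 \<partial>Q)"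
    using w_sym by (simp add: h_def)
  also have "\<dots> \<le> (\<integral>z. \<eta> * (u z)\<^sup>2 \<partial>Q)"
    using iu h_le h_nonneg eta_nonneg by (intro integral_mono_AE') (auto intro!: mult_right_mono)
  finally show ?thesis using eta_nonneg by (simp add: power2_eq_square mult.assoc mult_left_mono)
qed

text \<open>For fixed \<open>y\<close>, the function \<open>HK.G\<close> arises from
  \<open>hoeffding y\<close> by the operator with kernel \<open>w\<close> followed by centring.
  Centring does not increase the L2 norm, and the Schur test bounds the operator.\<close>

lemma g2_le: "HK.g2 \<le> \<eta>\<^sup>2 * HK.s"
proof -
  have "(\<integral>x. (HK.G x y)\<^sup>2 \<partial>Q) \<le> \<eta>\<^sup>2 * HK.D y" for y
  proof -
    define u where "u = hoeffding y"
    have [measurable]: "u \<in> borel_measurable Q" unfolding u_def by measurable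
    have ub: "\<bar>u z\<bar> \<le> 2 * B" for z unfolding u_def by (rule hoeffding_bounded)
    have ui: "integrable Q u" by (rule bounded_integrable[OF finite_measure_axioms, where B="2 * B"]) (use ub in auto)
    have u0: "(\<integral>z. u z \<partial>Q) = 0" unfolding u_def by (rule hoeffding_degenerate)
    have wub: "\<bar>w x z * u z\<bar> \<le> B * (2 * B)" for x z
      using mult_mono[OF _ ub[of z] B_nonneg abs_ge_zero, of "\<bar>w x z\<bar>"] w_le[of x z] w_nonneg[of x z] by (simp add: abs_mult)
    have hub: "\<bar>h z * u z\<bar> \<le> B * (2 * B)" for z
      using mult_mono[OF _ ub[of z] B_nonneg abs_ge_zero, of "\<bar>h z\<bar>"] h_le_B[of z] h_nonneg[of z] by (simp add: abs_mult)
    have wui: "integrable Q (\<lambda>z. w x z * u z)" for x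
      by (rule bounded_integrable[OF finite_measure_axioms, where B="B * (2 * B)"]) (use wub in auto)
    have hui: "integrable Q (\<lambda>z. h z * u z)"
      by (rule bounded_integrable[OF finite_measure_axioms, where B="B * (2 * B)"]) (use hub in auto)
    define T where "T x = (\<integral>z. w x z * u z \<partial>Q)" for x
    have [measurable]: "T \<in> borel_measurable Q" unfolding T_def by measurable
    have Tb: "\<bar>T x\<bar> \<le> B * (2 * B)" for x
      unfolding T_def by (rule HK.integral_bdd_le[OF prob_space_axioms]) (use wub in auto)
    have Ti: "integrable Q (\<lambda>x. T x ^ k)" for k
      by (rule bounded_integrable[OF finite_measure_axioms, where B="(B * (2 * B)) ^ k"])
         (auto intro!: abs_power_le Tb simp del: power_abs)
    have "(\<integral>x. T x \<partial>Q) = (\<integral>z. (\<integral>x. w x z * u z \<partial>Q) \<partial>Q)"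
      unfolding T_def
      by (rule pair_sigma_finite.Fubini_integral[OF pair_sigma_finite_QQ, symmetric])
         (rule bounded_integrable[OF prob_space.axioms(1)[OF prob_space_QQ], where B="B * (2 * B)"], use wub in auto)
    also have "\<dots> = (\<integral>z. h z * u z \<partial>Q)" using w_sym by (simp add: h_def)
    finally have Tm: "(\<integral>x. T x \<partial>Q) = (\<integral>z. h z * u z \<partial>Q)" .
    \<comment> \<open>As \<open>u\<close> has integral 0, the contributions of \<open>h x\<close>
      and \<open>\<mu>\<close> drop out, and \<open>h z\<close> contributes exactly the mean of
      \<open>T\<close>.\<close>
    have G: "HK.G x y = T x - (\<integral>x. T x \<partial>Q)" for x
    proof -
      have "HK.G x y = (\<integral>z. w x z * u z - h x * u z - h z * u z + \<mu> * u z \<partial>Q)"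
        unfolding HK.G_def u_def hoeffding_def[of x] by (intro Bochner_Integration.integral_cong refl) (simp add: algebra_simps)
      also have "\<dots> = T x - (\<integral>x. T x \<partial>Q)"
        unfolding Tm using wui hui ui by (simp add: u0 T_def)
      finally show ?thesis .
    qed
    define m where "m = (\<integral>x. T x \<partial>Q)"
    have "(\<integral>x. (HK.G x y)\<^sup>2 \<partial>Q) = (\<integral>x. (T x)\<^sup>2 - 2 * m * T x + m\<^sup>2 \<partial>Q)"
      unfolding G m_def[symmetric] by (simp add: power2_diff algebra_simps)
    also have "\<dots> = (\<integral>x. (T x)\<^sup>2 \<partial>Q) - m\<^sup>2"
      using Ti[of 1] Ti[of 2] by (simp add: m_def[symmetric] power2_eq_square)
    also have "\<dots> \<le> (\<integral>x. (T x)\<^sup>2 \<partial>Q)" by simp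
    also have "\<dots> \<le> \<eta>\<^sup>2 * (\<integral>z. (u z)\<^sup>2 \<partial>Q)"
      unfolding T_def by (rule schur_test[where C="2 * B"]) (use ub in auto)
    also have "(\<integral>z. (u z)\<^sup>2 \<partial>Q) = HK.D y"
      unfolding u_def HK.D_def by (simp add: hoeffding_sym[of y])
    finally show ?thesis .
  qed
  then have "HK.g2 \<le> (\<integral>y. \<eta>\<^sup>2 * HK.D y \<partial>Q)"
    unfolding HK.g2_def using HK.D_integrable HK.D_nonneg
    by (intro integral_mono_AE') auto
  then show ?thesis by (simp add: HK.s_def)
qed

text \<open>In units of the scale \<open>\<sigma>\<close> the error depends only on the largest
  weight \<open>b\<close> of one pair and on a bound \<open>e\<close> for the expected weight at one
  point. The intended scale satisfies roughly \<open>w2 * n^2 = 2 * \<sigma>^2\<close>; the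
  hypothesis leaves a factor 2 for the perturbation of the density.\<close>

theorem char_ustat_hoeffding_approx:
  assumes n: "n \<ge> 1" and \<sigma>: "0 < \<sigma>" and w2: "w2 * (real n)\<^sup>2 \<le> 4 * \<sigma>\<^sup>2"
  defines "b \<equiv> B / \<sigma>" and "e \<equiv> n * \<eta> / \<sigma>"
  shows "cmod ((\<integral>x. iexp (t / \<sigma> * ustat hoeffding n x) \<partial>P n)
      - exp (- (t\<^sup>2 * (HK.s * (real n * (real n - 1)) / (4 * \<sigma>\<^sup>2)))))
    \<le> \<bar>t\<bar> ^ 3 * sqrt (4 * b\<^sup>2 + 12 * b * e) + t\<^sup>2 * sqrt (8 * b * e + 4 * e\<^sup>2) + 2 * t ^ 4 / n"
proof -
  define N where "N = real n"
  define W where "W = 4 * \<sigma>\<^sup>2 / N\<^sup>2"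
  have N: "N \<ge> 1" "N > 0" using n by (auto simp: N_def)
  have s: "0 \<le> HK.s" "HK.s \<le> W"
  proof -
    have "w2 \<le> W" using w2 N by (simp add: W_def N_def[symmetric] pos_le_divide_eq)
    then show "HK.s \<le> W" using s_bounds(1) by simp
  qed (simp add: HK.s_def HK.D_nonneg)
  have nn: "0 \<le> B" "0 \<le> \<eta>" by (rule B_nonneg eta_nonneg)+
  have q4: "HK.q4 \<le> 4 * B\<^sup>2 * W" using q4_le mult_left_mono[OF s(2), of "4 * B\<^sup>2"] by simp
  have d2: "HK.d2 \<le> 4 * B * \<eta> * W" using d2_le mult_left_mono[OF s(2), of "4 * B * \<eta>"] nn by simp
  have g2: "HK.g2 \<le> \<eta>\<^sup>2 * W" using g2_le mult_left_mono[OF s(2), of "\<eta>\<^sup>2"] by simp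
  have B: "B = b * \<sigma>" and E: "\<eta> = e * \<sigma> / N" using \<sigma> N by (auto simp: b_def e_def N_def)
  have be: "0 \<le> b" "0 \<le> e" using nn \<sigma> by (auto simp: b_def e_def)
  have W: "0 \<le> W" by (simp add: W_def)
  have 1: "sqrt (N * HK.s * (N * HK.q4 + 3 * N\<^sup>2 * HK.d2)) \<le> 4 * \<sigma> ^ 3 / N * sqrt (4 * b\<^sup>2 + 12 * b * e)"
  proof -
    have "sqrt (N * HK.s * (N * HK.q4 + 3 * N\<^sup>2 * HK.d2)) \<le> sqrt (N * W * (N * (4 * B\<^sup>2 * W) + 3 * N\<^sup>2 * (4 * B * \<eta> * W)))"
      using N s q4 d2 nn W
      by (intro real_sqrt_le_mono mult_mono add_mono mult_left_mono) (auto simp: HK.q4_def HK.d2_def)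
    also have "N * W * (N * (4 * B\<^sup>2 * W) + 3 * N\<^sup>2 * (4 * B * \<eta> * W)) = (4 * \<sigma> ^ 3 / N)\<^sup>2 * (4 * b\<^sup>2 + 12 * b * e)"
      unfolding W_def B E using N by (simp add: field_simps power2_eq_square power3_eq_cube)
    also have "sqrt \<dots> = 4 * \<sigma> ^ 3 / N * sqrt (4 * b\<^sup>2 + 12 * b * e)"
      using N \<sigma> by (simp add: real_sqrt_mult)
    finally show ?thesis .
  qed
  have 2: "sqrt (2 * N * HK.d2 + 4 * N\<^sup>2 * HK.g2) \<le> 2 * \<sigma>\<^sup>2 / N * sqrt (8 * b * e + 4 * e\<^sup>2)"
  proof -
    have "sqrt (2 * N * HK.d2 + 4 * N\<^sup>2 * HK.g2) \<le> sqrt (2 * N * (4 * B * \<eta> * W) + 4 * N\<^sup>2 * (\<eta>\<^sup>2 * W))"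
      using N g2 d2 by (intro real_sqrt_le_mono add_mono mult_left_mono) auto
    also have "2 * N * (4 * B * \<eta> * W) + 4 * N\<^sup>2 * (\<eta>\<^sup>2 * W) = (2 * \<sigma>\<^sup>2 / N)\<^sup>2 * (8 * b * e + 4 * e\<^sup>2)"
      unfolding W_def B E using N by (simp add: field_simps power2_eq_square)
    also have "sqrt \<dots> = 2 * \<sigma>\<^sup>2 / N * sqrt (8 * b * e + 4 * e\<^sup>2)"
      using N \<sigma> by (simp add: real_sqrt_mult)
    finally show ?thesis .
  qed
  have 3: "N\<^sup>2 * HK.s\<^sup>2 \<le> 16 * \<sigma> ^ 4 / N\<^sup>2"
  proof -
    have "N\<^sup>2 * HK.s\<^sup>2 \<le> N\<^sup>2 * W\<^sup>2" using s by (intro mult_left_mono power_mono) auto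
    also have "\<dots> = 16 * \<sigma> ^ 4 / N\<^sup>2" unfolding W_def using N by (simp add: field_simps power2_eq_square power4_eq_xxxx)
    finally show ?thesis .
  qed
  have "N * HK.step_error (t / \<sigma>) n
      \<le> N * (\<bar>t / \<sigma>\<bar> ^ 3 / 6 * (4 * \<sigma> ^ 3 / N * sqrt (4 * b\<^sup>2 + 12 * b * e))
        + (t / \<sigma>)\<^sup>2 / 2 * (2 * \<sigma>\<^sup>2 / N * sqrt (8 * b * e + 4 * e\<^sup>2)) + (t / \<sigma>) ^ 4 * (16 * \<sigma> ^ 4 / N\<^sup>2) / 8)"
    unfolding HK.step_error_def N_def[symmetric]
    using 1 2 mult_left_mono[OF 3, of "(t / \<sigma>) ^ 4"] N
    by (intro mult_left_mono add_mono) (auto simp: ac_simps)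
  also have "\<dots> = 2 / 3 * (\<bar>t\<bar> ^ 3 * sqrt (4 * b\<^sup>2 + 12 * b * e)) + t\<^sup>2 * sqrt (8 * b * e + 4 * e\<^sup>2) + 2 * t ^ 4 / N"
  proof -
    have "\<bar>t / \<sigma>\<bar> ^ 3 = \<bar>t\<bar> ^ 3 / \<sigma> ^ 3" using \<sigma> by (simp add: power_divide)
    then show ?thesis using N \<sigma> by (simp add: field_simps power_divide power2_eq_square power4_eq_xxxx power3_eq_cube)
  qed
  also have "\<dots> \<le> \<bar>t\<bar> ^ 3 * sqrt (4 * b\<^sup>2 + 12 * b * e) + t\<^sup>2 * sqrt (8 * b * e + 4 * e\<^sup>2) + 2 * t ^ 4 / N"
    using be by simp
  finally have err: "N * HK.step_error (t / \<sigma>) n \<le> \<bar>t\<bar> ^ 3 * sqrt (4 * b\<^sup>2 + 12 * b * e) + t\<^sup>2 * sqrt (8 * b * e + 4 * e\<^sup>2) + 2 * t ^ 4 / N" .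
  have eq: "(t / \<sigma>)\<^sup>2 * HK.s * (real n * (real n - 1)) / 4 = t\<^sup>2 * (HK.s * (real n * (real n - 1)) / (4 * \<sigma>\<^sup>2))"
    by (simp add: power_divide)
  show ?thesis
    by (rule order_trans[OF HK.char_S_approx[where t="t / \<sigma>" and n=n, unfolded HK.S_eq_ustat eq] err[unfolded N_def]])
qed

end

section \<open>Radial kernels and convolution forms\<close>

lemma distr_lborel_minus_left: "distr lborel borel (\<lambda>y. x - y) = (lborel :: 'a::euclidean_space measure)"
  using lborel_affine[of "-1" x] by (simp add: density_1)

lemma distr_lborel_minus_right: "distr lborel borel (\<lambda>y. y - x) = (lborel :: 'a::euclidean_space measure)"
proof -
  have "(\<lambda>y. y - x) = (+) (- x)" by (simp add: fun_eq_iff)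
  then show ?thesis by (simp only: lborel_distr_plus)
qed

lemma
  fixes f :: "'a::euclidean_space \<Rightarrow> 'b::{banach, second_countable_topology}"
  shows integral_lborel_minus_left: "f \<in> borel_measurable borel \<Longrightarrow> (\<integral>y. f (x - y) \<partial>lborel) = (\<integral>y. f y \<partial>lborel)"
    and integral_lborel_minus_right: "f \<in> borel_measurable borel \<Longrightarrow> (\<integral>y. f (y - x) \<partial>lborel) = (\<integral>y. f y \<partial>lborel)"
    and integrable_lborel_minus_left: "integrable lborel f \<Longrightarrow> integrable lborel (\<lambda>y. f (x - y))"
    and integrable_lborel_minus_right: "integrable lborel f \<Longrightarrow> integrable lborel (\<lambda>y. f (y - x))"
proof -
  show "f \<in> borel_measurable borel \<Longrightarrow> (\<integral>y. f (x - y) \<partial>lborel) = (\<integral>y. f y \<partial>lborel)"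
    using integral_distr[of "\<lambda>y. x - y" lborel borel f] by (simp add: distr_lborel_minus_left)
  show "f \<in> borel_measurable borel \<Longrightarrow> (\<integral>y. f (y - x) \<partial>lborel) = (\<integral>y. f y \<partial>lborel)"
    using integral_distr[of "\<lambda>y. y - x" lborel borel f] by (simp add: distr_lborel_minus_right)
  show "integrable lborel f \<Longrightarrow> integrable lborel (\<lambda>y. f (x - y))"
    using integrable_distr[of "\<lambda>y. x - y" lborel borel f] by (simp add: distr_lborel_minus_left)
  show "integrable lborel f \<Longrightarrow> integrable lborel (\<lambda>y. f (y - x))"
    using integrable_distr[of "\<lambda>y. y - x" lborel borel f] by (simp add: distr_lborel_minus_right)
qed

text \<open>Polar coordinates for radial functions: the image of Lebesgue measure on a ball under
  the norm has density \<open>d \<kappa>\<^sub>d t\<^sup>d\<^sup>-\<^sup>1\<close>.\<close>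

lemma distr_norm_cball:
  assumes r: "0 < r"
  shows "distr (density lborel (indicator (cball (0::'a::euclidean_space) r))) borel norm
    = density lborel (\<lambda>t. ennreal (DIM('a) * unit_ball_vol (DIM('a)) * t ^ (DIM('a) - 1)) * indicator {0..r} t)"
    (is "?M = ?N")
proof (rule measure_eqI_lessThan)
  let ?\<kappa> = "unit_ball_vol (real DIM('a))"
  let ?c = "\<lambda>t. real DIM('a) * ?\<kappa> * t ^ (DIM('a) - 1)"
  have d: "DIM('a) \<ge> 1" using DIM_positive[where 'a='a] by linarith
  have M: "emeasure ?M {t<..} = emeasure lborel (cball (0::'a) r \<inter> {x. t < norm x})" for t
  proof -
    have "emeasure ?M {t<..} = (\<integral>\<^sup>+x. indicator (cball (0::'a) r) x * indicator {x. t < norm x} x \<partial>lborel)"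
    proof (subst emeasure_distr)
      have [measurable]: "{x::'a. t < norm x} \<in> sets borel" by measurable
      have "norm -` {t<..} \<inter> space (density lborel (indicator (cball (0::'a) r))) = {x. t < norm x}" by auto
      then show "emeasure (density lborel (indicator (cball (0::'a) r))) (norm -` {t<..} \<inter> space (density lborel (indicator (cball (0::'a) r))))
          = (\<integral>\<^sup>+x. indicator (cball (0::'a) r) x * indicator {x. t < norm x} x \<partial>lborel)"
        by (simp only:) (subst emeasure_density, simp_all add: borel_measurable_indicator)
    qed auto
    also have "\<dots> = (\<integral>\<^sup>+x. indicator (cball (0::'a) r \<inter> {x. t < norm x}) x \<partial>lborel)"
      by (simp add: indicator_inter_arith)
    also have "\<dots> = emeasure lborel (cball (0::'a) r \<inter> {x. t < norm x})"
      by (rule nn_integral_indicator) measurable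
    finally show ?thesis .
  qed
  show "emeasure ?M {t<..} < \<infinity>" for t
  proof -
    have "emeasure ?M {t<..} \<le> emeasure lborel (cball (0::'a) r)" unfolding M by (intro emeasure_mono) auto
    also have "\<dots> < \<infinity>" using r by (simp add: emeasure_cball)
    finally show ?thesis .
  qed
  \<comment> \<open>Volumes of spherical shells: the density is the derivative of the ball volume as
    a function of the radius.\<close>
  have FTC: "(\<integral>\<^sup>+u. ennreal (?c u) * indicator {a..r} u \<partial>lborel) = ennreal (?\<kappa> * r ^ DIM('a) - ?\<kappa> * a ^ DIM('a))"
    if "0 \<le> a" "a \<le> r" for a
    by (rule nn_integral_FTC_Icc[where F="\<lambda>u. ?\<kappa> * u ^ DIM('a)"])
       (use that d in \<open>auto intro!: derivative_eq_intros\<close>)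
  show "emeasure ?M {t<..} = emeasure ?N {t<..}" for t
  proof -
    have N: "emeasure ?N {t<..} = (\<integral>\<^sup>+u. ennreal (?c u) * indicator {max 0 t..r} u \<partial>lborel)"
    proof -
      have "emeasure ?N {t<..} = (\<integral>\<^sup>+u. ennreal (?c u) * indicator {0..r} u * indicator {t<..} u \<partial>lborel)"
        by (simp add: emeasure_density)
      also have "\<dots> = (\<integral>\<^sup>+u. ennreal (?c u) * indicator {max 0 t..r} u \<partial>lborel)"
        by (rule nn_integral_cong_AE, use AE_lborel_singleton[of t] in eventually_elim)
           (auto split: split_indicator)
      finally show ?thesis .
    qed
    consider "t < 0" | "0 \<le> t" "t \<le> r" | "r < t" by linarith
    then show ?thesis
    proof cases
      case 1
      then have "cball (0::'a) r \<inter> {x. t < norm x} = cball 0 r" by (auto intro: less_le_trans)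
      then show ?thesis using 1 r FTC[of 0] d unfolding M N by (simp add: emeasure_cball max_def zero_power)
    next
      case 2
      have "cball (0::'a) r \<inter> {x. t < norm x} = cball 0 r - cball 0 t" by auto
      moreover have "emeasure lborel (cball (0::'a) r - cball 0 t)
          = emeasure lborel (cball (0::'a) r) - emeasure lborel (cball (0::'a) t)"
        using 2 by (intro emeasure_Diff) (auto simp: emeasure_cball)
      ultimately show ?thesis using 2 r FTC[of t] unfolding M N
        by (simp add: emeasure_cball max_def ennreal_minus)
    next
      case 3
      then have "cball (0::'a) r \<inter> {x. t < norm x} = {}" by auto
      moreover have "{max 0 t..r} = {}" using 3 r by auto
      ultimately show ?thesis unfolding M N by simp
    qed
  qed
qed simp_all

section \<open>Powers of the norm on a ball\<close>

definition radial :: "real \<Rightarrow> real \<Rightarrow> 'a::euclidean_space \<Rightarrow> real" where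
  "radial r b z = of_bool (norm z \<le> r) * norm z powr b"

text \<open>Closed form of the integral of \<open>radial r b\<close> over the whole space, see
  \<open>integral_radial\<close>. The type argument carries the dimension.\<close>

definition radial_mass :: "'a::euclidean_space itself \<Rightarrow> real \<Rightarrow> real \<Rightarrow> real" where
  "radial_mass _ r b = real DIM('a) * unit_ball_vol (real DIM('a)) / (b + real DIM('a)) * r powr (b + real DIM('a))"

lemma radial_measurable [measurable]: "radial r b \<in> borel_measurable borel"
  unfolding radial_def by measurable

lemma radial_nonneg [simp]: "0 \<le> radial r b z"
  unfolding radial_def by simp

lemma radial_minus [simp]: "radial r b (- z) = radial r b z"
  unfolding radial_def by simp

lemma radial_commute: "radial r b (x - y) = radial r b (y - x)"
  unfolding radial_def by (simp add: norm_minus_commute)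

lemma radial_support: "radial r b z \<noteq> 0 \<Longrightarrow> norm z \<le> r"
  unfolding radial_def by auto

lemma radial_power2: "(radial r b z)\<^sup>2 = radial r (2 * b) z"
  unfolding radial_def by (simp add: power_mult_distrib powr_add[symmetric] power2_eq_square)

lemma nn_integral_radial:
  assumes r: "0 < r" and b: "- real DIM('a::euclidean_space) < b"
  shows "(\<integral>\<^sup>+z. ennreal (radial r b (z::'a)) \<partial>lborel) = ennreal (radial_mass TYPE('a) r b)"
proof -
  let ?c = "real DIM('a) * unit_ball_vol (real DIM('a))"
  have d: "DIM('a) \<ge> 1" using DIM_positive[where 'a='a] by linarith
  have "(\<integral>\<^sup>+z. ennreal (radial r b (z::'a)) \<partial>lborel)
      = (\<integral>\<^sup>+z. indicator (cball (0::'a) r) z * ennreal (norm z powr b) \<partial>lborel)"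
    unfolding radial_def by (intro nn_integral_cong) (auto split: split_indicator)
  also have "\<dots> = (\<integral>\<^sup>+t. ennreal (t powr b) \<partial>distr (density lborel (indicator (cball (0::'a) r))) borel norm)"
    by (subst nn_integral_distr, measurable) (subst nn_integral_density, simp_all add: borel_measurable_indicator)
  also have "\<dots> = (\<integral>\<^sup>+t. ennreal (?c * t ^ (DIM('a) - 1)) * indicator {0..r} t * ennreal (t powr b) \<partial>lborel)"
    unfolding distr_norm_cball[OF r] by (subst nn_integral_density) auto
  also have "\<dots> = (\<integral>\<^sup>+t. ennreal (?c * t powr (b + DIM('a) - 1)) * indicator {0..r} t \<partial>lborel)"
  proof (intro nn_integral_cong)
    fix t :: real
    \<comment> \<open>At \<open>t = 0\<close> both sides are 0, also in dimension 1, because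
      \<open>0 powr b\<close> is 0.\<close>
    have "t ^ (DIM('a) - 1) * t powr b = t powr (b + DIM('a) - 1)" if "0 \<le> t"
    proof (cases "t = 0")
      case False
      then have "t ^ (DIM('a) - 1) = t powr (real DIM('a) - 1)"
        using that d by (simp add: powr_realpow[symmetric] of_nat_diff)
      then show ?thesis by (simp add: powr_add[symmetric] algebra_simps)
    qed simp
    then show "ennreal (?c * t ^ (DIM('a) - 1)) * indicator {0..r} t * ennreal (t powr b)
        = ennreal (?c * t powr (b + DIM('a) - 1)) * indicator {0..r} t"
      by (auto split: split_indicator simp: ennreal_mult[symmetric] mult.assoc)
  qed
  also have "\<dots> = ennreal (radial_mass TYPE('a) r b)"
  proof (rule nn_integral_has_integral_lebesgue')
    have "((\<lambda>x. x powr (b + DIM('a) - 1)) has_integral (r powr (b + DIM('a)) / (b + DIM('a)))) {0..r}"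
      using has_integral_powr_from_0[of "b + DIM('a) - 1" r] r b by simp
    from has_integral_mult_right[OF this, of ?c]
    show "((\<lambda>t. ?c * t powr (b + DIM('a) - 1)) has_integral radial_mass TYPE('a) r b) {0..r}"
      by (simp add: radial_mass_def)
  qed simp
  finally show ?thesis .
qed

lemma radial_mass_pos:
  assumes "0 < r" "- real DIM('a) < b"
  shows "0 < radial_mass TYPE('a::euclidean_space) r b"
  using assms DIM_positive[where 'a='a] unfolding radial_mass_def by (auto intro!: mult_pos_pos divide_pos_pos)

lemma
  assumes r: "0 < r" and b: "- real DIM('a) < b"
  shows integrable_radial: "integrable lborel (radial r b :: 'a::euclidean_space \<Rightarrow> real)"
    and integral_radial: "(\<integral>z. radial r b (z :: 'a) \<partial>lborel) = radial_mass TYPE('a) r b"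
proof -
  have "has_bochner_integral lborel (radial r b :: 'a \<Rightarrow> real) (radial_mass TYPE('a) r b)"
    using radial_mass_pos[OF r b] nn_integral_radial[OF r b]
    by (intro has_bochner_integral_nn_integral) auto
  then show "integrable lborel (radial r b :: 'a \<Rightarrow> real)"
    and "(\<integral>z. radial r b (z :: 'a) \<partial>lborel) = radial_mass TYPE('a) r b"
    by (auto simp: has_bochner_integral_iff)
qed

lemma
  fixes F k :: "'a::euclidean_space \<Rightarrow> real"
  assumes F: "integrable lborel F" and k: "integrable lborel k" "\<And>z. 0 \<le> k z"
  shows integrable_convolution: "integrable (lborel \<Otimes>\<^sub>M lborel) (\<lambda>(x, y). F x * k (x - y))"
      "integrable (lborel \<Otimes>\<^sub>M lborel) (\<lambda>(x, y). F y * k (x - y))"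
    and integral_convolution: "(\<integral>(x, y). F x * k (x - y) \<partial>(lborel \<Otimes>\<^sub>M lborel)) = (\<integral>x. F x \<partial>lborel) * (\<integral>z. k z \<partial>lborel)"
      "(\<integral>(x, y). F y * k (x - y) \<partial>(lborel \<Otimes>\<^sub>M lborel)) = (\<integral>x. F x \<partial>lborel) * (\<integral>z. k z \<partial>lborel)"
proof -
  have [measurable]: "F \<in> borel_measurable borel" "k \<in> borel_measurable borel"
    using F k by (auto dest: borel_measurable_integrable)
  have ky: "integrable lborel (\<lambda>y. k (x - y))" "(\<integral>y. k (x - y) \<partial>lborel) = (\<integral>z. k z \<partial>lborel)" for x
    using integrable_lborel_minus_left[OF k(1)] by (auto simp: integral_lborel_minus_left)
  have kx: "integrable lborel (\<lambda>x. k (x - y))" "(\<integral>x. k (x - y) \<partial>lborel) = (\<integral>z. k z \<partial>lborel)" for y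
    using integrable_lborel_minus_right[OF k(1)] by (auto simp: integral_lborel_minus_right)
  show 1: "integrable (lborel \<Otimes>\<^sub>M lborel) (\<lambda>(x, y). F x * k (x - y))"
    using F k ky by (intro lborel_pair.Fubini_integrable) (auto simp: abs_mult)
  have "integrable (lborel \<Otimes>\<^sub>M lborel) (\<lambda>(y, x). F y * k (x - y))"
    using F k kx by (intro lborel_pair.Fubini_integrable) (auto simp: abs_mult)
  from lborel_pair.integrable_product_swap[OF this]
  show 2: "integrable (lborel \<Otimes>\<^sub>M lborel) (\<lambda>(x, y). F y * k (x - y))" by (simp add: case_prod_unfold)
  show "(\<integral>(x, y). F x * k (x - y) \<partial>(lborel \<Otimes>\<^sub>M lborel)) = (\<integral>x. F x \<partial>lborel) * (\<integral>z. k z \<partial>lborel)"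
    using lborel_pair.integral_fst'[OF 1] ky by simp
  show "(\<integral>(x, y). F y * k (x - y) \<partial>(lborel \<Otimes>\<^sub>M lborel)) = (\<integral>x. F x \<partial>lborel) * (\<integral>z. k z \<partial>lborel)"
    using lborel_pair.integral_snd[OF 2] kx by simp
qed

section \<open>Convolution quadratic forms\<close>

definition conv_form :: "('a::euclidean_space \<Rightarrow> real) \<Rightarrow> ('a \<Rightarrow> real) \<Rightarrow> ('a \<Rightarrow> real) \<Rightarrow> real" where
  "conv_form k u v = (\<integral>(x, y). u x * v y * k (x - y) \<partial>(lborel \<Otimes>\<^sub>M lborel))"

text \<open>The pointwise bound of \<open>u x * v y\<close> by half the sum of squares separates the
  variables, and each square integrates against the kernel by translation invariance.\<close>

lemma
  fixes u v k :: "'a::euclidean_space \<Rightarrow> real"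
  assumes [measurable]: "u \<in> borel_measurable borel" "v \<in> borel_measurable borel"
    and u: "integrable lborel (\<lambda>x. (u x)\<^sup>2)" and v: "integrable lborel (\<lambda>x. (v x)\<^sup>2)"
    and k: "integrable lborel k" "\<And>z. 0 \<le> k z"
  shows integrable_conv_form: "integrable (lborel \<Otimes>\<^sub>M lborel) (\<lambda>(x, y). u x * v y * k (x - y))"
    and conv_form_bound: "\<bar>conv_form k u v\<bar> \<le> ((\<integral>x. (u x)\<^sup>2 \<partial>lborel) + (\<integral>x. (v x)\<^sup>2 \<partial>lborel)) / 2 * (\<integral>z. k z \<partial>lborel)"
proof -
  let ?R = "lborel \<Otimes>\<^sub>M lborel :: ('a \<times> 'a) measure"
  have [measurable]: "k \<in> borel_measurable borel" using k by (auto dest: borel_measurable_integrable)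
  let ?d = "\<lambda>(x, y). ((u x)\<^sup>2 * k (x - y) + (v y)\<^sup>2 * k (x - y)) / 2"
  have e: "?d = (\<lambda>p. ((case p of (x, y) \<Rightarrow> (u x)\<^sup>2 * k (x - y)) + (case p of (x, y) \<Rightarrow> (v y)\<^sup>2 * k (x - y))) / 2)"
    by (simp add: fun_eq_iff)
  have d: "integrable ?R ?d"
    unfolding e using integrable_convolution(1)[OF u k] integrable_convolution(2)[OF v k] by simp
  have dI: "(\<integral>p. ?d p \<partial>?R) = ((\<integral>x. (u x)\<^sup>2 \<partial>lborel) + (\<integral>x. (v x)\<^sup>2 \<partial>lborel)) / 2 * (\<integral>z. k z \<partial>lborel)"
    unfolding e using integrable_convolution(1)[OF u k] integrable_convolution(2)[OF v k]
      integral_convolution(1)[OF u k] integral_convolution(2)[OF v k] by (simp add: field_simps)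
  have le: "\<bar>u x * v y * k (x - y)\<bar> \<le> ((u x)\<^sup>2 * k (x - y) + (v y)\<^sup>2 * k (x - y)) / 2" for x y
  proof -
    have "0 \<le> (\<bar>u x\<bar> - \<bar>v y\<bar>)\<^sup>2" by simp
    then have "\<bar>u x * v y\<bar> \<le> ((u x)\<^sup>2 + (v y)\<^sup>2) / 2" by (simp add: power2_diff abs_mult mult.assoc)
    from mult_right_mono[OF this k(2)[of "x - y"]] show ?thesis using k(2) by (simp add: abs_mult distrib_right)
  qed
  show i: "integrable ?R (\<lambda>(x, y). u x * v y * k (x - y))"
    by (rule Bochner_Integration.integrable_bound[OF d])
       (use le order_trans[OF le abs_ge_self] in \<open>auto intro!: AE_I2\<close>)
  have "\<bar>conv_form k u v\<bar> \<le> (\<integral>p. \<bar>case p of (x, y) \<Rightarrow> u x * v y * k (x - y)\<bar> \<partial>?R)"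
    unfolding conv_form_def by (rule integral_abs_bound)
  also have "\<dots> \<le> (\<integral>p. ?d p \<partial>?R)"
    by (rule integral_mono) (use i d le in auto)
  finally show "\<bar>conv_form k u v\<bar> \<le> ((\<integral>x. (u x)\<^sup>2 \<partial>lborel) + (\<integral>x. (v x)\<^sup>2 \<partial>lborel)) / 2 * (\<integral>z. k z \<partial>lborel)"
    unfolding dI .
qed

section \<open>Continuity of translations in L1\<close>

definition translation_modulus :: "('a::euclidean_space \<Rightarrow> real) \<Rightarrow> 'a \<Rightarrow> real" where
  "translation_modulus u z = (\<integral>x. \<bar>u x - u (x - z)\<bar> \<partial>lborel)"

lemma integrable_translation_modulus:
  "integrable lborel u \<Longrightarrow> integrable lborel (\<lambda>x. \<bar>u x - u (x - z)\<bar>)" for u :: "'a::euclidean_space \<Rightarrow> real"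
  using integrable_lborel_minus_right[of u z] by simp

lemma translation_modulus_approx:
  fixes u v :: "'a::euclidean_space \<Rightarrow> real"
  assumes u: "integrable lborel u" and v: "integrable lborel v"
  shows "translation_modulus u z \<le> translation_modulus v z + 2 * (\<integral>x. \<bar>u x - v x\<bar> \<partial>lborel)"
proof -
  have uv: "integrable lborel (\<lambda>x. \<bar>u x - v x\<bar>)" using u v by simp
  have "translation_modulus u z
      \<le> (\<integral>x. \<bar>v x - v (x - z)\<bar> + \<bar>u x - v x\<bar> + \<bar>u (x - z) - v (x - z)\<bar> \<partial>lborel)"
    unfolding translation_modulus_def
    by (rule integral_mono)
       (use integrable_translation_modulus[OF u] integrable_translation_modulus[OF v] uv
          integrable_lborel_minus_right[OF uv] in \<open>auto simp: algebra_simps\<close>)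
  also have "\<dots> = translation_modulus v z + 2 * (\<integral>x. \<bar>u x - v x\<bar> \<partial>lborel)"
    using integrable_translation_modulus[OF v] uv integrable_lborel_minus_right[OF uv]
      integral_lborel_minus_right[of "\<lambda>x. \<bar>u x - v x\<bar>" z] borel_measurable_integrable[OF uv]
    by (simp add: translation_modulus_def)
  finally show ?thesis .
qed

lemma translation_modulus_nonneg: "0 \<le> translation_modulus u z"
  unfolding translation_modulus_def by simp

lemma translation_modulus_tendsto_approx:
  fixes u :: "'a::euclidean_space \<Rightarrow> real"
  assumes u: "integrable lborel u"
    and v: "\<And>e. e > 0 \<Longrightarrow> \<exists>v. integrable lborel v \<and> (\<integral>x. \<bar>u x - v x\<bar> \<partial>lborel) \<le> e
      \<and> (\<lambda>n. translation_modulus v (z n)) \<longlonglongrightarrow> 0"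
  shows "(\<lambda>n. translation_modulus u (z n)) \<longlonglongrightarrow> 0"
proof (rule LIMSEQ_I)
  fix e :: real assume e: "0 < e"
  then obtain v where v: "integrable lborel v" "(\<integral>x. \<bar>u x - v x\<bar> \<partial>lborel) \<le> e / 4"
    "(\<lambda>n. translation_modulus v (z n)) \<longlonglongrightarrow> 0"
    using v[of "e / 4"] by auto
  from LIMSEQ_D[OF v(3), of "e / 2"] e
  obtain N where N: "\<And>n. n \<ge> N \<Longrightarrow> translation_modulus v (z n) < e / 2"
    by (auto simp: translation_modulus_nonneg)
  show "\<exists>N. \<forall>n\<ge>N. norm (translation_modulus u (z n) - 0) < e"
  proof (intro exI[of _ N] allI impI)
    fix n assume "n \<ge> N"
    from N[OF this] translation_modulus_approx[OF u v(1), of "z n"] v(2)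
    show "norm (translation_modulus u (z n) - 0) < e"
      by (simp add: translation_modulus_nonneg)
  qed
qed

text \<open>Openness gives pointwise convergence: a point of \<open>U\<close> stays in
  \<open>U\<close> under small translations.\<close>

lemma translation_modulus_open:
  fixes U :: "'a::euclidean_space set"
  assumes U: "open U" "emeasure lborel U < \<infinity>" and z: "z \<longlonglongrightarrow> 0"
  shows "(\<lambda>n. translation_modulus (indicator U) (z n)) \<longlonglongrightarrow> 0"
proof -
  let ?I = "indicator U :: 'a \<Rightarrow> real"
  have [measurable]: "U \<in> sets borel" using U by simp
  have i: "integrable lborel ?I" using U by (intro integrable_real_indicator) auto
  have ip: "integrable lborel (\<lambda>x. ?I x * (1 - ?I (x - a)))" for a
    by (rule Bochner_Integration.integrable_bound[OF i]) (auto split: split_indicator)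
  have eq: "translation_modulus ?I a = 2 * (\<integral>x. ?I x * (1 - ?I (x - a)) \<partial>lborel)" for a
  proof -
    \<comment> \<open>The symmetric difference is replaced by twice its half inside
      \<open>U\<close>, as both halves have the same measure. That half is dominated by the fixed
      function \<open>indicator U\<close>, whatever the translation.\<close>
    have "translation_modulus ?I a = (\<integral>x. 2 * (?I x * (1 - ?I (x - a))) + (?I (x - a) - ?I x) \<partial>lborel)"
      unfolding translation_modulus_def
      by (intro Bochner_Integration.integral_cong refl) (auto split: split_indicator)
    also have "\<dots> = 2 * (\<integral>x. ?I x * (1 - ?I (x - a)) \<partial>lborel)"
      using ip[of a] i integrable_lborel_minus_right[OF i, of a] integral_lborel_minus_right[of ?I a] by simp
    finally show ?thesis .
  qed
  have "(\<lambda>n. \<integral>x. ?I x * (1 - ?I (x - z n)) \<partial>lborel) \<longlonglongrightarrow> (\<integral>x. 0 \<partial>(lborel :: 'a measure))"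
  proof (rule integral_dominated_convergence[where w="?I"])
    show "AE x in lborel. (\<lambda>n. ?I x * (1 - ?I (x - z n))) \<longlonglongrightarrow> 0"
    proof (rule AE_I2)
      fix x
      show "(\<lambda>n. ?I x * (1 - ?I (x - z n))) \<longlonglongrightarrow> 0"
      proof (cases "x \<in> U")
        case True
        have "(\<lambda>n. x - z n) \<longlonglongrightarrow> x" using tendsto_diff[OF tendsto_const z, of x] by simp
        then have "eventually (\<lambda>n. x - z n \<in> U) sequentially"
          using U(1) True by (rule topological_tendstoD)
        then have "eventually (\<lambda>n. ?I x * (1 - ?I (x - z n)) = 0) sequentially"
          by eventually_elim simp
        then show ?thesis by (rule tendsto_eventually)
      qed simp
    qed
  qed (use i in \<open>auto split: split_indicator\<close>)
  from tendsto_mult[OF tendsto_const[of 2] this] show ?thesis unfolding eq by simp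
qed

lemma translation_modulus_cmult: "translation_modulus (\<lambda>x. u x * c) z = translation_modulus u z * \<bar>c\<bar>"
  unfolding translation_modulus_def by (simp add: left_diff_distrib[symmetric] abs_mult)

text \<open>Density argument: outer regularity passes from open sets to Borel sets of finite
  measure, and the induction rule for integrable functions does the rest.\<close>

theorem translation_modulus_tendsto:
  fixes u :: "'a::euclidean_space \<Rightarrow> real"
  assumes u: "integrable lborel u" and z: "z \<longlonglongrightarrow> 0"
  shows "(\<lambda>n. translation_modulus u (z n)) \<longlonglongrightarrow> 0"
  using u
proof (induction rule: integrable_induct)
  case (base A c)
  then have A: "A \<in> sets borel" "emeasure lborel A < \<infinity>" by auto
  have iA: "integrable lborel (\<lambda>x. indicator A x * c)" using A by (intro integrable_mult_left integrable_real_indicator) auto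
  have "(\<lambda>n. translation_modulus (\<lambda>x. indicator A x * c) (z n)) \<longlonglongrightarrow> 0"
  proof (rule translation_modulus_tendsto_approx[OF iA])
    fix e :: real assume e: "e > 0"
    \<comment> \<open>The summand 1 keeps the denominator positive when
      \<open>c = 0\<close>.\<close>
    define e' where "e' = e / (\<bar>c\<bar> + 1)"
    have e': "e' > 0" using e by (simp add: e'_def)
    obtain U where U: "open U" "A \<subseteq> U" "emeasure lborel (U - A) < e'"
      using outer_regular_lborel[OF A(1) e'] by auto
    have [measurable]: "U \<in> sets borel" "A \<in> sets borel" using U A by auto
    have "emeasure lborel U \<le> emeasure lborel A + emeasure lborel (U - A)"
      using U(2) emeasure_subadditive[of A lborel "U - A"] by (auto simp: Un_absorb1)
    also have "\<dots> < \<infinity>" using A(2) U(3) by (simp add: ennreal_add_less_top less_top[symmetric]) (metis ennreal_less_top order.strict_trans less_irrefl)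
    finally have Ufin: "emeasure lborel U < \<infinity>" .
    have iU: "integrable lborel (indicator U :: 'a \<Rightarrow> real)" using Ufin by (intro integrable_real_indicator) auto
    have "(\<integral>x. \<bar>indicator A x * c - indicator U x * c\<bar> \<partial>lborel) = (\<integral>x. indicator (U - A) x * \<bar>c\<bar> \<partial>lborel)"
      using U(2) by (intro Bochner_Integration.integral_cong refl) (auto split: split_indicator)
    also have "\<dots> = measure lborel (U - A) * \<bar>c\<bar>" by simp
    also have "measure lborel (U - A) \<le> e'"
      using U(3) e' unfolding measure_def by (intro enn2real_leI) auto
    then have "measure lborel (U - A) * \<bar>c\<bar> \<le> e' * \<bar>c\<bar>" by (intro mult_right_mono) auto
    also have "e' * \<bar>c\<bar> \<le> e" using e by (simp add: e'_def field_simps)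
    finally have "(\<integral>x. \<bar>indicator A x * c - indicator U x * c\<bar> \<partial>lborel) \<le> e" .
    moreover have "(\<lambda>n. translation_modulus (\<lambda>x. indicator U x * c) (z n)) \<longlonglongrightarrow> 0"
      unfolding translation_modulus_cmult
      using tendsto_mult_left_zero[OF translation_modulus_open[OF U(1) Ufin z]] by simp
    ultimately show "\<exists>v. integrable lborel v \<and> (\<integral>x. \<bar>indicator A x * c - v x\<bar> \<partial>lborel) \<le> e
      \<and> (\<lambda>n. translation_modulus v (z n)) \<longlonglongrightarrow> 0"
      using iU by (intro exI[of _ "\<lambda>x. indicator U x * c"]) simp
  qed
  then show ?case by simp
next
  case (add f g)
  have le: "translation_modulus (\<lambda>x. f x + g x) a \<le> translation_modulus f a + translation_modulus g a" for a
  proof -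
    have "translation_modulus (\<lambda>x. f x + g x) a \<le> (\<integral>x. \<bar>f x - f (x - a)\<bar> + \<bar>g x - g (x - a)\<bar> \<partial>lborel)"
      unfolding translation_modulus_def
      by (rule integral_mono)
         (use integrable_translation_modulus[OF add(1), of a] integrable_translation_modulus[OF add(2), of a]
            integrable_translation_modulus[of "\<lambda>x. f x + g x" a] add(1,2) in auto)
    also have "\<dots> = translation_modulus f a + translation_modulus g a"
      unfolding translation_modulus_def
      by (rule Bochner_Integration.integral_add) (rule integrable_translation_modulus add)+
    finally show ?thesis .
  qed
  show ?case
    by (rule tendsto_sandwich[OF _ _ tendsto_const tendsto_add_zero[OF add(3,4)]])
       (auto intro!: eventuallyI le translation_modulus_nonneg)
next
  case (lim f s)
  show ?case
  proof (rule translation_modulus_tendsto_approx[OF lim.hyps(4)])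
    fix e :: real assume e: "e > 0"
    have [measurable]: "f \<in> borel_measurable borel" "\<And>i. s i \<in> borel_measurable borel"
      using lim.hyps(1,4) by (auto dest: borel_measurable_integrable)
    have "(\<lambda>i. \<integral>x. \<bar>f x - s i x\<bar> \<partial>lborel) \<longlonglongrightarrow> (\<integral>x. 0 \<partial>(lborel :: 'a measure))"
    \<comment> \<open>The approximants of the induction rule satisfy
      \<open>|s i x| <= 2 * |f x|\<close>, hence the factor 3.\<close>
    proof (rule integral_dominated_convergence[where w="\<lambda>x. 3 * \<bar>f x\<bar>"])
      show "AE x in lborel. (\<lambda>i. \<bar>f x - s i x\<bar>) \<longlonglongrightarrow> 0"
      proof (rule AE_I2)
        fix x
        have "(\<lambda>i. f x - s i x) \<longlonglongrightarrow> f x - f x" by (intro tendsto_intros lim.hyps(2)) simp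
        then show "(\<lambda>i. \<bar>f x - s i x\<bar>) \<longlonglongrightarrow> 0" by (simp add: tendsto_rabs_zero)
      qed
      show "AE x in lborel. norm \<bar>f x - s i x\<bar> \<le> 3 * \<bar>f x\<bar>" for i
      proof (rule AE_I2)
        fix x
        show "norm \<bar>f x - s i x\<bar> \<le> 3 * \<bar>f x\<bar>" using lim.hyps(3)[of x i] by simp
      qed
    qed (use lim.hyps(4) in auto)
    from LIMSEQ_D[OF this e] obtain i where i: "(\<integral>x. \<bar>f x - s i x\<bar> \<partial>lborel) < e" by force
    then show "\<exists>v. integrable lborel v \<and> (\<integral>x. \<bar>f x - v x\<bar> \<partial>lborel) \<le> e \<and> (\<lambda>n. translation_modulus v (z n)) \<longlonglongrightarrow> 0"
      using lim.hyps(1) lim.IH by (intro exI[of _ "s i"]) auto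
  qed
qed

lemma translation_modulus_small:
  fixes u :: "'a::euclidean_space \<Rightarrow> real"
  assumes u: "integrable lborel u" and e: "0 < e"
  obtains \<delta> where "0 < \<delta>" "\<And>z. norm z \<le> \<delta> \<Longrightarrow> translation_modulus u z \<le> e"
proof -
  have "eventually (\<lambda>z. translation_modulus u z < e) (nhds 0)"
    unfolding eventually_nhds_iff_sequentially
    using translation_modulus_tendsto[OF u] e by (auto dest: order_tendstoD(2))
  then obtain d where d: "d > 0" "\<And>z. norm z < d \<Longrightarrow> translation_modulus u z < e"
    unfolding eventually_nhds_metric by (auto simp: dist_norm)
  show ?thesis
    by (rule that[of "d / 2"]) (use d in \<open>auto intro!: less_imp_le\<close>)
qed

text \<open>Substituting \<open>z = x - y\<close> and integrating over \<open>x\<close> first turns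
  the double integral into an average of the translation modulus with weight \<open>k\<close>, so
  only shifts in the support of \<open>k\<close> matter.\<close>

lemma
  fixes u k :: "'a::euclidean_space \<Rightarrow> real"
  assumes u: "integrable lborel u" and k: "integrable lborel k" "\<And>z. 0 \<le> k z"
    and small: "\<And>z. k z \<noteq> 0 \<Longrightarrow> translation_modulus u z \<le> e"
  shows integrable_diff_convolution: "integrable (lborel \<Otimes>\<^sub>M lborel) (\<lambda>(x, y). \<bar>u x - u y\<bar> * k (x - y))"
    and integral_diff_convolution_le:
      "(\<integral>(x, y). \<bar>u x - u y\<bar> * k (x - y) \<partial>(lborel \<Otimes>\<^sub>M lborel)) \<le> e * (\<integral>z. k z \<partial>lborel)"
proof -
  have [measurable]: "u \<in> borel_measurable borel" "k \<in> borel_measurable borel"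
    using u k by (auto dest: borel_measurable_integrable)
  have d: "integrable (lborel \<Otimes>\<^sub>M lborel) (\<lambda>p. (case p of (x, y) \<Rightarrow> \<bar>u x\<bar> * k (x - y)) + (case p of (x, y) \<Rightarrow> \<bar>u y\<bar> * k (x - y)))"
    using integrable_convolution(1)[OF integrable_abs[OF u] k] integrable_convolution(2)[OF integrable_abs[OF u] k] by simp
  show i: "integrable (lborel \<Otimes>\<^sub>M lborel) (\<lambda>(x, y). \<bar>u x - u y\<bar> * k (x - y))"
  proof (rule Bochner_Integration.integrable_bound[OF d])
    show "AE p in lborel \<Otimes>\<^sub>M lborel. norm (case p of (x, y) \<Rightarrow> \<bar>u x - u y\<bar> * k (x - y))
        \<le> norm ((case p of (x, y) \<Rightarrow> \<bar>u x\<bar> * k (x - y)) + (case p of (x, y) \<Rightarrow> \<bar>u y\<bar> * k (x - y)))"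
      using k(2) by (intro AE_I2) (auto simp: abs_mult distrib_right[symmetric] intro!: mult_right_mono)
  qed measurable
  have i2: "integrable (lborel \<Otimes>\<^sub>M lborel) (\<lambda>(z, x). \<bar>u x - u (x - z)\<bar> * k z)"
  proof (rule lborel_pair.Fubini_integrable)
    have "integrable lborel (\<lambda>z. translation_modulus u z * k z)"
    proof (rule Bochner_Integration.integrable_bound[of _ "\<lambda>z. e * k z"])
      show "(\<lambda>z. translation_modulus u z * k z) \<in> borel_measurable lborel"
        unfolding translation_modulus_def by measurable
      show "AE z in lborel. norm (translation_modulus u z * k z) \<le> norm (e * k z)"
      proof (rule AE_I2)
        fix z show "norm (translation_modulus u z * k z) \<le> norm (e * k z)"
          using small[of z] k(2)[of z] translation_modulus_nonneg[of u z]
          by (cases "k z = 0") (auto simp: abs_mult intro!: mult_right_mono)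
      qed
    qed (use k in auto)
    then show "integrable lborel (\<lambda>x. \<integral>y. norm (case (x, y) of (z, x) \<Rightarrow> \<bar>u x - u (x - z)\<bar> * k z) \<partial>lborel)"
      using k(2) by (simp add: abs_mult translation_modulus_def)
  qed (use integrable_translation_modulus[OF u] in auto)
  have "(\<integral>(x, y). \<bar>u x - u y\<bar> * k (x - y) \<partial>(lborel \<Otimes>\<^sub>M lborel)) = (\<integral>x. \<integral>y. \<bar>u x - u y\<bar> * k (x - y) \<partial>lborel \<partial>lborel)"
    using lborel_pair.integral_fst'[OF i] by simp
  also have "\<dots> = (\<integral>x. \<integral>z. \<bar>u x - u (x - z)\<bar> * k z \<partial>lborel \<partial>lborel)"
  proof (rule Bochner_Integration.integral_cong[OF refl])
    fix x
    show "(\<integral>y. \<bar>u x - u y\<bar> * k (x - y) \<partial>lborel) = (\<integral>z. \<bar>u x - u (x - z)\<bar> * k z \<partial>lborel)"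
      using integral_lborel_minus_left[of "\<lambda>y. \<bar>u x - u y\<bar> * k (x - y)" x] by simp
  qed
  also have "\<dots> = (\<integral>z. \<integral>x. \<bar>u x - u (x - z)\<bar> * k z \<partial>lborel \<partial>lborel)"
    using lborel_pair.Fubini_integral[OF i2] .
  also have "\<dots> = (\<integral>z. translation_modulus u z * k z \<partial>lborel)"
    by (simp add: translation_modulus_def)
  also have "\<dots> \<le> (\<integral>z. e * k z \<partial>lborel)"
  proof (rule integral_mono_AE)
    show "integrable lborel (\<lambda>z. translation_modulus u z * k z)"
      using lborel_pair.integrable_fst'[OF i2] by (simp add: translation_modulus_def)
    show "AE z in lborel. translation_modulus u z * k z \<le> e * k z"
    proof (rule AE_I2)
      fix z show "translation_modulus u z * k z \<le> e * k z"
        using small[of z] k(2)[of z] by (cases "k z = 0") (auto intro!: mult_right_mono)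
    qed
  qed (use k in auto)
  finally show "(\<integral>(x, y). \<bar>u x - u y\<bar> * k (x - y) \<partial>(lborel \<Otimes>\<^sub>M lborel)) \<le> e * (\<integral>z. k z \<partial>lborel)"
    using k by simp
qed

text \<open>Carries continuity of translations from L1 to squared differences. Clipping at level
  \<open>T\<close> is 1-Lipschitz with oscillation at most \<open>2 * T\<close>, so the squared
  difference of clipped values is linear in \<open>|a - b|\<close>; the clipping errors will be
  small in L2.\<close>

lemma truncated_diff_power2_le:
  fixes a b T :: real
  assumes T: "0 \<le> T"
  defines "c \<equiv> \<lambda>x. max (- T) (min T x)"
  shows "(a - b)\<^sup>2 \<le> 4 * T * \<bar>a - b\<bar> + 4 * (a - c a)\<^sup>2 + 4 * (b - c b)\<^sup>2"
proof -
  have le: "\<bar>c a - c b\<bar> \<le> \<bar>a - b\<bar>" "\<bar>c a - c b\<bar> \<le> 2 * T" using T by (auto simp: c_def)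
  have "(c a - c b)\<^sup>2 \<le> 2 * T * \<bar>a - b\<bar>"
    using mult_mono[OF le(2,1)] T by (simp add: power2_eq_square)
  moreover have "(a - b)\<^sup>2 \<le> 2 * (c a - c b)\<^sup>2 + 4 * (a - c a)\<^sup>2 + 4 * (b - c b)\<^sup>2"
  proof -
    define p q w where "p = c a - c b" and "q = a - c a" and "w = b - c b"
    have "a - b = p + (q - w)" by (simp add: p_def q_def w_def)
    moreover have "(p + (q - w))\<^sup>2 \<le> 2 * p\<^sup>2 + 4 * q\<^sup>2 + 4 * w\<^sup>2"
    proof -
      \<comment> \<open>The expression is exactly the difference of the two sides of the
        claim.\<close>
      have "0 \<le> (p - (q - w))\<^sup>2 + 2 * (q + w)\<^sup>2" by simp
      then show ?thesis by (simp add: power2_eq_square algebra_simps)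
    qed
    ultimately show ?thesis by (simp add: p_def q_def w_def)
  qed
  ultimately show ?thesis by linarith
qed

text \<open>Since \<open>\<parallel>u\<parallel>\<^sup>2 \<integral>k - \<langle>u, k * u\<rangle>\<close> equals half the integral of \<open>(u x - u y)\<^sup>2 k (x - y)\<close>,
  it is small as soon as translations act continuously on \<open>u\<close>.\<close>

theorem conv_form_approx_identity:
  fixes u :: "'a::euclidean_space \<Rightarrow> real"
  assumes u: "integrable lborel u" and u2: "integrable lborel (\<lambda>x. (u x)\<^sup>2)" and e: "0 < e"
  obtains \<delta> where "0 < \<delta>"
    "\<And>k. integrable lborel k \<Longrightarrow> (\<And>z. 0 \<le> k z) \<Longrightarrow> (\<And>z. k z \<noteq> 0 \<Longrightarrow> norm z \<le> \<delta>) \<Longrightarrow>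
      \<bar>conv_form k u u - (\<integral>x. (u x)\<^sup>2 \<partial>lborel) * (\<integral>z. k z \<partial>lborel)\<bar> \<le> e * (\<integral>z. k z \<partial>lborel)"
proof -
  have [measurable]: "u \<in> borel_measurable borel" using u by (auto dest: borel_measurable_integrable)
  define c where "c T x = max (- T) (min T x)" for T x :: real
  define E where "E T x = (u x - c T (u x))\<^sup>2" for T x
  have [measurable]: "E T \<in> borel_measurable borel" for T unfolding E_def c_def by measurable
  have Ele: "\<bar>E T x\<bar> \<le> (u x)\<^sup>2" if "0 \<le> T" for T x
  proof -
    have "\<bar>u x - c T (u x)\<bar> \<le> \<bar>u x\<bar>" using that by (auto simp: c_def)
    then show ?thesis unfolding E_def by (metis abs_le_square_iff abs_power2)
  qed
  have Ei: "integrable lborel (E T)" if "0 \<le> T" for T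
    by (rule Bochner_Integration.integrable_bound[OF u2]) (use Ele[OF that] in auto)
  have "(\<lambda>n. \<integral>x. E (real n) x \<partial>lborel) \<longlonglongrightarrow> (\<integral>x. 0 \<partial>(lborel :: 'a measure))"
  proof (rule integral_dominated_convergence[OF _ _ u2])
    show "AE x in lborel. (\<lambda>n. E (real n) x) \<longlonglongrightarrow> 0"
    proof (rule AE_I2)
      fix x
      have "eventually (\<lambda>n. \<bar>u x\<bar> \<le> real n) sequentially"
        using filterlim_real_sequentially by (auto simp: filterlim_at_top)
      then have "eventually (\<lambda>n. E (real n) x = 0) sequentially"
        by eventually_elim (auto simp: E_def c_def)
      then show "(\<lambda>n. E (real n) x) \<longlonglongrightarrow> 0" by (rule tendsto_eventually)
    qed
  qed (use Ele in auto)
  from LIMSEQ_D[OF this, of "e / 8"] e obtain n where "\<bar>\<integral>x. E (real n) x \<partial>lborel\<bar> < e / 8" by force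
  then obtain T where T: "0 \<le> T" "(\<integral>x. E T x \<partial>lborel) \<le> e / 8"
    by (intro that[of "real n"]) auto
  \<comment> \<open>Calibrated so that the integral of the squared differences is at most
    \<open>2 * e\<close> times the mass of \<open>k\<close>: one \<open>e\<close> from
    \<open>4 * T\<close> times this modulus, the other from the two clipping errors
    \<open>e / 8\<close> with weight 4 each. The 1 in the denominator covers
    \<open>T = 0\<close>.\<close>
  obtain \<delta> where \<delta>: "0 < \<delta>" "\<And>z. norm z \<le> \<delta> \<Longrightarrow> translation_modulus u z \<le> e / (4 * T + 1)"
    using translation_modulus_small[OF u, of "e / (4 * T + 1)"] e T by (auto simp: field_simps)
  show ?thesis
  proof (rule that[OF \<delta>(1)])
    fix k :: "'a \<Rightarrow> real"
    assume k: "integrable lborel k" "\<And>z. 0 \<le> k z" and supp: "\<And>z. k z \<noteq> 0 \<Longrightarrow> norm z \<le> \<delta>"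
    let ?R = "lborel \<Otimes>\<^sub>M lborel :: ('a \<times> 'a) measure"
    let ?K = "\<integral>z. k z \<partial>lborel"
    have [measurable]: "k \<in> borel_measurable borel" using k by (auto dest: borel_measurable_integrable)
    have K: "0 \<le> ?K" using k by simp
    have ic: "integrable ?R (\<lambda>(x, y). u x * u y * k (x - y))" by (rule integrable_conv_form) (use u2 k in auto)
    have small: "k z \<noteq> 0 \<Longrightarrow> translation_modulus u z \<le> e / (4 * T + 1)" for z using supp \<delta>(2) by auto
    note i1 = integrable_convolution(1)[OF u2 k] integrable_convolution(2)[OF u2 k]
    note I1 = integral_convolution(1)[OF u2 k] integral_convolution(2)[OF u2 k]
    note iE = integrable_convolution(1)[OF Ei[OF T(1)] k] integrable_convolution(2)[OF Ei[OF T(1)] k]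
    note IE = integral_convolution(1)[OF Ei[OF T(1)] k] integral_convolution(2)[OF Ei[OF T(1)] k]
    note iD = integrable_diff_convolution[OF u k small]
    note ID = integral_diff_convolution_le[OF u k small]
    let ?q = "\<lambda>(x, y). (u x - u y)\<^sup>2 * k (x - y)"
    have q: "?q = (\<lambda>p. (case p of (x, y) \<Rightarrow> (u x)\<^sup>2 * k (x - y)) + (case p of (x, y) \<Rightarrow> (u y)\<^sup>2 * k (x - y))
        - 2 * (case p of (x, y) \<Rightarrow> u x * u y * k (x - y)))"
      by (simp add: fun_eq_iff power2_eq_square algebra_simps)
    have iq: "integrable ?R ?q" unfolding q using i1 ic by simp
    have Iq: "(\<integral>p. ?q p \<partial>?R) = 2 * ((\<integral>x. (u x)\<^sup>2 \<partial>lborel) * ?K) - 2 * conv_form k u u"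
      unfolding q using i1 ic by (simp add: I1 conv_form_def)
    let ?b = "\<lambda>p. 4 * T * (case p of (x, y) \<Rightarrow> \<bar>u x - u y\<bar> * k (x - y))
        + 4 * (case p of (x, y) \<Rightarrow> E T x * k (x - y)) + 4 * (case p of (x, y) \<Rightarrow> E T y * k (x - y))"
    have "(\<integral>p. ?q p \<partial>?R) \<le> (\<integral>p. ?b p \<partial>?R)"
    proof (rule integral_mono[OF iq])
      show "integrable ?R ?b" using iD iE by simp
      fix p :: "'a \<times> 'a"
      obtain x y where p: "p = (x, y)" by (cases p)
      from mult_right_mono[OF truncated_diff_power2_le[OF T(1), of "u x" "u y"] k(2)[of "x - y"]]
      show "?q p \<le> ?b p" by (simp add: p E_def c_def algebra_simps)
    qed
    also have "\<dots> = 4 * T * (\<integral>(x, y). \<bar>u x - u y\<bar> * k (x - y) \<partial>?R) + 8 * ((\<integral>x. E T x \<partial>lborel) * ?K)"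
      using iD iE by (simp add: IE)
    also have "\<dots> \<le> 4 * T * (e / (4 * T + 1) * ?K) + 8 * (e / 8 * ?K)"
      using ID T K by (intro add_mono mult_left_mono mult_right_mono) auto
    also have "\<dots> \<le> 2 * (e * ?K)"
    proof -
      have "4 * T * (e / (4 * T + 1)) \<le> e" using T e by (simp add: field_simps)
      from mult_right_mono[OF this K] show ?thesis by simp
    qed
    finally have 1: "(\<integral>p. ?q p \<partial>?R) \<le> 2 * (e * ?K)" .
    have 2: "0 \<le> (\<integral>p. ?q p \<partial>?R)" using k(2) by (intro integral_nonneg_AE AE_I2) auto
    show "\<bar>conv_form k u u - (\<integral>x. (u x)\<^sup>2 \<partial>lborel) * ?K\<bar> \<le> e * ?K"
      using 1 2 unfolding Iq by (simp add: abs_le_iff)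
  qed
qed

section \<open>Samples from perturbed uniform densities\<close>

text \<open>\<open>U\<close> is a Borel subset of full measure in \<open>W\<close>, \<open>G\<close> is \<open>g\<close> set to \<open>0\<close> outside \<open>U\<close>, and \<open>D\<close> is the
  distance to the boundary of \<open>W\<close>.\<close>

locale perturbed_uniform =
  fixes U :: "'a::euclidean_space set" and G D :: "'a \<Rightarrow> real" and \<delta> C \<rho>\<^sub>0 :: real
  assumes U_borel [measurable]: "U \<in> sets borel" and U_vol: "emeasure lborel U = 1"
    and G_borel [measurable]: "G \<in> borel_measurable borel" and G_outside: "x \<notin> U \<Longrightarrow> G x = 0"
    and G3_integrable: "integrable lborel (\<lambda>x. \<bar>G x\<bar> ^ 3)" and G_mean: "(\<integral>x. G x \<partial>lborel) = 0"
    and D_borel [measurable]: "D \<in> borel_measurable borel"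
    and ball_in_U: "x \<in> U \<Longrightarrow> r < D x \<Longrightarrow> AE y in lborel. norm (x - y) \<le> r \<longrightarrow> y \<in> U"
    and delta_pos: "0 < \<delta>" and gap: "G x \<noteq> 0 \<Longrightarrow> \<delta> \<le> D x"
    and rho0_pos: "0 < \<rho>\<^sub>0"
    and strip: "0 < \<rho> \<Longrightarrow> \<rho> < \<rho>\<^sub>0 \<Longrightarrow> measure lborel {x \<in> U. D x \<le> \<rho>} \<le> C * \<rho>"
begin

abbreviation I :: "'a \<Rightarrow> real" where "I \<equiv> indicator U"

lemma I_integrable: "integrable lborel I" and I_integral: "(\<integral>x. I x \<partial>lborel) = 1"
  and I2_integrable: "integrable lborel (\<lambda>x. (I x)\<^sup>2)" and I2_integral: "(\<integral>x. (I x)\<^sup>2 \<partial>lborel) = 1"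
proof -
  show 1: "integrable lborel I" by (rule integrable_real_indicator) (auto simp: U_vol)
  show 2: "(\<integral>x. I x \<partial>lborel) = 1" using U_vol by (simp add: measure_def)
  have e: "(\<lambda>x. (I x)\<^sup>2) = I" by (auto simp: fun_eq_iff split: split_indicator)
  show "integrable lborel (\<lambda>x. (I x)\<^sup>2)" "(\<integral>x. (I x)\<^sup>2 \<partial>lborel) = 1"
    unfolding e by (rule 1 2)+
qed

lemma G_I: "G x * I x = G x"
  using G_outside[of x] by (auto split: split_indicator)

text \<open>As \<open>U\<close> has finite volume, lower powers of \<open>|G|\<close> are dominated
  by \<open>I\<close> where \<open>|G| <= 1\<close> and by the cube elsewhere.\<close>

lemma G_integrable: "integrable lborel G" and G2_integrable: "integrable lborel (\<lambda>x. (G x)\<^sup>2)"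
proof -
  have i: "integrable lborel (\<lambda>x. I x + \<bar>G x\<bar> ^ 3)" using I_integrable G3_integrable by simp
  have le: "\<bar>G x\<bar> ^ k \<le> I x + \<bar>G x\<bar> ^ 3" if "k \<in> {1, 2}" for k x
  proof (cases "\<bar>G x\<bar> \<le> 1")
    case True
    show ?thesis
    proof (cases "x \<in> U")
      case True
      have "\<bar>G x\<bar> ^ k \<le> 1" using \<open>\<bar>G x\<bar> \<le> 1\<close> by (simp add: power_le_one)
      then show ?thesis using True by (simp add: add_increasing2)
    qed (use G_outside[of x] that in auto)
  next
    case False
    then have "\<bar>G x\<bar> ^ k \<le> \<bar>G x\<bar> ^ 3" using that by (intro power_increasing) auto
    then show ?thesis by (auto split: split_indicator)
  qed
  show "integrable lborel G"
    by (rule Bochner_Integration.integrable_bound[OF i]) (use le[of 1] in \<open>auto intro!: AE_I2 order_trans[OF _ abs_ge_self]\<close>)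
  show "integrable lborel (\<lambda>x. (G x)\<^sup>2)"
    by (rule Bochner_Integration.integrable_bound[OF i]) (use le[of 2] in \<open>auto intro!: AE_I2 order_trans[OF _ abs_ge_self]\<close>)
qed

lemma D_less_imp: "0 < r \<Longrightarrow> r < \<delta> \<Longrightarrow> G x \<noteq> 0 \<Longrightarrow> x \<in> U \<and> r < D x"
  using gap[of x] G_outside[of x] by force

text \<open>Projection of the kernel under the uniform density alone. It equals the full mass at
  points farther than \<open>r\<close> from the boundary and never exceeds it.\<close>

definition h\<^sub>0 :: "real \<Rightarrow> real \<Rightarrow> 'a \<Rightarrow> real" where
  "h\<^sub>0 r b x = (\<integral>y. I y * radial r b (x - y) \<partial>lborel)"

lemma h0_measurable [measurable]: "h\<^sub>0 r b \<in> borel_measurable borel"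
  unfolding h\<^sub>0_def by measurable

context
  fixes r b :: real
  assumes r: "0 < r" and b: "- real DIM('a) < b"
begin

lemma integrable_radial_shift: "integrable lborel (\<lambda>y. radial r b (x - y) :: real)" for x :: 'a
  by (rule integrable_lborel_minus_left[OF integrable_radial[OF r b]])

lemma integral_radial_shift: "(\<integral>y. radial r b (x - y) \<partial>lborel) = radial_mass TYPE('a) r b" for x :: 'a
  using integral_lborel_minus_left[of "radial r b" x] integral_radial[OF r b] by simp

lemma h0_nonneg: "0 \<le> h\<^sub>0 r b x" unfolding h\<^sub>0_def by simp

lemma h0_le: "h\<^sub>0 r b x \<le> radial_mass TYPE('a) r b"
proof -
  have "h\<^sub>0 r b x \<le> (\<integral>y. radial r b (x - y) \<partial>lborel)"
    unfolding h\<^sub>0_def by (rule integral_mono_AE') (auto intro!: AE_I2 integrable_radial_shift split: split_indicator)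
  then show ?thesis by (simp add: integral_radial_shift)
qed

lemma h0_eq: "h\<^sub>0 r b x = radial_mass TYPE('a) r b" if "x \<in> U" "r < D x"
proof -
  have "h\<^sub>0 r b x = (\<integral>y. radial r b (x - y) \<partial>lborel)"
    unfolding h\<^sub>0_def
  proof (rule integral_cong_AE)
    show "AE y in lborel. I y * radial r b (x - y) = radial r b (x - y)"
      using ball_in_U[OF that]
    proof eventually_elim
      case (elim y)
      then show ?case using radial_support[of r b "x - y"] by (cases "radial r b (x - y) = 0") auto
    qed
  qed measurable
  then show ?thesis by (simp add: integral_radial_shift)
qed

text \<open>The cross term has to vanish exactly and not just asymptotically: it carries the factor
  \<open>a\<close>, which dominates the \<open>a^2\<close> of the term that determines the
  limit.\<close>

lemma conv_form_G_I: "conv_form (radial r b) G I = 0" if "r < \<delta>"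
proof -
  have "conv_form (radial r b) G I = (\<integral>x. \<integral>y. G x * I y * radial r b (x - y) \<partial>lborel \<partial>lborel)"
    unfolding conv_form_def
    using lborel_pair.integral_fst'[OF integrable_conv_form[OF _ _ G2_integrable I2_integrable integrable_radial[OF r b]]]
    by simp
  also have "\<dots> = (\<integral>x. G x * h\<^sub>0 r b x \<partial>lborel)"
    by (simp add: h\<^sub>0_def mult.assoc)
  also have "\<dots> = (\<integral>x. G x * radial_mass TYPE('a) r b \<partial>lborel)"
  proof (intro Bochner_Integration.integral_cong refl)
    fix x show "G x * h\<^sub>0 r b x = G x * radial_mass TYPE('a) r b"
      using D_less_imp[OF r that, of x] h0_eq[of x] by (cases "G x = 0") auto
  qed
  finally show ?thesis by (simp add: G_mean)
qed

lemma strip_measure: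
  assumes "r < \<rho>\<^sub>0"
  shows "integrable lborel (indicator {x \<in> U. D x \<le> r} :: 'a \<Rightarrow> real)"
    and "(\<integral>x. indicator {x \<in> U. D x \<le> r} x \<partial>lborel) \<le> C * r"
proof -
  have [measurable]: "{x \<in> U. D x \<le> r} \<in> sets borel"
  proof -
    have "{x \<in> U. D x \<le> r} = U \<inter> {x \<in> space borel. D x \<le> r}" by auto
    also have "\<dots> \<in> sets borel" by (intro sets.Int U_borel) measurable
    finally show ?thesis .
  qed
  have "emeasure lborel {x \<in> U. D x \<le> r} \<le> emeasure lborel U" by (intro emeasure_mono) auto
  then have "emeasure lborel {x \<in> U. D x \<le> r} < \<infinity>" unfolding U_vol by (simp add: order_le_less_trans)
  then show "integrable lborel (indicator {x \<in> U. D x \<le> r} :: 'a \<Rightarrow> real)" by (intro integrable_real_indicator) auto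
  show "(\<integral>x. indicator {x \<in> U. D x \<le> r} x \<partial>lborel) \<le> C * r" using strip[OF r assms] by simp
qed

text \<open>Only points within \<open>r\<close> of the boundary lose mass, each at most the full
  mass, and they occupy volume at most \<open>C * r\<close>. Used with exponent \<open>2 * b\<close>
  for the variance and with \<open>b\<close> for the bias of the closed formula.\<close>

lemma conv_form_I_I:
  assumes "r < \<rho>\<^sub>0"
  shows "\<bar>conv_form (radial r b) I I - radial_mass TYPE('a) r b\<bar> \<le> radial_mass TYPE('a) r b * (C * r)"
proof -
  let ?S = "indicator {x \<in> U. D x \<le> r} :: 'a \<Rightarrow> real"
  have K: "0 \<le> radial_mass TYPE('a) r b" using radial_mass_pos[OF r b] by simp
  have "conv_form (radial r b) I I = (\<integral>x. \<integral>y. I x * I y * radial r b (x - y) \<partial>lborel \<partial>lborel)"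
    unfolding conv_form_def
    using lborel_pair.integral_fst'[OF integrable_conv_form[OF _ _ I2_integrable I2_integrable integrable_radial[OF r b]]]
    by simp
  also have "\<dots> = (\<integral>x. I x * h\<^sub>0 r b x \<partial>lborel)" by (simp add: h\<^sub>0_def mult.assoc)
  finally have eq: "conv_form (radial r b) I I = (\<integral>x. I x * h\<^sub>0 r b x \<partial>lborel)" .
  have ih: "integrable lborel (\<lambda>x. I x * h\<^sub>0 r b x)"
    by (rule Bochner_Integration.integrable_bound[of _ "\<lambda>x. radial_mass TYPE('a) r b * I x"])
       (use I_integrable h0_nonneg h0_le K in \<open>auto intro!: AE_I2 split: split_indicator simp: abs_mult\<close>)
  have "radial_mass TYPE('a) r b - conv_form (radial r b) I I = (\<integral>x. radial_mass TYPE('a) r b * I x - I x * h\<^sub>0 r b x \<partial>lborel)"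
    unfolding eq using ih I_integrable I_integral by simp
  moreover have "0 \<le> (\<integral>x. radial_mass TYPE('a) r b * I x - I x * h\<^sub>0 r b x \<partial>lborel)"
    using h0_le by (intro integral_nonneg_AE AE_I2) (auto split: split_indicator)
  moreover have "(\<integral>x. radial_mass TYPE('a) r b * I x - I x * h\<^sub>0 r b x \<partial>lborel) \<le> (\<integral>x. radial_mass TYPE('a) r b * ?S x \<partial>lborel)"
  proof (rule integral_mono)
    show "integrable lborel (\<lambda>x. radial_mass TYPE('a) r b * I x - I x * h\<^sub>0 r b x)" using ih I_integrable by simp
    show "integrable lborel (\<lambda>x. radial_mass TYPE('a) r b * ?S x)" using strip_measure[OF assms] by simp
    fix x show "radial_mass TYPE('a) r b * I x - I x * h\<^sub>0 r b x \<le> radial_mass TYPE('a) r b * ?S x"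
      using h0_eq[of x] h0_nonneg[of x] K by (auto split: split_indicator)
  qed
  moreover have "(\<integral>x. radial_mass TYPE('a) r b * ?S x \<partial>lborel) \<le> radial_mass TYPE('a) r b * (C * r)"
    using mult_left_mono[OF strip_measure(2)[OF assms] K] by simp
  ultimately show ?thesis by linarith
qed

end

lemma conv_form_commute: "conv_form (radial r b) u v = conv_form (radial r b) v u"
  if "integrable (lborel \<Otimes>\<^sub>M lborel) (\<lambda>(x, y). v x * u y * radial r b (x - y))"
  for u v :: "'a \<Rightarrow> real"
proof -
  have "conv_form (radial r b) v u = (\<integral>(x, y). v y * u x * radial r b (y - x) \<partial>(lborel \<Otimes>\<^sub>M lborel))"
    unfolding conv_form_def
    using lborel_pair.integral_product_swap[of "\<lambda>(x, y). v x * u y * radial r b (x - y)"] borel_measurable_integrable[OF that]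
    by (simp add: case_prod_unfold)
  also have "\<dots> = conv_form (radial r b) u v"
    unfolding conv_form_def by (simp add: radial_commute mult.commute)
  finally show ?thesis by simp
qed

end

section \<open>One perturbed density and its sample\<close>

locale perturbed_sample = perturbed_uniform +
  fixes a :: real
  assumes density_nonneg: "x \<in> U \<Longrightarrow> 0 \<le> 1 + a * G x"
begin

definition f :: "'a \<Rightarrow> real" where "f x = I x + a * G x"

definition Q :: "'a measure" where "Q = density lborel (\<lambda>x. ennreal (f x))"

lemma f_measurable [measurable]: "f \<in> borel_measurable borel" unfolding f_def by measurable

lemma f_nonneg: "0 \<le> f x"
  using density_nonneg[of x] G_outside[of x] by (cases "x \<in> U") (auto simp: f_def)

lemma f_integrable: "integrable lborel f" and f_integral: "(\<integral>x. f x \<partial>lborel) = 1"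
  unfolding f_def using I_integrable G_integrable I_integral G_mean by auto

lemma f2_integrable: "integrable lborel (\<lambda>x. (f x)\<^sup>2)"
  and f2_integral: "(\<integral>x. (f x)\<^sup>2 \<partial>lborel) = 1 + a\<^sup>2 * (\<integral>x. (G x)\<^sup>2 \<partial>lborel)"
proof -
  have e: "(f x)\<^sup>2 = (I x)\<^sup>2 + 2 * a * G x + a\<^sup>2 * (G x)\<^sup>2" for x
    unfolding f_def using G_I[of x] by (simp add: power2_eq_square algebra_simps)
  show "integrable lborel (\<lambda>x. (f x)\<^sup>2)" "(\<integral>x. (f x)\<^sup>2 \<partial>lborel) = 1 + a\<^sup>2 * (\<integral>x. (G x)\<^sup>2 \<partial>lborel)"
    unfolding e using I2_integrable I2_integral G_integrable G2_integrable G_mean by auto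
qed

lemma f3_integrable: "integrable lborel (\<lambda>x. f x ^ 3)"
  and f3_integral: "(\<integral>x. f x ^ 3 \<partial>lborel) \<le> 4 * (1 + \<bar>a\<bar> ^ 3 * (\<integral>x. \<bar>G x\<bar> ^ 3 \<partial>lborel))"
proof -
  have cube: "(p + q) ^ 3 \<le> 4 * (p ^ 3 + q ^ 3)" if "0 \<le> p" "0 \<le> q" for p q :: real
  proof -
    have "0 \<le> 3 * (p + q) * (p - q)\<^sup>2" using that by simp
    then show ?thesis by (simp add: power2_eq_square power3_eq_cube algebra_simps)
  qed
  have le: "f x ^ 3 \<le> 4 * (I x + \<bar>a\<bar> ^ 3 * \<bar>G x\<bar> ^ 3)" for x
  proof -
    have "f x ^ 3 \<le> (I x + \<bar>a\<bar> * \<bar>G x\<bar>) ^ 3"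
      using f_nonneg[of x] by (intro power_mono) (auto simp: f_def abs_mult[symmetric])
    also have "\<dots> \<le> 4 * ((I x) ^ 3 + (\<bar>a\<bar> * \<bar>G x\<bar>) ^ 3)" by (rule cube) auto
    also have "(I x) ^ 3 = I x" by (auto split: split_indicator)
    finally show ?thesis by (simp add: power_mult_distrib)
  qed
  have i: "integrable lborel (\<lambda>x. 4 * (I x + \<bar>a\<bar> ^ 3 * \<bar>G x\<bar> ^ 3))" using I_integrable G3_integrable by simp
  show f3: "integrable lborel (\<lambda>x. f x ^ 3)"
    by (rule Bochner_Integration.integrable_bound[OF i])
       (use le f_nonneg in \<open>auto intro!: AE_I2 order_trans[OF _ abs_ge_self]\<close>)
  have "(\<integral>x. f x ^ 3 \<partial>lborel) \<le> (\<integral>x. 4 * (I x + \<bar>a\<bar> ^ 3 * \<bar>G x\<bar> ^ 3) \<partial>lborel)"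
    by (rule integral_mono[OF f3 i le])
  then show "(\<integral>x. f x ^ 3 \<partial>lborel) \<le> 4 * (1 + \<bar>a\<bar> ^ 3 * (\<integral>x. \<bar>G x\<bar> ^ 3 \<partial>lborel))"
    using I_integrable G3_integrable I_integral by simp
qed

lemma sets_Q [measurable_cong, simp]: "sets Q = sets borel" unfolding Q_def by simp

sublocale iid_sample Q
proof -
  have "emeasure Q (space Q) = (\<integral>\<^sup>+x. ennreal (f x) \<partial>lborel)"
    unfolding Q_def by (simp add: emeasure_density)
  also have "\<dots> = ennreal 1" using f_integrable f_nonneg f_integral by (subst nn_integral_eq_integral) auto
  finally have "prob_space Q" by (intro prob_spaceI) simp
  then show "iid_sample Q" by (intro iid_sample.intro iid_sample_axioms.intro) (simp_all add: Q_def)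
qed

lemma integral_Q: "\<phi> \<in> borel_measurable borel \<Longrightarrow> (\<integral>x. \<phi> x \<partial>Q) = (\<integral>x. f x * \<phi> x \<partial>lborel)"
  and integrable_Q: "\<phi> \<in> borel_measurable borel \<Longrightarrow> integrable Q \<phi> \<longleftrightarrow> integrable lborel (\<lambda>x. f x * \<phi> x)"
  for \<phi> :: "'a \<Rightarrow> real"
  unfolding Q_def using f_nonneg by (auto simp: integral_density integrable_density)

lemma QQ_eq: "Q \<Otimes>\<^sub>M Q = density (lborel \<Otimes>\<^sub>M lborel) (\<lambda>(x, y). ennreal (f x * f y))"
proof -
  have "sigma_finite_measure (density lborel (\<lambda>x. ennreal (f x)))"
    using sigma_finite_measure_axioms unfolding Q_def .
  then have "Q \<Otimes>\<^sub>M Q = density (lborel \<Otimes>\<^sub>M lborel) (\<lambda>(x, y). ennreal (f x) * ennreal (f y))"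
    unfolding Q_def by (intro pair_measure_density) (auto intro: sigma_finite_lborel)
  then show ?thesis using f_nonneg by (simp add: ennreal_mult)
qed

lemma
  assumes [measurable]: "k \<in> borel_measurable borel"
  shows integral_QQ_kernel: "(\<integral>(x, y). k (x - y) \<partial>(Q \<Otimes>\<^sub>M Q)) = conv_form k f f"
    and integrable_QQ_kernel: "integrable (Q \<Otimes>\<^sub>M Q) (\<lambda>(x, y). k (x - y))
      \<longleftrightarrow> integrable (lborel \<Otimes>\<^sub>M lborel) (\<lambda>(x, y). f x * f y * k (x - y))"
proof -
  show "(\<integral>(x, y). k (x - y) \<partial>(Q \<Otimes>\<^sub>M Q)) = conv_form k f f"
    unfolding QQ_eq conv_form_def case_prod_unfold
    by (subst integral_density) (auto simp: f_nonneg)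
  show "integrable (Q \<Otimes>\<^sub>M Q) (\<lambda>(x, y). k (x - y))
      \<longleftrightarrow> integrable (lborel \<Otimes>\<^sub>M lborel) (\<lambda>(x, y). f x * f y * k (x - y))"
    unfolding QQ_eq case_prod_unfold
    by (subst integrable_density) (auto simp: f_nonneg)
qed

lemma conv_form_f_f:
  assumes k: "integrable lborel k" "\<And>z. 0 \<le> k z"
  shows "conv_form k f f = conv_form k I I + a * (conv_form k I G + conv_form k G I) + a\<^sup>2 * conv_form k G G"
proof -
  note i = integrable_conv_form[OF _ _ I2_integrable I2_integrable k] integrable_conv_form[OF _ _ I2_integrable G2_integrable k]
    integrable_conv_form[OF _ _ G2_integrable I2_integrable k] integrable_conv_form[OF _ _ G2_integrable G2_integrable k]
  have e: "(\<lambda>(x, y). f x * f y * k (x - y)) = (\<lambda>p. (case p of (x, y) \<Rightarrow> I x * I y * k (x - y))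
      + a * ((case p of (x, y) \<Rightarrow> I x * G y * k (x - y)) + (case p of (x, y) \<Rightarrow> G x * I y * k (x - y)))
      + a\<^sup>2 * (case p of (x, y) \<Rightarrow> G x * G y * k (x - y)))"
    by (auto simp: fun_eq_iff f_def power2_eq_square algebra_simps)
  show ?thesis unfolding conv_form_def e using i by simp
qed

text \<open>Dictionary between the abstract projections of a translation-invariant kernel and
  convolutions with the density \<open>f\<close>.\<close>

lemma kernel_square_integrable:
  assumes k: "integrable lborel k" "\<And>z. 0 \<le> k z" "\<And>z. k (- z) = k z" and k2: "integrable lborel (\<lambda>z. (k z)\<^sup>2)"
  shows "square_integrable_kernel Q (\<lambda>x y. k (x - y))"
    and "square_integrable_kernel.h Q (\<lambda>x y. k (x - y)) x = (\<integral>y. f y * k (x - y) \<partial>lborel)"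
    and "square_integrable_kernel.\<mu> Q (\<lambda>x y. k (x - y)) = conv_form k f f"
    and "square_integrable_kernel.w2 Q (\<lambda>x y. k (x - y)) = conv_form (\<lambda>z. (k z)\<^sup>2) f f"
proof -
  have [measurable]: "k \<in> borel_measurable borel" using k by (auto dest: borel_measurable_integrable)
  show sq: "square_integrable_kernel Q (\<lambda>x y. k (x - y))"
  proof unfold_locales
    show "(\<lambda>(x, y). k (x - y)) \<in> borel_measurable (Q \<Otimes>\<^sub>M Q)" by measurable
    show "k (x - y) = k (y - x)" for x y using k(3)[of "x - y"] by simp
    \<comment> \<open>Cauchy-Schwarz with \<open>f\<close> and \<open>k\<close> both in L2 gives
      integrability at every \<open>x\<close>, where Fubini would give it only almost
      everywhere.\<close>
    show "integrable Q (\<lambda>y. k (x - y))" for x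
      by (subst integrable_Q, measurable)
         (rule Cauchy_Schwarz_integral(1)[OF _ _ f2_integrable integrable_lborel_minus_left[OF k2]], measurable)
    show "integrable (Q \<Otimes>\<^sub>M Q) (\<lambda>(x, y). (k (x - y))\<^sup>2)"
      by (subst integrable_QQ_kernel[of "\<lambda>z. (k z)\<^sup>2"], measurable)
         (rule integrable_conv_form[OF _ _ f2_integrable f2_integrable k2]; simp)
  qed
  interpret K: square_integrable_kernel Q "\<lambda>x y. k (x - y)" by (rule sq)
  show h: "K.h x = (\<integral>y. f y * k (x - y) \<partial>lborel)" for x
    unfolding K.h_def by (rule integral_Q) measurable
  have "integrable (Q \<Otimes>\<^sub>M Q) (\<lambda>(x, y). k (x - y))"
    by (subst integrable_QQ_kernel, measurable) (rule integrable_conv_form[OF _ _ f2_integrable f2_integrable k(1,2)]; simp)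
  from pair_sigma_finite.integral_fst'[OF pair_sigma_finite_QQ this]
  show "K.\<mu> = conv_form k f f" unfolding K.\<mu>_def K.h_def by (simp add: integral_QQ_kernel[symmetric])
  show "K.w2 = conv_form (\<lambda>z. (k z)\<^sup>2) f f"
    unfolding K.w2_def by (rule integral_QQ_kernel) measurable
qed

end

text \<open>Lets the kernel be cut into a truncated part and its short edges after the
  decomposition, with one common linear part kept whole.\<close>

lemma (in iid_sample) hoeffding_add:
  assumes v: "square_integrable_kernel Q v" and w: "square_integrable_kernel Q w"
    and vw: "square_integrable_kernel Q (\<lambda>x y. v x y + w x y)"
  shows "square_integrable_kernel.hoeffding Q (\<lambda>x y. v x y + w x y)
    = (\<lambda>x y. square_integrable_kernel.hoeffding Q v x y + square_integrable_kernel.hoeffding Q w x y)"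
proof -
  interpret v: square_integrable_kernel Q v by (rule v)
  interpret w: square_integrable_kernel Q w by (rule w)
  interpret vw: square_integrable_kernel Q "\<lambda>x y. v x y + w x y" by (rule vw)
  have h: "vw.h x = v.h x + w.h x" for x
    unfolding vw.h_def v.h_def w.h_def by (rule Bochner_Integration.integral_add[OF v.w_integrable w.w_integrable])
  have "vw.\<mu> = v.\<mu> + w.\<mu>"
    unfolding vw.\<mu>_def v.\<mu>_def w.\<mu>_def h by (rule Bochner_Integration.integral_add[OF v.h_integrable w.h_integrable])
  then show ?thesis by (simp add: fun_eq_iff vw.hoeffding_def v.hoeffding_def w.hoeffding_def h)
qed

section \<open>Projections and local masses under the perturbed density\<close>

context perturbed_sample
begin

definition F3 :: real where "F3 = (\<integral>x. f x ^ 3 \<partial>lborel)"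
definition G3 :: real where "G3 = (\<integral>x. \<bar>G x\<bar> ^ 3 \<partial>lborel)"

lemma F3_nonneg: "0 \<le> F3"
  unfolding F3_def using f_nonneg by simp

text \<open>The third moment of \<open>G\<close> enters through \<open>f g\<^sup>2 \<le> f\<^sup>3 + \<bar>g\<bar>\<^sup>3\<close>, which replaces Young's
  convolution inequality.\<close>

lemma G_convolution_power2:
  assumes r: "0 < r" and b: "- real DIM('a) < b"
  defines "hG \<equiv> \<lambda>x. \<integral>y. G y * radial r b (x - y) \<partial>lborel"
  shows "integrable lborel (\<lambda>x. f x * (hG x)\<^sup>2)"
    and "(\<integral>x. f x * (hG x)\<^sup>2 \<partial>lborel) \<le> (radial_mass TYPE('a) r b)\<^sup>2 * (F3 + G3)"
proof -
  let ?k = "radial r b :: 'a \<Rightarrow> real"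
  let ?K = "radial_mass TYPE('a) r b"
  note k = integrable_radial[OF r b] radial_nonneg[of r b, where 'a='a]
  have K: "0 \<le> ?K" using radial_mass_pos[OF r b] by simp
  have [measurable]: "hG \<in> borel_measurable borel" unfolding hG_def by measurable
  have dom: "integrable (lborel \<Otimes>\<^sub>M lborel) (\<lambda>p. (case p of (x, y) \<Rightarrow> f x ^ 3 * ?k (x - y)) + (case p of (x, y) \<Rightarrow> \<bar>G y\<bar> ^ 3 * ?k (x - y)))"
    using integrable_convolution(1)[OF f3_integrable k] integrable_convolution(2)[OF G3_integrable k] by simp
  have pt: "f x * ((G y)\<^sup>2 * ?k (x - y)) \<le> f x ^ 3 * ?k (x - y) + \<bar>G y\<bar> ^ 3 * ?k (x - y)" for x y
  proof -
    \<comment> \<open>The larger of \<open>f x\<close> and \<open>|G y|\<close> is cubed; the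
      products thereby separate into functions of \<open>x\<close> and of \<open>y\<close>
      alone.\<close>
    have "f x * (G y)\<^sup>2 \<le> f x ^ 3 + \<bar>G y\<bar> ^ 3"
    proof (cases "f x \<le> \<bar>G y\<bar>")
      case True
      then have "f x * \<bar>G y\<bar>\<^sup>2 \<le> \<bar>G y\<bar> * \<bar>G y\<bar>\<^sup>2" by (intro mult_right_mono) auto
      then show ?thesis using f_nonneg[of x] by (simp add: power3_eq_cube power2_eq_square add_increasing mult.assoc)
    next
      case False
      then have "f x * \<bar>G y\<bar>\<^sup>2 \<le> f x * (f x)\<^sup>2" using f_nonneg[of x] by (intro mult_left_mono power_mono) auto
      then have "f x * (G y)\<^sup>2 \<le> f x ^ 3" by (simp add: power3_eq_cube power2_eq_square)
      then show ?thesis by (rule add_increasing2[rotated]) simp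
    qed
    from mult_right_mono[OF this k(2)[of "x - y"]] show ?thesis by (simp add: algebra_simps)
  qed
  have i: "integrable (lborel \<Otimes>\<^sub>M lborel) (\<lambda>(x, y). f x * ((G y)\<^sup>2 * ?k (x - y)))"
    by (rule Bochner_Integration.integrable_bound[OF dom])
       (use pt f_nonneg in \<open>auto intro!: AE_I2 order_trans[OF _ abs_ge_self]\<close>)
  have AE: "AE x in lborel. f x * (hG x)\<^sup>2 \<le> ?K * (\<integral>y. f x * ((G y)\<^sup>2 * ?k (x - y)) \<partial>lborel)"
    using lborel_pair.AE_integrable_fst'[OF integrable_convolution(2)[OF G2_integrable k]]
  proof eventually_elim
    case (elim x)
    \<comment> \<open>Splitting the kernel into two square roots is Jensen's inequality for the
      measure with density \<open>?k (x - y)\<close>, whose total mass is \<open>?K\<close>.\<close>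
    have "(\<integral>y. sqrt (?k (x - y)) * (G y * sqrt (?k (x - y))) \<partial>lborel)\<^sup>2
        \<le> (\<integral>y. (sqrt (?k (x - y)))\<^sup>2 \<partial>lborel) * (\<integral>y. (G y * sqrt (?k (x - y)))\<^sup>2 \<partial>lborel)"
      using elim integrable_radial_shift[OF r b, of x]
      by (intro Cauchy_Schwarz_integral) (auto simp: power_mult_distrib)
    moreover have "sqrt (?k (x - y)) * (G y * sqrt (?k (x - y))) = G y * ?k (x - y)" for y
      using real_sqrt_mult_self[of "?k (x - y)"] by (simp add: mult.left_commute)
    ultimately have "(hG x)\<^sup>2 \<le> ?K * (\<integral>y. (G y)\<^sup>2 * ?k (x - y) \<partial>lborel)"
      by (simp add: hG_def power_mult_distrib integral_radial_shift[OF r b])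
    from mult_left_mono[OF this f_nonneg[of x]] show ?case by (simp add: mult.left_commute)
  qed
  have iK: "integrable lborel (\<lambda>x. ?K * (\<integral>y. f x * ((G y)\<^sup>2 * ?k (x - y)) \<partial>lborel))"
    using lborel_pair.integrable_fst'[OF i] by simp
  show int: "integrable lborel (\<lambda>x. f x * (hG x)\<^sup>2)"
    by (rule Bochner_Integration.integrable_bound[OF iK])
       (use AE f_nonneg in \<open>auto elim!: eventually_mono intro: order_trans[OF _ abs_ge_self]\<close>)
  have "(\<integral>x. f x * (hG x)\<^sup>2 \<partial>lborel) \<le> (\<integral>x. ?K * (\<integral>y. f x * ((G y)\<^sup>2 * ?k (x - y)) \<partial>lborel) \<partial>lborel)"
    by (rule integral_mono_AE[OF int iK AE])
  also have "\<dots> = ?K * (\<integral>(x, y). f x * ((G y)\<^sup>2 * ?k (x - y)) \<partial>(lborel \<Otimes>\<^sub>M lborel))"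
    using lborel_pair.integral_fst'[OF i] by simp
  also have "\<dots> \<le> ?K * (\<integral>p. (case p of (x, y) \<Rightarrow> f x ^ 3 * ?k (x - y)) + (case p of (x, y) \<Rightarrow> \<bar>G y\<bar> ^ 3 * ?k (x - y)) \<partial>(lborel \<Otimes>\<^sub>M lborel))"
    using pt by (intro mult_left_mono[OF _ K] integral_mono[OF i dom]) auto
  also have "\<dots> = ?K * (F3 * ?K + G3 * ?K)"
    using integrable_convolution(1)[OF f3_integrable k] integrable_convolution(2)[OF G3_integrable k]
      integral_convolution(1)[OF f3_integrable k] integral_convolution(2)[OF G3_integrable k]
    by (simp add: F3_def G3_def integral_radial[OF r b])
  finally show "(\<integral>x. f x * (hG x)\<^sup>2 \<partial>lborel) \<le> ?K\<^sup>2 * (F3 + G3)"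
    by (simp add: power2_eq_square algebra_simps)
qed

text \<open>The projection is \<open>h\<^sub>0 r b + a * hG\<close>. The first term differs from the
  constant only on the boundary strip, the second is handled by the third moments, and the two
  squares are added with factor 2.\<close>

lemma projection_deviation:
  assumes r: "0 < r" "r < \<delta>" "r < \<rho>\<^sub>0" and b: "- real DIM('a) / 2 < b"
  defines "h \<equiv> square_integrable_kernel.h Q (\<lambda>x y. radial r b (x - y))"
  shows "(\<integral>x. (h x - radial_mass TYPE('a) r b)\<^sup>2 \<partial>Q)
    \<le> 2 * (radial_mass TYPE('a) r b)\<^sup>2 * (C * r + a\<^sup>2 * (F3 + G3))"
proof -
  let ?k = "radial r b :: 'a \<Rightarrow> real"
  let ?K = "radial_mass TYPE('a) r b"
  let ?S = "indicator {x \<in> U. D x \<le> r} :: 'a \<Rightarrow> real"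
  have b': "- real DIM('a) < b" "- real DIM('a) < 2 * b" using b by (auto simp: field_simps)
  note k = integrable_radial[OF r(1) b'(1)] radial_nonneg[of r b, where 'a='a]
  have k2: "integrable lborel (\<lambda>z::'a. (?k z)\<^sup>2)" unfolding radial_power2 by (rule integrable_radial[OF r(1) b'(2)])
  have K: "0 \<le> ?K" using radial_mass_pos[OF r(1) b'(1)] by simp
  define hG where "hG x = (\<integral>y. G y * ?k (x - y) \<partial>lborel)" for x
  have [measurable]: "hG \<in> borel_measurable borel" unfolding hG_def by measurable
  have h: "h x = h\<^sub>0 r b x + a * hG x" for x
  proof -
    have i: "integrable lborel (\<lambda>y. I y * ?k (x - y))" "integrable lborel (\<lambda>y. G y * ?k (x - y))"
      by (rule Cauchy_Schwarz_integral(1)[OF _ _ I2_integrable integrable_lborel_minus_left[OF k2]], measurable)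
         (rule Cauchy_Schwarz_integral(1)[OF _ _ G2_integrable integrable_lborel_minus_left[OF k2]], measurable)
    have "h x = (\<integral>y. f y * ?k (x - y) \<partial>lborel)"
      unfolding h_def using k k2 by (intro kernel_square_integrable) auto
    also have "\<dots> = (\<integral>y. I y * ?k (x - y) + a * (G y * ?k (x - y)) \<partial>lborel)"
      by (simp add: f_def distrib_right mult.assoc)
    finally show ?thesis using i by (simp add: h\<^sub>0_def hG_def)
  qed
  note gc = G_convolution_power2[OF r(1) b'(1), folded hG_def]
  have le0: "f x * (h\<^sub>0 r b x - ?K)\<^sup>2 \<le> ?K\<^sup>2 * ?S x" for x
  proof (cases "x \<in> U")
    case True
    show ?thesis
    proof (cases "r < D x")
      case True
      then show ?thesis using h0_eq[OF r(1) b'(1) \<open>x \<in> U\<close>] by simp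
    next
      \<comment> \<open>The density may be unbounded, but \<open>G\<close> vanishes in the strip, so
        there \<open>f\<close> is 1 and the strip is weighed by plain volume.\<close>
      case False
      then have "G x = 0" using D_less_imp[OF r(1,2), of x] by auto
      then have "f x = 1" using \<open>x \<in> U\<close> by (simp add: f_def)
      moreover have "\<bar>h\<^sub>0 r b x - ?K\<bar> \<le> ?K" using h0_nonneg[OF r(1) b'(1), of x] h0_le[OF r(1) b'(1), of x] by auto
      then have "(h\<^sub>0 r b x - ?K)\<^sup>2 \<le> ?K\<^sup>2" by (simp add: abs_le_square_iff[symmetric] K)
      ultimately show ?thesis using False \<open>x \<in> U\<close> by simp
    qed
  qed (simp add: f_def G_outside)
  have "(\<integral>x. (h x - ?K)\<^sup>2 \<partial>Q) = (\<integral>x. f x * (h x - ?K)\<^sup>2 \<partial>lborel)"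
    unfolding h by (rule integral_Q) measurable
  also have "\<dots> \<le> (\<integral>x. 2 * (?K\<^sup>2 * ?S x) + 2 * a\<^sup>2 * (f x * (hG x)\<^sup>2) \<partial>lborel)"
  proof (rule integral_mono_AE')
    show "integrable lborel (\<lambda>x. 2 * (?K\<^sup>2 * ?S x) + 2 * a\<^sup>2 * (f x * (hG x)\<^sup>2))"
      using gc(1) strip_measure(1)[OF r(1) b'(1) r(3)] by simp
    show "AE x in lborel. f x * (h x - ?K)\<^sup>2 \<le> 2 * (?K\<^sup>2 * ?S x) + 2 * a\<^sup>2 * (f x * (hG x)\<^sup>2)"
    proof (rule AE_I2)
      fix x
      have "(h x - ?K)\<^sup>2 \<le> 2 * (h\<^sub>0 r b x - ?K)\<^sup>2 + 2 * (a * hG x)\<^sup>2"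
      proof -
        have "0 \<le> ((h\<^sub>0 r b x - ?K) - a * hG x)\<^sup>2" by simp
        then show ?thesis unfolding h by (simp add: power2_eq_square algebra_simps)
      qed
      from mult_left_mono[OF this f_nonneg[of x]] le0[of x]
      show "f x * (h x - ?K)\<^sup>2 \<le> 2 * (?K\<^sup>2 * ?S x) + 2 * a\<^sup>2 * (f x * (hG x)\<^sup>2)"
        by (simp add: power_mult_distrib algebra_simps)
    qed
  qed (use f_nonneg in auto)
  also have "\<dots> = 2 * (?K\<^sup>2 * (\<integral>x. ?S x \<partial>lborel)) + 2 * a\<^sup>2 * (\<integral>x. f x * (hG x)\<^sup>2 \<partial>lborel)"
    using gc(1) strip_measure(1)[OF r(1) b'(1) r(3)] by simp
  also have "\<dots> \<le> 2 * (?K\<^sup>2 * (C * r)) + 2 * a\<^sup>2 * (?K\<^sup>2 * (F3 + G3))"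
    using gc(2) strip_measure(2)[OF r(1) b'(1) r(3)] by (intro add_mono mult_left_mono) auto
  finally show ?thesis by (simp add: algebra_simps)
qed

text \<open>The exponent is the one that Hoelder's inequality yields for a density in L3: the volume
  of the ball to the power \<open>2 / 3\<close>. What counts later is that it exceeds
  \<open>1 / 2\<close>.\<close>

lemma ball_mass_le:
  assumes r: "0 < r"
  shows "integrable lborel (\<lambda>y. f y * of_bool (norm (x - y) \<le> r))"
    and "(\<integral>y. f y * of_bool (norm (x - y) \<le> r) \<partial>lborel)
      \<le> (unit_ball_vol (real DIM('a)) + F3) * r powr (2 / 3 * DIM('a))"
proof -
  \<comment> \<open>\<open>f \<le> T + f\<^sup>3 / T\<^sup>2\<close>, and this level \<open>T\<close> balances the two terms on a ball of radius \<open>r\<close>\<close>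
  define T where "T = r powr (- real DIM('a) / 3)"
  have T: "0 < T" using r by (simp add: T_def)
  have e: "(\<lambda>y. of_bool (norm (x - y) \<le> r)) = (indicator (cball x r) :: 'a \<Rightarrow> real)"
    by (auto simp: fun_eq_iff dist_norm split: split_indicator)
  have ib: "integrable lborel (indicator (cball x r) :: 'a \<Rightarrow> real)"
    using r by (intro integrable_real_indicator) (auto simp: emeasure_cball)
  show i: "integrable lborel (\<lambda>y. f y * of_bool (norm (x - y) \<le> r))"
    by (rule Bochner_Integration.integrable_bound[OF f_integrable]) (use f_nonneg in auto)
  have "(\<integral>y. f y * of_bool (norm (x - y) \<le> r) \<partial>lborel) \<le> (\<integral>y. T * indicator (cball x r) y + f y ^ 3 / T\<^sup>2 \<partial>lborel)"
  proof (rule integral_mono[OF i])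
    show "integrable lborel (\<lambda>y. T * indicator (cball x r) y + f y ^ 3 / T\<^sup>2)" using ib f3_integrable by simp
    fix y
    have "f y * indicator (cball x r) y \<le> T * indicator (cball x r) y + f y ^ 3 / T\<^sup>2"
    proof (cases "f y \<le> T")
      case True
      then have "f y * indicator (cball x r) y \<le> T * indicator (cball x r) y" by (intro mult_right_mono) auto
      then show ?thesis using f_nonneg[of y] by (simp add: add_increasing2)
    next
      case False
      then have "f y * T\<^sup>2 \<le> f y * (f y)\<^sup>2" using T by (intro mult_left_mono power_mono f_nonneg) auto
      then have "f y \<le> f y ^ 3 / T\<^sup>2" using T by (simp add: field_simps power3_eq_cube power2_eq_square)
      then show ?thesis using f_nonneg[of y] T by (auto split: split_indicator intro: add_increasing)
    qed
    then show "f y * of_bool (norm (x - y) \<le> r) \<le> T * indicator (cball x r) y + f y ^ 3 / T\<^sup>2"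
      by (simp add: fun_cong[OF e])
  qed
  also have "\<dots> = T * (unit_ball_vol (real DIM('a)) * r ^ DIM('a)) + F3 / T\<^sup>2"
    using ib f3_integrable r by (simp add: F3_def content_cball)
  also have "T * (unit_ball_vol (real DIM('a)) * r ^ DIM('a)) = unit_ball_vol (real DIM('a)) * r powr (2 / 3 * DIM('a))"
  proof -
    have "T * r ^ DIM('a) = r powr (2 / 3 * DIM('a))"
      using r by (simp add: T_def powr_realpow[symmetric] powr_add[symmetric])
    then show ?thesis by (simp add: mult.left_commute)
  qed
  also have "F3 / T\<^sup>2 = F3 * r powr (2 / 3 * DIM('a))"
  proof -
    have "T\<^sup>2 = r powr (- (2 / 3 * DIM('a)))"
      using r by (simp add: T_def power2_eq_square powr_add[symmetric])
    then show ?thesis unfolding powr_minus_divide by simp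
  qed
  finally show "(\<integral>y. f y * of_bool (norm (x - y) \<le> r) \<partial>lborel)
      \<le> (unit_ball_vol (real DIM('a)) + F3) * r powr (2 / 3 * DIM('a))"
    by (simp add: distrib_right)
qed

text \<open>For \<open>b \<le> - d / 4\<close> the fourth moment of the kernel is infinite, so its singularity at the
  origin is cut off.\<close>

definition truncated :: "real \<Rightarrow> real \<Rightarrow> real \<Rightarrow> 'a \<Rightarrow> real" where
  "truncated \<epsilon> r b z = radial r b z - radial (\<epsilon> * r) b z"

lemma truncated_eq:
  assumes "0 < r" "0 < \<epsilon>" "\<epsilon> < 1"
  shows "truncated \<epsilon> r b z = of_bool (\<epsilon> * r < norm z \<and> norm z \<le> r) * norm z powr b"
proof -
  have "\<epsilon> * r \<le> r" using assms by simp
  then show ?thesis unfolding truncated_def radial_def by auto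
qed

text \<open>On the annulus, the power of the norm is largest at the outer radius for
  \<open>b >= 0\<close> and near the inner radius for \<open>b < 0\<close>; the maximum covers both.
  Squaring just doubles the exponent since the cut-off is an indicator.\<close>

lemma truncated_bounds:
  assumes r: "0 < r" and \<epsilon>: "0 < \<epsilon>" "\<epsilon> < 1"
  shows "0 \<le> truncated \<epsilon> r b z"
    and "truncated \<epsilon> r b z \<le> max 1 (\<epsilon> powr b) * r powr b * of_bool (norm z \<le> r)"
    and "(truncated \<epsilon> r b z)\<^sup>2 = truncated \<epsilon> r (2 * b) z"
proof -
  show "0 \<le> truncated \<epsilon> r b z" unfolding truncated_eq[OF assms] by simp
  show "(truncated \<epsilon> r b z)\<^sup>2 = truncated \<epsilon> r (2 * b) z"
    unfolding truncated_eq[OF assms] by (simp add: power_mult_distrib powr_add[symmetric] power2_eq_square)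
  show "truncated \<epsilon> r b z \<le> max 1 (\<epsilon> powr b) * r powr b * of_bool (norm z \<le> r)"
  proof (cases "\<epsilon> * r < norm z \<and> norm z \<le> r")
    case True
    define q where "q = norm z / r"
    have "0 < norm z" using True mult_pos_pos[OF \<epsilon>(1) r] by linarith
    then have q: "\<epsilon> \<le> q" "q \<le> 1" "0 < q" "norm z = q * r" using True r \<epsilon> by (auto simp: q_def field_simps)
    have "q powr b \<le> max 1 (\<epsilon> powr b)"
    proof (cases "0 \<le> b")
      case True
      then have "q powr b \<le> 1 powr b" using q by (intro powr_mono2) auto
      then show ?thesis by simp
    next
      case False
      then have "q powr b \<le> \<epsilon> powr b" using q \<epsilon> by (intro powr_mono2') auto
      then show ?thesis by simp
    qed
    then have "norm z powr b \<le> max 1 (\<epsilon> powr b) * r powr b"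
      using q r by (simp add: powr_mult mult_right_mono)
    then show ?thesis using True unfolding truncated_eq[OF assms] by simp
  qed (auto simp: truncated_eq[OF assms] le_max_iff_disj)
qed

text \<open>The mass around a point is at most the supremum \<open>B\<close> of the kernel times the
  probability of the ball of radius \<open>r\<close>.\<close>

lemma truncated_bounded_kernel:
  fixes b :: real
  assumes r: "0 < r" and \<epsilon>: "0 < \<epsilon>" "\<epsilon> < 1"
  defines "B \<equiv> max 1 (\<epsilon> powr b) * r powr b"
  shows "bounded_kernel Q (\<lambda>x y. truncated \<epsilon> r b (x - y)) B
    (B * ((unit_ball_vol (real DIM('a)) + F3) * r powr (2 / 3 * DIM('a))))"
proof unfold_locales
  have B: "0 \<le> B" by (simp add: B_def le_max_iff_disj)
  have [measurable]: "truncated \<epsilon> r b \<in> borel_measurable borel" unfolding truncated_def by measurable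
  show "(\<lambda>(x, y). truncated \<epsilon> r b (x - y)) \<in> borel_measurable (Q \<Otimes>\<^sub>M Q)" by measurable
  show "truncated \<epsilon> r b (x - y) = truncated \<epsilon> r b (y - x)" for x y
    unfolding truncated_def using radial_commute[of _ b x y] by simp
  show "0 \<le> truncated \<epsilon> r b (x - y)" for x y by (rule truncated_bounds[OF r \<epsilon>])
  show "truncated \<epsilon> r b (x - y) \<le> B" for x y
  proof -
    have "truncated \<epsilon> r b (x - y) \<le> B * of_bool (norm (x - y) \<le> r)"
      unfolding B_def by (rule truncated_bounds(2)[OF r \<epsilon>])
    then show ?thesis using B by (cases "norm (x - y) \<le> r") auto
  qed
  fix x
  have "(\<integral>y. truncated \<epsilon> r b (x - y) \<partial>Q) = (\<integral>y. f y * truncated \<epsilon> r b (x - y) \<partial>lborel)"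
    by (rule integral_Q) measurable
  also have "\<dots> \<le> (\<integral>y. B * (f y * of_bool (norm (x - y) \<le> r)) \<partial>lborel)"
  proof (rule integral_mono_AE')
    show "integrable lborel (\<lambda>y. B * (f y * of_bool (norm (x - y) \<le> r)))" using ball_mass_le(1)[OF r] by simp
    show "AE y in lborel. f y * truncated \<epsilon> r b (x - y) \<le> B * (f y * of_bool (norm (x - y) \<le> r))"
    proof (rule AE_I2)
      fix y
      show "f y * truncated \<epsilon> r b (x - y) \<le> B * (f y * of_bool (norm (x - y) \<le> r))"
        using mult_left_mono[OF truncated_bounds(2)[OF r \<epsilon>, of b "x - y"] f_nonneg[of y]]
        by (simp add: B_def mult.left_commute)
    qed
  qed (use f_nonneg truncated_bounds(1)[OF r \<epsilon>] B in \<open>auto intro!: mult_nonneg_nonneg\<close>)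
  also have "\<dots> \<le> B * ((unit_ball_vol (real DIM('a)) + F3) * r powr (2 / 3 * DIM('a)))"
    using mult_left_mono[OF ball_mass_le(2)[OF r, of x] B] by simp
  finally show "(\<integral>y. truncated \<epsilon> r b (x - y) \<partial>Q) \<le> B * ((unit_ball_vol (real DIM('a)) + F3) * r powr (2 / 3 * DIM('a)))" .
qed

end

section \<open>The normalised statistic at a fixed sample size\<close>

lemma edge_weight_eq_radial: "edge_weight r b x y = radial r b (x - y)"
  unfolding edge_weight_def radial_def ..

lemma T_scale_pos:
  assumes "0 < r" "- real DIM('a::euclidean_space) / 2 < b" "1 \<le> n"
  shows "0 < T_scale TYPE('a) r b n"
  unfolding T_scale_def using assms by (intro mult_pos_pos) (auto intro!: divide_pos_pos mult_pos_pos simp: field_simps)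

text \<open>The scale is the leading term of the standard deviation under uniformity: about
  \<open>n^2 / 2\<close> pairs, each contributing the integral of the squared kernel.\<close>

lemma T_scale_power2:
  assumes "0 < r" "- real DIM('a::euclidean_space) / 2 < b"
  shows "(T_scale TYPE('a) r b n)\<^sup>2 = (real n)\<^sup>2 / 2 * radial_mass TYPE('a) r (2 * b)"
proof -
  have "(r powr (b + real DIM('a) / 2))\<^sup>2 = r powr (2 * b + real DIM('a))"
    using assms by (simp add: power2_eq_square powr_add[symmetric] algebra_simps)
  moreover have "0 \<le> real DIM('a) * unit_ball_vol (real DIM('a)) / (2 * (2 * b + real DIM('a)))"
    using assms by (intro divide_nonneg_nonneg mult_nonneg_nonneg) (auto simp: field_simps)
  ultimately show ?thesis
    unfolding T_scale_def radial_mass_def power_mult_distrib by (simp add: mult_ac)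
qed

text \<open>With exponent \<open>2 * b\<close> this is the share of the variance that falls on edges
  shorter than \<open>\<epsilon> * r\<close>.\<close>

lemma radial_mass_scale:
  assumes "0 < r" "0 < \<epsilon>"
  shows "radial_mass TYPE('a::euclidean_space) (\<epsilon> * r) b = \<epsilon> powr (b + real DIM('a)) * radial_mass TYPE('a) r b"
  unfolding radial_mass_def using assms by (simp add: powr_mult mult_ac)

lemma cmod_iexp_diff_le: "cmod (iexp (x + y) - iexp x) \<le> \<bar>y\<bar>" for x y :: real
proof -
  have "iexp (x + y) - iexp x = iexp x * (iexp y - 1)"
    by (simp add: distrib_left exp_add right_diff_distrib)
  then have "cmod (iexp (x + y) - iexp x) = cmod (iexp y - 1)" by (simp only: norm_mult norm_exp_i_times mult_1_left)
  also have "\<dots> \<le> \<bar>y\<bar>" using iexp_approx1[of y 0] by simp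
  finally show ?thesis .
qed

lemma abs_exp_minus_diff_le:
  fixes u v :: real
  assumes "0 \<le> u" "0 \<le> v"
  shows "\<bar>exp (- u) - exp (- v)\<bar> \<le> \<bar>u - v\<bar>"
proof -
  have *: "exp (- p) - exp (- q) \<le> q - p" if "0 \<le> p" "p \<le> q" for p q :: real
  proof -
    have "exp (- p) - exp (- q) = exp (- p) * (1 - exp (- (q - p)))" by (simp add: right_diff_distrib exp_add[symmetric])
    also have "\<dots> \<le> 1 * (q - p)"
    proof (rule mult_mono)
      show "1 - exp (- (q - p)) \<le> q - p" using exp_ge_add_one_self[of "- (q - p)"] by linarith
    qed (use that in auto)
    finally show ?thesis by simp
  qed
  show ?thesis using *[of u v] *[of v u] assms by (cases "u \<le> v") auto
qed

context perturbed_sample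
begin

definition F2 :: real where "F2 = (\<integral>x. (f x)\<^sup>2 \<partial>lborel)"

text \<open>Bound for the variance of the linear part relative to the squared scale, up to a
  constant: \<open>C * r\<close> comes from the boundary strip, the term with \<open>a^2\<close>
  from the perturbation.\<close>

definition linear_error :: "real \<Rightarrow> real \<Rightarrow> nat \<Rightarrow> real" where
  "linear_error r b n = real n * ((radial_mass TYPE('a) r b)\<^sup>2 / radial_mass TYPE('a) r (2 * b)) * (C * r + a\<^sup>2 * (F3 + G3))"

text \<open>Centred at the mean under the actual density \<open>f\<close>, unlike
  \<open>T_e\<close>, which is centred at the uniform mean. The discrepancy becomes the
  deterministic \<open>shift\<close>.\<close>

definition normalised :: "real \<Rightarrow> real \<Rightarrow> nat \<Rightarrow> (nat \<Rightarrow> 'a) \<Rightarrow> real" where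
  "normalised r b n x = (ustat (edge_weight r b) n x - real n * (real n - 1) / 2 * conv_form (radial r b) f f) / T_scale TYPE('a) r b n"

context
  fixes r b :: real and n :: nat
  assumes r: "0 < r" "r < \<delta>" "r < \<rho>\<^sub>0" and b: "- real DIM('a) / 2 < b" and n: "1 \<le> n"
begin

lemma exponents: "- real DIM('a) < b" "- real DIM('a) < 2 * b"
  using b by (auto simp: field_simps)

lemma edge_kernel:
  assumes \<epsilon>: "0 < \<epsilon>" "\<epsilon> \<le> 1"
  shows "square_integrable_kernel Q (\<lambda>x y. radial (\<epsilon> * r) b (x - y))"
    and "square_integrable_kernel.\<mu> Q (\<lambda>x y. radial (\<epsilon> * r) b (x - y)) = conv_form (radial (\<epsilon> * r) b) f f"
    and "square_integrable_kernel.w2 Q (\<lambda>x y. radial (\<epsilon> * r) b (x - y)) = conv_form (radial (\<epsilon> * r) (2 * b)) f f"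
    and "conv_form (radial (\<epsilon> * r) (2 * b)) f f \<le> F2 * \<epsilon> powr (2 * b + real DIM('a)) * radial_mass TYPE('a) r (2 * b)"
proof -
  have er: "0 < \<epsilon> * r" using r \<epsilon> by simp
  note k = integrable_radial[OF er exponents(1)] radial_nonneg[of "\<epsilon> * r" b, where 'a='a] radial_minus[of "\<epsilon> * r" b, where 'a='a]
  have k2: "integrable lborel (\<lambda>z::'a. (radial (\<epsilon> * r) b z)\<^sup>2)"
    unfolding radial_power2 by (rule integrable_radial[OF er exponents(2)])
  note * = kernel_square_integrable[OF k k2]
  show "square_integrable_kernel Q (\<lambda>x y. radial (\<epsilon> * r) b (x - y))"
    "square_integrable_kernel.\<mu> Q (\<lambda>x y. radial (\<epsilon> * r) b (x - y)) = conv_form (radial (\<epsilon> * r) b) f f" by (rule *)+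
  show "square_integrable_kernel.w2 Q (\<lambda>x y. radial (\<epsilon> * r) b (x - y)) = conv_form (radial (\<epsilon> * r) (2 * b)) f f"
    using *(4) unfolding radial_power2 .
  show "conv_form (radial (\<epsilon> * r) (2 * b)) f f \<le> F2 * \<epsilon> powr (2 * b + real DIM('a)) * radial_mass TYPE('a) r (2 * b)"
    using conv_form_bound[OF f_measurable f_measurable f2_integrable f2_integrable integrable_radial[OF er exponents(2)] radial_nonneg]
    by (simp add: F2_def integral_radial[OF er exponents(2)] radial_mass_scale[OF r(1) \<epsilon>(1)])
qed

lemma sq_T_scale: "(T_scale TYPE('a) r b n)\<^sup>2 = (real n)\<^sup>2 / 2 * radial_mass TYPE('a) r (2 * b)"
  by (rule T_scale_power2[OF r(1) b])

lemma scale_pos: "0 < T_scale TYPE('a) r b n"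
  by (rule T_scale_pos[OF r(1) b n])

lemma m2_pos: "0 < radial_mass TYPE('a) r (2 * b)"
  by (rule radial_mass_pos[OF r(1) exponents(2)])

text \<open>The part of the normalised statistic that is discarded: the linear part and, for
  \<open>\<epsilon> < 1\<close>, the pairs at distance at most \<open>\<epsilon> r\<close>.\<close>

lemma remainder_power2:
  assumes \<epsilon>: "0 < \<epsilon>" "\<epsilon> \<le> 1"
  defines "H \<equiv> square_integrable_kernel.hoeffding Q (\<lambda>x y. radial (\<epsilon> * r) b (x - y))"
    and "L \<equiv> square_integrable_kernel.linear_part Q (\<lambda>x y. radial r b (x - y)) n"
  shows "(\<lambda>x. (ustat H n x + L x) / T_scale TYPE('a) r b n) \<in> borel_measurable (P n)"
    and "integrable (P n) (\<lambda>x. ((ustat H n x + L x) / T_scale TYPE('a) r b n)\<^sup>2)"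
    and "(\<integral>x. ((ustat H n x + L x) / T_scale TYPE('a) r b n)\<^sup>2 \<partial>P n)
      \<le> 2 * F2 * \<epsilon> powr (2 * b + real DIM('a)) + 8 * linear_error r b n"
proof -
  let ?\<sigma> = "T_scale TYPE('a) r b n"
  let ?m = "radial_mass TYPE('a) r (2 * b)"
  interpret K: square_integrable_kernel Q "\<lambda>x y. radial r b (x - y)"
    using edge_kernel(1)[of 1] by simp
  interpret E: square_integrable_kernel Q "\<lambda>x y. radial (\<epsilon> * r) b (x - y)"
    by (rule edge_kernel(1)[OF \<epsilon>])
  have Lm: "L \<in> borel_measurable (P n)" unfolding L_def by (rule K.linear_part_measurable)
  have Hm: "ustat H n \<in> borel_measurable (P n)" unfolding H_def by (rule ustat_measurable[OF E.hoeffding_measurable])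
  have H2: "integrable (P n) (\<lambda>x. (ustat H n x)\<^sup>2)" unfolding H_def by (rule E.ustat_hoeffding_power2)
  have L2: "integrable (P n) (\<lambda>x. (L x)\<^sup>2)" unfolding L_def by (rule K.integral_linear_part_power2)
  show "(\<lambda>x. (ustat H n x + L x) / ?\<sigma>) \<in> borel_measurable (P n)" using Hm Lm by measurable
  show i: "integrable (P n) (\<lambda>x. ((ustat H n x + L x) / ?\<sigma>)\<^sup>2)"
    using integrable_power2_add[OF Hm Lm H2 L2] by (simp add: power_divide)
  have "(\<integral>x. ((ustat H n x + L x) / ?\<sigma>)\<^sup>2 \<partial>P n) \<le> (\<integral>x. 2 / ?\<sigma>\<^sup>2 * (ustat H n x)\<^sup>2 + 2 / ?\<sigma>\<^sup>2 * (L x)\<^sup>2 \<partial>P n)"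
  proof (rule integral_mono[OF i])
    show "integrable (P n) (\<lambda>x. 2 / ?\<sigma>\<^sup>2 * (ustat H n x)\<^sup>2 + 2 / ?\<sigma>\<^sup>2 * (L x)\<^sup>2)" using H2 L2 by simp
    fix x
    have "(ustat H n x + L x)\<^sup>2 \<le> 2 * (ustat H n x)\<^sup>2 + 2 * (L x)\<^sup>2"
    proof -
      have "0 \<le> (ustat H n x - L x)\<^sup>2" by simp
      then show ?thesis by (simp add: power2_eq_square algebra_simps)
    qed
    from divide_right_mono[OF this zero_le_power2[of ?\<sigma>]]
    show "((ustat H n x + L x) / ?\<sigma>)\<^sup>2 \<le> 2 / ?\<sigma>\<^sup>2 * (ustat H n x)\<^sup>2 + 2 / ?\<sigma>\<^sup>2 * (L x)\<^sup>2"
      unfolding power_divide by (simp add: add_divide_distrib)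
  qed
  also have "\<dots> = 2 / ?\<sigma>\<^sup>2 * (\<integral>x. (ustat H n x)\<^sup>2 \<partial>P n) + 2 / ?\<sigma>\<^sup>2 * (\<integral>x. (L x)\<^sup>2 \<partial>P n)"
    using H2 L2 by simp
  also have "\<dots> \<le> 2 / ?\<sigma>\<^sup>2 * ((real n)\<^sup>2 / 2 * (F2 * \<epsilon> powr (2 * b + real DIM('a)) * ?m))
      + 2 / ?\<sigma>\<^sup>2 * (real n ^ 3 * (2 * (radial_mass TYPE('a) r b)\<^sup>2 * (C * r + a\<^sup>2 * (F3 + G3))))"
  proof (intro add_mono mult_left_mono)
    show "(\<integral>x. (ustat H n x)\<^sup>2 \<partial>P n) \<le> (real n)\<^sup>2 / 2 * (F2 * \<epsilon> powr (2 * b + real DIM('a)) * ?m)"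
      unfolding H_def
      by (rule order_trans[OF E.ustat_hoeffding_power2(2)], unfold edge_kernel(3)[OF \<epsilon>])
         (intro mult_left_mono edge_kernel(4)[OF \<epsilon>], simp)
    show "(\<integral>x. (L x)\<^sup>2 \<partial>P n) \<le> real n ^ 3 * (2 * (radial_mass TYPE('a) r b)\<^sup>2 * (C * r + a\<^sup>2 * (F3 + G3)))"
      unfolding L_def
      by (rule order_trans[OF K.integral_linear_part_power2(2) mult_left_mono[OF projection_deviation[OF r b]]]) simp
  qed auto
  also have "\<dots> = 2 * F2 * \<epsilon> powr (2 * b + real DIM('a)) + 8 * linear_error r b n"
    unfolding sq_T_scale linear_error_def using m2_pos n
    by (simp add: field_simps power2_eq_square power3_eq_cube)
  finally show "(\<integral>x. ((ustat H n x + L x) / ?\<sigma>)\<^sup>2 \<partial>P n)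
      \<le> 2 * F2 * \<epsilon> powr (2 * b + real DIM('a)) + 8 * linear_error r b n" .
qed

lemma normalised_eq:
  "normalised r b n x = (ustat (square_integrable_kernel.hoeffding Q (\<lambda>x y. radial r b (x - y))) n x
    + square_integrable_kernel.linear_part Q (\<lambda>x y. radial r b (x - y)) n x) / T_scale TYPE('a) r b n"
proof -
  interpret K: square_integrable_kernel Q "\<lambda>x y. radial r b (x - y)"
    using edge_kernel(1)[of 1] by simp
  have e: "edge_weight r b = (\<lambda>x y. radial r b (x - y :: 'a))" by (simp add: fun_eq_iff edge_weight_eq_radial)
  show ?thesis
    unfolding normalised_def e K.ustat_decomposition using edge_kernel(2)[of 1] by simp
qed

text \<open>The case \<open>\<epsilon> = 1\<close> of \<open>remainder_power2\<close>: everything is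
  counted as remainder. The resulting second moment feeds Chebyshev's inequality.\<close>

lemma normalised_power2:
  shows "normalised r b n \<in> borel_measurable (P n)"
    and "integrable (P n) (\<lambda>x. (normalised r b n x)\<^sup>2)"
    and "(\<integral>x. (normalised r b n x)\<^sup>2 \<partial>P n) \<le> 2 * F2 + 8 * linear_error r b n"
proof -
  have e: "normalised r b n = (\<lambda>x. (ustat (square_integrable_kernel.hoeffding Q (\<lambda>x y. radial (1 * r) b (x - y))) n x
    + square_integrable_kernel.linear_part Q (\<lambda>x y. radial r b (x - y)) n x) / T_scale TYPE('a) r b n)"
    by (simp add: fun_eq_iff normalised_eq)
  show "normalised r b n \<in> borel_measurable (P n)" "integrable (P n) (\<lambda>x. (normalised r b n x)\<^sup>2)"
    unfolding e by (rule remainder_power2; simp)+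
  show "(\<integral>x. (normalised r b n x)\<^sup>2 \<partial>P n) \<le> 2 * F2 + 8 * linear_error r b n"
    unfolding e using remainder_power2(3)[of 1] by simp
qed

text \<open>Three replacements, one line of the bound each: the remainder is dropped, which costs
  its L1 norm because \<open>iexp\<close> is 1-Lipschitz; the truncated degenerate part is compared
  with a Gaussian of its own variance; that variance is compared with 1. Here \<open>q\<close> is
  the variance share of short edges and \<open>\<rho>\<close> the ratio of the actual to the uniform
  second moment of the kernel.\<close>

lemma char_normalised_approx:
  assumes \<epsilon>: "0 < \<epsilon>" "\<epsilon> < 1" and F2: "F2 \<le> 2"
  defines "B \<equiv> max 1 (\<epsilon> powr b) * r powr b"
  defines "\<beta>\<^sub>n \<equiv> B / T_scale TYPE('a) r b n"
    and "e \<equiv> real n * (B * ((unit_ball_vol (real DIM('a)) + F3) * r powr (2 / 3 * DIM('a)))) / T_scale TYPE('a) r b n"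
    and "q \<equiv> \<epsilon> powr (2 * b + real DIM('a))"
    and "\<rho> \<equiv> conv_form (radial r (2 * b)) f f / radial_mass TYPE('a) r (2 * b)"
  shows "cmod ((\<integral>x. iexp (t * normalised r b n x) \<partial>P n) - complex_of_real (exp (- (t\<^sup>2 / 2))))
    \<le> \<bar>t\<bar> * sqrt (4 * q + 8 * linear_error r b n)
      + (\<bar>t\<bar> ^ 3 * sqrt (4 * \<beta>\<^sub>n\<^sup>2 + 12 * \<beta>\<^sub>n * e) + t\<^sup>2 * sqrt (8 * \<beta>\<^sub>n * e + 4 * e\<^sup>2) + 2 * t ^ 4 / n)
      + t\<^sup>2 / 2 * (\<bar>\<rho> - 1\<bar> + e\<^sup>2 + 2 * q + 2 / n)"
proof -
  define \<sigma> where "\<sigma> = T_scale TYPE('a) r b n"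
  define m where "m = radial_mass TYPE('a) r (2 * b)"
  define \<eta> where "\<eta> = B * ((unit_ball_vol (real DIM('a)) + F3) * r powr (2 / 3 * DIM('a)))"
  have \<sigma>: "0 < \<sigma>" unfolding \<sigma>_def by (rule scale_pos)
  have m: "0 < m" unfolding m_def by (rule m2_pos)
  have sm: "\<sigma>\<^sup>2 = (real n)\<^sup>2 / 2 * m" unfolding \<sigma>_def m_def by (rule sq_T_scale)
  have N: "1 \<le> real n" using n by simp
  note \<epsilon>' = \<epsilon>(1) less_imp_le[OF \<epsilon>(2)]
  interpret BK: bounded_kernel Q "\<lambda>x y. truncated \<epsilon> r b (x - y)" B \<eta>
    unfolding B_def \<eta>_def by (rule truncated_bounded_kernel[OF r(1) \<epsilon>])
  interpret E: square_integrable_kernel Q "\<lambda>x y. radial (\<epsilon> * r) b (x - y)"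
    by (rule edge_kernel(1)[OF \<epsilon>'])
  interpret K: square_integrable_kernel Q "\<lambda>x y. radial r b (x - y)"
    using edge_kernel(1)[of 1] by simp
  have w: "(\<lambda>x y. truncated \<epsilon> r b (x - y) + radial (\<epsilon> * r) b (x - y)) = (\<lambda>x y. radial r b (x - y))"
    by (simp add: truncated_def)
  have hoeff: "K.hoeffding = (\<lambda>x y. BK.hoeffding x y + E.hoeffding x y)"
    using hoeffding_add[OF BK.square_integrable edge_kernel(1)[OF \<epsilon>']] K.square_integrable_kernel_axioms
    unfolding w by blast
  define R where "R x = (ustat E.hoeffding n x + K.linear_part n x) / \<sigma>" for x
  have NR: "normalised r b n x = ustat BK.hoeffding n x / \<sigma> + R x" for x
    unfolding normalised_eq hoeff ustat_add R_def \<sigma>_def by (simp add: add_divide_distrib)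
  note R2 = remainder_power2[OF \<epsilon>', folded \<sigma>_def R_def]
  have Rm: "R \<in> borel_measurable (P n)" using R2(1) by (simp add: R_def[abs_def])
  have R2i: "integrable (P n) (\<lambda>x. (R x)\<^sup>2)" using R2(2) by (simp add: R_def)
  have R2b: "(\<integral>x. (R x)\<^sup>2 \<partial>P n) \<le> 4 * q + 8 * linear_error r b n"
  proof -
    have "2 * F2 * q \<le> 4 * q" using F2 by (intro mult_right_mono) (auto simp: q_def)
    then show ?thesis using R2(3) unfolding R_def q_def by linarith
  qed
  have Um: "ustat BK.hoeffding n \<in> borel_measurable (P n)" by (rule ustat_measurable[OF BK.hoeffding_measurable])
  have iN: "integrable (P n) (\<lambda>x. iexp (t * normalised r b n x))"
    by (rule bounded_integrable[OF finite_measure_P, where B=1]) (use normalised_power2(1) in auto)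
  have iU: "integrable (P n) (\<lambda>x. iexp (t / \<sigma> * ustat BK.hoeffding n x))"
    by (rule bounded_integrable[OF finite_measure_P, where B=1]) (use Um in auto)
  have 1: "cmod ((\<integral>x. iexp (t * normalised r b n x) \<partial>P n) - (\<integral>x. iexp (t / \<sigma> * ustat BK.hoeffding n x) \<partial>P n))
      \<le> \<bar>t\<bar> * sqrt (4 * q + 8 * linear_error r b n)"
  proof -
    have "cmod ((\<integral>x. iexp (t * normalised r b n x) \<partial>P n) - (\<integral>x. iexp (t / \<sigma> * ustat BK.hoeffding n x) \<partial>P n))
        = cmod (\<integral>x. iexp (t * normalised r b n x) - iexp (t / \<sigma> * ustat BK.hoeffding n x) \<partial>P n)"
      by (simp only: Bochner_Integration.integral_diff[OF iN iU])
    also have "\<dots> \<le> (\<integral>x. cmod (iexp (t * normalised r b n x) - iexp (t / \<sigma> * ustat BK.hoeffding n x)) \<partial>P n)"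
      by (rule integral_norm_bound)
    also have "\<dots> \<le> (\<integral>x. \<bar>t\<bar> * \<bar>R x\<bar> \<partial>P n)"
    proof (rule integral_mono)
      show "integrable (P n) (\<lambda>x. cmod (iexp (t * normalised r b n x) - iexp (t / \<sigma> * ustat BK.hoeffding n x)))"
        by (rule integrable_norm[OF Bochner_Integration.integrable_diff[OF iN iU]])
      show "integrable (P n) (\<lambda>x. \<bar>t\<bar> * \<bar>R x\<bar>)"
        using prob_space.power2_integral_le(1)[OF prob_space_P Rm R2i] by simp
      fix x
      have "t * normalised r b n x = t / \<sigma> * ustat BK.hoeffding n x + t * R x"
        unfolding NR by (simp add: distrib_left)
      then show "cmod (iexp (t * normalised r b n x) - iexp (t / \<sigma> * ustat BK.hoeffding n x)) \<le> \<bar>t\<bar> * \<bar>R x\<bar>"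
        using cmod_iexp_diff_le[of "t / \<sigma> * ustat BK.hoeffding n x" "t * R x"] by (simp only: abs_mult)
    qed
    also have "\<dots> = \<bar>t\<bar> * (\<integral>x. \<bar>R x\<bar> \<partial>P n)" by simp
    also have "\<dots> \<le> \<bar>t\<bar> * sqrt (\<integral>x. (R x)\<^sup>2 \<partial>P n)"
      by (intro mult_left_mono prob_space.integral_abs_le_sqrt[OF prob_space_P Rm R2i]) simp
    also have "\<dots> \<le> \<bar>t\<bar> * sqrt (4 * q + 8 * linear_error r b n)"
      using R2b by (intro mult_left_mono real_sqrt_le_mono) auto
    finally show ?thesis .
  qed
  have w2E: "0 \<le> conv_form (radial (\<epsilon> * r) (2 * b)) f f" "conv_form (radial (\<epsilon> * r) (2 * b)) f f \<le> 2 * q * m"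
  proof -
    show "0 \<le> conv_form (radial (\<epsilon> * r) (2 * b)) f f"
      using E.w2_nonneg unfolding edge_kernel(3)[OF \<epsilon>'] .
    have "F2 * q * m \<le> 2 * q * m" using F2 m by (intro mult_right_mono) (auto simp: q_def)
    then show "conv_form (radial (\<epsilon> * r) (2 * b)) f f \<le> 2 * q * m"
      using edge_kernel(4)[OF \<epsilon>'] unfolding q_def m_def by linarith
  qed
  have K2: "conv_form (radial r (2 * b)) f f \<le> 2 * m"
  proof -
    have "F2 * m \<le> 2 * m" using F2 m by (intro mult_right_mono) auto
    then show ?thesis using edge_kernel(4)[of 1] by (simp add: m_def)
  qed
  \<comment> \<open>The squared truncated kernel is again a difference of two radial kernels, so
    second moments subtract without a cross term.\<close>
  have w2: "BK.w2 = conv_form (radial r (2 * b)) f f - conv_form (radial (\<epsilon> * r) (2 * b)) f f"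
  proof -
    have er: "0 < \<epsilon> * r" using r \<epsilon> by simp
    have m': "truncated \<epsilon> r (2 * b) \<in> borel_measurable borel" unfolding truncated_def by measurable
    note i = integrable_conv_form[OF f_measurable f_measurable f2_integrable f2_integrable integrable_radial[OF r(1) exponents(2)] radial_nonneg]
      integrable_conv_form[OF f_measurable f_measurable f2_integrable f2_integrable integrable_radial[OF er exponents(2)] radial_nonneg]
    have "BK.w2 = conv_form (truncated \<epsilon> r (2 * b)) f f"
      unfolding BK.w2_def truncated_bounds(3)[OF r(1) \<epsilon>] by (rule integral_QQ_kernel[OF m'])
    also have "\<dots> = (\<integral>p. (case p of (x, y) \<Rightarrow> f x * f y * radial r (2 * b) (x - y))
        - (case p of (x, y) \<Rightarrow> f x * f y * radial (\<epsilon> * r) (2 * b) (x - y)) \<partial>(lborel \<Otimes>\<^sub>M lborel))"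
      unfolding conv_form_def truncated_def
      by (intro Bochner_Integration.integral_cong refl) (auto simp: right_diff_distrib)
    finally show ?thesis unfolding Bochner_Integration.integral_diff[OF i] conv_form_def .
  qed
  have w2m: "BK.w2 * (real n)\<^sup>2 \<le> 4 * \<sigma>\<^sup>2"
  proof -
    have "BK.w2 \<le> 2 * m" using w2 w2E K2 by linarith
    from mult_right_mono[OF this, of "(real n)\<^sup>2"] show ?thesis by (simp add: sm mult_ac)
  qed
  have be: "\<beta>\<^sub>n = B / \<sigma>" "e = real n * \<eta> / \<sigma>" by (simp_all add: \<beta>\<^sub>n_def e_def \<eta>_def \<sigma>_def)
  \<comment> \<open>The variance of the truncated degenerate part in units of the squared
    scale.\<close>
  define v where "v = BK.HK.s * (real n * (real n - 1)) / (2 * \<sigma>\<^sup>2)"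
  have 2: "cmod ((\<integral>x. iexp (t / \<sigma> * ustat BK.hoeffding n x) \<partial>P n) - exp (- (t\<^sup>2 / 2 * v)))
    \<le> \<bar>t\<bar> ^ 3 * sqrt (4 * \<beta>\<^sub>n\<^sup>2 + 12 * \<beta>\<^sub>n * e) + t\<^sup>2 * sqrt (8 * \<beta>\<^sub>n * e + 4 * e\<^sup>2) + 2 * t ^ 4 / n"
  proof -
    have "t\<^sup>2 / 2 * v = t\<^sup>2 * (BK.HK.s * (real n * (real n - 1)) / (4 * \<sigma>\<^sup>2))" by (simp add: v_def)
    then show ?thesis using BK.char_ustat_hoeffding_approx[OF n \<sigma> w2m, of t] unfolding be by (simp only:)
  qed
  have s0: "0 \<le> BK.HK.s" by (simp add: BK.HK.s_def BK.HK.D_nonneg)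
  have v0: "0 \<le> v" unfolding v_def using s0 N by (intro divide_nonneg_nonneg mult_nonneg_nonneg) auto
  have "\<bar>v - 1\<bar> \<le> \<bar>\<rho> - 1\<bar> + e\<^sup>2 + 2 * q + 2 / n"
  proof -
    define S where "S = BK.HK.s / m"
    have S0: "0 \<le> S" using s0 m by (simp add: S_def)
    have vS: "v = S - S / n"
      unfolding v_def sm S_def using m N by (simp add: field_simps power2_eq_square)
    have rho: "\<rho> = conv_form (radial r (2 * b)) f f / m" by (simp add: \<rho>_def m_def)
    have S1: "S \<le> \<rho>"
      unfolding S_def rho using BK.s_bounds(1) w2 w2E m by (intro divide_right_mono) auto
    have "\<rho> \<le> 2" unfolding rho using K2 m by (simp add: field_simps)
    with S1 have S2: "S \<le> 2" by simp
    \<comment> \<open>The factor 2 in the lower bound of \<open>BK.s_bounds\<close> matches the one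
      in \<open>\<sigma>^2 = n^2 / 2 * m\<close>, so the loss is exactly \<open>e^2\<close>.\<close>
    have e2: "2 * \<eta>\<^sup>2 / m = e\<^sup>2"
      unfolding be using \<sigma> N m by (simp add: power_divide power_mult_distrib sm)
    have "\<rho> - 2 * q - e\<^sup>2 \<le> S"
    proof -
      have "conv_form (radial r (2 * b)) f f - 2 * q * m - 2 * \<eta>\<^sup>2 \<le> BK.HK.s"
        using BK.s_bounds(2) w2 w2E by linarith
      from divide_right_mono[OF this less_imp_le[OF m]] show ?thesis
        using m by (simp add: S_def rho diff_divide_distrib e2)
    qed
    moreover have "S / n \<le> 2 / n" using S2 N by (intro divide_right_mono) auto
    moreover have "0 \<le> S / n" "0 \<le> e\<^sup>2" "0 \<le> q" "0 \<le> 2 / real n" using S0 by (auto simp: q_def)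
    ultimately show ?thesis using S1 vS by linarith
  qed
  then have "t\<^sup>2 / 2 * \<bar>v - 1\<bar> \<le> t\<^sup>2 / 2 * (\<bar>\<rho> - 1\<bar> + e\<^sup>2 + 2 * q + 2 / n)" by (intro mult_left_mono) auto
  moreover have "\<bar>exp (- (t\<^sup>2 / 2 * v)) - exp (- (t\<^sup>2 / 2))\<bar> \<le> t\<^sup>2 / 2 * \<bar>v - 1\<bar>"
  proof -
    have "t\<^sup>2 / 2 * v - t\<^sup>2 / 2 = t\<^sup>2 / 2 * (v - 1)" by (simp add: right_diff_distrib)
    then have "\<bar>t\<^sup>2 / 2 * v - t\<^sup>2 / 2\<bar> = t\<^sup>2 / 2 * \<bar>v - 1\<bar>" by (simp only: abs_mult) simp
    then show ?thesis using abs_exp_minus_diff_le[of "t\<^sup>2 / 2 * v" "t\<^sup>2 / 2"] v0 by simp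
  qed
  ultimately have 3: "cmod (complex_of_real (exp (- (t\<^sup>2 / 2 * v))) - complex_of_real (exp (- (t\<^sup>2 / 2))))
      \<le> t\<^sup>2 / 2 * (\<bar>\<rho> - 1\<bar> + e\<^sup>2 + 2 * q + 2 / n)"
    unfolding of_real_diff[symmetric] norm_of_real by linarith
  have tri: "cmod (p - s) \<le> cmod (p - q') + cmod (q' - r') + cmod (r' - s)" for p q' r' s :: complex
    using norm_triangle_ineq[of "p - q'" "q' - s"] norm_triangle_ineq[of "q' - r'" "r' - s"] by simp
  show ?thesis
    by (rule order_trans[OF tri add_mono[OF add_mono[OF 1 2] 3]])
qed

end
end

section \<open>Asymptotics\<close>

lemma weak_conv_m_cong_eventually:
  assumes "eventually (\<lambda>n. \<mu> n = \<nu> n) sequentially" and "weak_conv_m \<nu> L"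
  shows "weak_conv_m \<mu> L"
  unfolding weak_conv_m_def weak_conv_def
proof (intro allI impI)
  fix x assume "isCont (cdf L) x"
  then have "(\<lambda>n. cdf (\<nu> n) x) \<longlonglongrightarrow> cdf L x"
    using assms(2) by (simp add: weak_conv_m_def weak_conv_def)
  then show "(\<lambda>n. cdf (\<mu> n) x) \<longlonglongrightarrow> cdf L x"
    by (rule Lim_transform_eventually) (use assms(1) in \<open>auto elim!: eventually_mono\<close>)
qed

lemma weak_conv_m_continuous_map:
  fixes g :: "real \<Rightarrow> real"
  assumes \<mu>: "\<And>n. real_distribution (\<mu> n)" and L: "real_distribution L"
    and conv: "weak_conv_m \<mu> L" and g: "\<And>x. isCont g x"
  shows "weak_conv_m (\<lambda>n. distr (\<mu> n) borel g) (distr L borel g)"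
proof -
  have [measurable]: "g \<in> borel_measurable borel"
    using g by (intro borel_measurable_continuous_onI continuous_at_imp_continuous_on) auto
  have gm: "g \<in> borel_measurable (\<mu> n)" for n
    using real_distribution.events_eq_borel[OF \<mu>] by (simp cong: measurable_cong_sets)
  have gL: "g \<in> borel_measurable L"
    using real_distribution.events_eq_borel[OF L] by (simp cong: measurable_cong_sets)
  have d: "real_distribution (distr (\<mu> n) borel g)" for n
    using \<mu> gm by (intro prob_space.real_distribution_distr) (auto simp: real_distribution_def)
  have dL: "real_distribution (distr L borel g)"
    using L gL by (intro prob_space.real_distribution_distr) (auto simp: real_distribution_def)
  show ?thesis
  proof (rule integral_bdd_continuous_conv_imp_weak_conv[OF d dL])
    fix f :: "real \<Rightarrow> real"
    assume f: "\<And>x. isCont f x" "\<And>x. \<bar>f x\<bar> \<le> 1"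
    have [measurable]: "f \<in> borel_measurable borel"
      using f by (intro borel_measurable_continuous_onI continuous_at_imp_continuous_on) auto
    have "(\<lambda>n. integral\<^sup>L (\<mu> n) (\<lambda>x. f (g x))) \<longlonglongrightarrow> integral\<^sup>L L (\<lambda>x. f (g x))"
      using f by (intro weak_conv_imp_integral_bdd_continuous_conv[OF \<mu> L conv, where B=1])
        (auto intro: isCont_o2[OF g])
    then show "(\<lambda>n. integral\<^sup>L (distr (\<mu> n) borel g) f) \<longlonglongrightarrow> integral\<^sup>L (distr L borel g) f"
      using gm gL by (simp add: integral_distr)
  qed
qed

text \<open>A deterministic shift only multiplies the characteristic function by a convergent phase,
  so Levy's theorem applies before squaring, and squaring is a continuous map.\<close>

lemma weak_conv_m_shifted_power2:
  fixes Y :: "nat \<Rightarrow> 'b \<Rightarrow> real" and c :: "nat \<Rightarrow> real"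
  assumes P: "\<And>n. prob_space (P n)" and Y: "\<And>n. Y n \<in> borel_measurable (P n)"
    and char: "\<And>t. (\<lambda>n. \<integral>x. iexp (t * Y n x) \<partial>P n) \<longlonglongrightarrow> complex_of_real (exp (- (t\<^sup>2 / 2)))"
    and c: "c \<longlonglongrightarrow> l"
  shows "weak_conv_m (\<lambda>n. distr (P n) borel (\<lambda>x. (Y n x + c n)\<^sup>2))
    (distr std_normal_distribution borel (\<lambda>z. (z + l)\<^sup>2))"
proof -
  define \<mu> where "\<mu> n = distr (P n) borel (\<lambda>x. Y n x + c n)" for n
  define L where "L = distr std_normal_distribution borel (\<lambda>z. z + l)"
  have m: "(\<lambda>x. Y n x + c n) \<in> borel_measurable (P n)" for n using Y[of n] by measurable
  have \<mu>: "real_distribution (\<mu> n)" for n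
    unfolding \<mu>_def by (rule prob_space.real_distribution_distr[OF P m])
  interpret N: real_distribution std_normal_distribution by (rule real_dist_normal_dist)
  have L: "real_distribution L" unfolding L_def by (rule N.real_distribution_distr) measurable
  have "char L t = iexp (t * l) * char std_normal_distribution t" for t
  proof -
    have "char L t = (\<integral>z. iexp (t * (z + l)) \<partial>std_normal_distribution)"
      unfolding char_def L_def by (rule integral_distr) measurable
    also have "\<dots> = (\<integral>z. iexp (t * l) * iexp (t * z) \<partial>std_normal_distribution)"
      by (simp add: distrib_left exp_add[symmetric] add.commute)
    finally show ?thesis by (simp add: char_def)
  qed
  then have charL: "char L t = iexp (t * l) * complex_of_real (exp (- (t\<^sup>2 / 2)))" for t
    by (simp add: char_std_normal_distribution)
  have char\<mu>: "char (\<mu> n) t = iexp (t * c n) * (\<integral>x. iexp (t * Y n x) \<partial>P n)" for n t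
  proof -
    have "char (\<mu> n) t = (\<integral>x. iexp (t * (Y n x + c n)) \<partial>P n)"
      unfolding char_def \<mu>_def by (rule integral_distr[OF m]) measurable
    also have "\<dots> = (\<integral>x. iexp (t * c n) * iexp (t * Y n x) \<partial>P n)"
      by (simp add: distrib_left exp_add[symmetric] add.commute)
    finally show ?thesis by simp
  qed
  have "weak_conv_m \<mu> L"
  proof (rule levy_continuity[OF \<mu> L])
    fix t
    show "(\<lambda>n. char (\<mu> n) t) \<longlonglongrightarrow> char L t"
      unfolding char\<mu> charL by (intro tendsto_mult char tendsto_intros c)
  qed
  from weak_conv_m_continuous_map[OF \<mu> L this, of "\<lambda>x. x\<^sup>2"]
  have "weak_conv_m (\<lambda>n. distr (\<mu> n) borel (\<lambda>x. x\<^sup>2)) (distr L borel (\<lambda>x. x\<^sup>2))" by simp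
  then show ?thesis
    unfolding \<mu>_def L_def using m by (simp add: distr_distr comp_def)
qed

text \<open>Chebyshev's inequality at half the shift. The bound \<open>V\<close> may grow with
  \<open>n\<close> as long as it is small against the squared shift, which is what happens when the
  linear part fails to be negligible.\<close>

lemma shifted_power2_tendsto_infinity:
  fixes Y :: "nat \<Rightarrow> 'b \<Rightarrow> real" and c V :: "nat \<Rightarrow> real"
  assumes P: "\<And>n. prob_space (P n)" and Y: "\<And>n. Y n \<in> borel_measurable (P n)"
    and Y2: "eventually (\<lambda>n. integrable (P n) (\<lambda>x. (Y n x)\<^sup>2) \<and> (\<integral>x. (Y n x)\<^sup>2 \<partial>P n) \<le> V n) sequentially"
    and c: "filterlim c at_top sequentially" and V: "(\<lambda>n. V n / (c n)\<^sup>2) \<longlonglongrightarrow> 0"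
  shows "tendsto_infinity_in_prob P (\<lambda>n x. (Y n x + c n)\<^sup>2)"
  unfolding tendsto_infinity_in_prob_def
proof (intro allI impI)
  fix K :: real assume K: "K > 0"
  let ?p = "\<lambda>n. measure (P n) {x \<in> space (P n). K < (Y n x + c n)\<^sup>2}"
  have ev: "eventually (\<lambda>n. 1 - 4 * (V n / (c n)\<^sup>2) \<le> ?p n) sequentially"
    \<comment> \<open>Beyond \<open>2 * sqrt K\<close>, the event \<open>|Y + c| <= sqrt K\<close>
      forces \<open>|Y| >= c / 2\<close>.\<close>
    using Y2 filterlim_at_top_dense[THEN iffD1, OF c, rule_format, of "2 * sqrt K"]
  proof eventually_elim
    case (elim n)
    interpret P: prob_space "P n" by (rule P)
    have [measurable]: "Y n \<in> borel_measurable (P n)" by (rule Y)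
    have c0: "0 < c n" using elim K by (smt (verit) real_sqrt_gt_zero)
    let ?A = "{x \<in> space (P n). K < (Y n x + c n)\<^sup>2}" and ?B = "{x \<in> space (P n). (c n / 2)\<^sup>2 \<le> (Y n x)\<^sup>2}"
    have "space (P n) - ?A \<subseteq> ?B"
    proof
      fix x assume x: "x \<in> space (P n) - ?A"
      then have "(Y n x + c n)\<^sup>2 \<le> K" by auto
      then have "\<bar>Y n x + c n\<bar> \<le> sqrt K" by (simp add: real_le_rsqrt)
      then have "\<bar>c n / 2\<bar> \<le> \<bar>Y n x\<bar>" using elim c0 by linarith
      then have "(c n / 2)\<^sup>2 \<le> (Y n x)\<^sup>2" by (rule abs_le_square_iff[THEN iffD1])
      then show "x \<in> ?B" using x by simp
    qed
    then have "1 - ?p n \<le> P.prob ?B"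
      by (subst P.prob_compl[symmetric], measurable) (intro P.finite_measure_mono, auto)
    also have "\<dots> \<le> (\<integral>x. (Y n x)\<^sup>2 \<partial>P n) / (c n / 2)\<^sup>2"
      using elim c0 by (intro integral_Markov_inequality_measure[where A="{}"]) auto
    also have "\<dots> \<le> V n / (c n / 2)\<^sup>2" using elim by (intro divide_right_mono) auto
    finally show ?case by (simp add: power_divide)
  qed
  have lim: "(\<lambda>n. 1 - 4 * (V n / (c n)\<^sup>2)) \<longlonglongrightarrow> 1"
    using tendsto_diff[OF tendsto_const tendsto_mult[OF tendsto_const V], of 1 4] by simp
  have "eventually (\<lambda>n. ?p n \<le> 1) sequentially"
    by (intro eventuallyI prob_space.prob_le_1 P)
  then show "?p \<longlonglongrightarrow> 1"
    by (rule tendsto_sandwich[OF ev _ lim tendsto_const])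
qed

lemma length_power_eq_ustat: "length_power r b n x = ustat (edge_weight r b) n x"
proof -
  let ?w = "\<lambda>p. edge_weight r b (x (fst p)) (x (snd p))"
  let ?A = "{(i, j). i \<in> {1..n} \<and> j \<in> {1..n} \<and> i < j}"
  have fin: "finite ?A" by (rule finite_subset[of _ "{1..n} \<times> {1..n}"]) auto
  have sym: "edge_weight r b u v = edge_weight r b v u" for u v :: 'a
    unfolding edge_weight_def by (simp add: norm_minus_commute)
  have swap: "sum ?w (prod.swap ` ?A) = sum ?w ?A"
    by (subst sum.reindex) (auto simp: sym[of "x (snd _)"] intro!: sum.cong)
  have "{(i, j). i \<in> {1..n} \<and> j \<in> {1..n} \<and> i \<noteq> j} = ?A \<union> prod.swap ` ?A"
    by (auto simp: image_iff)
  moreover have "?A \<inter> prod.swap ` ?A = {}" by auto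
  ultimately have "sum ?w {(i, j). i \<in> {1..n} \<and> j \<in> {1..n} \<and> i \<noteq> j} = sum ?w ?A + sum ?w (prod.swap ` ?A)"
    using fin by (simp only: sum.union_disjoint finite_imageI)
  then have "sum ?w {(i, j). i \<in> {1..n} \<and> j \<in> {1..n} \<and> i \<noteq> j} = 2 * sum ?w ?A"
    unfolding swap by (simp only: mult_2)
  then have "length_power r b n x = sum ?w ?A"
    unfolding length_power_def by (simp add: case_prod_unfold)
  also have "?A = prod.swap ` (Sigma {0<..n} (\<lambda>j. {0<..j - 1}))"
    by (force simp: image_iff)
  also have "sum ?w (prod.swap ` (Sigma {0<..n} (\<lambda>j. {0<..j - 1}))) = ustat (edge_weight r b) n x"
    unfolding ustat_eq_sum_Sigma by (subst sum.reindex) auto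
  finally show ?thesis .
qed

lemma ustat_cong: "(\<And>i. i \<in> {0<..n} \<Longrightarrow> x i = y i) \<Longrightarrow> ustat w n x = ustat w n y"
  unfolding ustat_def by (intro sum.cong refl arg_cong2[where f=w]) auto

text \<open>\<open>cong\<close> bridges two conventions: the random points form a total family of
  indices, whereas points of the product space are \<open>undefined\<close> outside
  \<open>{0<..n}\<close>.\<close>

lemma distr_iid_sample:
  fixes X :: "nat \<Rightarrow> 'b \<Rightarrow> 'a::euclidean_space"
  assumes n: "1 \<le> n" and M: "prob_space M" and indep: "prob_space.indep_vars M (\<lambda>_. borel) X {1..n}"
    and X: "\<And>i. i \<in> {1..n} \<Longrightarrow> X i \<in> borel_measurable M"
    and Q: "\<And>i. i \<in> {1..n} \<Longrightarrow> distr M borel (X i) = Q"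
    and F: "F \<in> borel_measurable (Pi\<^sub>M {0<..n} (\<lambda>_. Q))"
    and cong: "\<And>x y. (\<And>i. i \<in> {0<..n} \<Longrightarrow> x i = y i) \<Longrightarrow> F x = F y"
  shows "(\<lambda>\<omega>. F (\<lambda>i. X i \<omega>)) \<in> borel_measurable M"
    and "distr M borel (\<lambda>\<omega>. F (\<lambda>i. X i \<omega>)) = distr (Pi\<^sub>M {0<..n} (\<lambda>_. Q)) borel F"
proof -
  have I: "{1..n} = {0<..n}" by auto
  have sQ: "sets Q = sets borel" using Q[of 1] n by (metis atLeastAtMost_iff order_refl sets_distr)
  let ?R = "\<lambda>\<omega>. \<lambda>i\<in>{0<..n}. X i \<omega>"
  have ne: "{0<..n} \<noteq> {}" using n by auto
  have "distr M (\<Pi>\<^sub>M i\<in>{0<..n}. borel) ?R = (\<Pi>\<^sub>M i\<in>{0<..n}. distr M borel (X i))"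
    using prob_space.indep_vars_iff_distr_eq_PiM'[where I="{0<..n}" and M'="\<lambda>_. borel" and X=X, OF M ne] indep X unfolding I by auto
  also have "\<dots> = Pi\<^sub>M {0<..n} (\<lambda>_. Q)" using Q unfolding I by (intro PiM_cong) auto
  finally have P: "Pi\<^sub>M {0<..n} (\<lambda>_. Q) = distr M (\<Pi>\<^sub>M i\<in>{0<..n}. borel) ?R" ..
  have R: "?R \<in> measurable M (\<Pi>\<^sub>M i\<in>{0<..n}. borel)"
    using X unfolding I by (intro measurable_restrict) auto
  have F': "F \<in> borel_measurable (\<Pi>\<^sub>M i\<in>{0<..n}. borel)"
    using F unfolding P by simp
  have e: "F \<circ> ?R = (\<lambda>\<omega>. F (\<lambda>i. X i \<omega>))"
    by (intro ext) (auto intro: cong)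
  show "(\<lambda>\<omega>. F (\<lambda>i. X i \<omega>)) \<in> borel_measurable M"
    unfolding e[symmetric] by (rule measurable_comp[OF R F'])
  show "distr M borel (\<lambda>\<omega>. F (\<lambda>i. X i \<omega>)) = distr (Pi\<^sub>M {0<..n} (\<lambda>_. Q)) borel F"
    unfolding P e[symmetric] by (rule distr_distr[OF F' R, symmetric])
qed

lemma char_bound_mono:
  fixes t q \<beta> l l' e e' p p' k :: real
  assumes l: "l \<le> l'" and e: "0 \<le> e" "e \<le> e'" and \<beta>: "0 \<le> \<beta>" and p: "p \<le> p'"
  shows "\<bar>t\<bar> * sqrt (4 * q + 8 * l)
      + (\<bar>t\<bar> ^ 3 * sqrt (4 * \<beta>\<^sup>2 + 12 * \<beta> * e) + t\<^sup>2 * sqrt (8 * \<beta> * e + 4 * e\<^sup>2) + 2 * t ^ 4 / k)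
      + t\<^sup>2 / 2 * (p + e\<^sup>2 + 2 * q + 2 / k)
    \<le> \<bar>t\<bar> * sqrt (4 * q + 8 * l')
      + (\<bar>t\<bar> ^ 3 * sqrt (4 * \<beta>\<^sup>2 + 12 * \<beta> * e') + t\<^sup>2 * sqrt (8 * \<beta> * e' + 4 * e'\<^sup>2) + 2 * t ^ 4 / k)
      + t\<^sup>2 / 2 * (p' + e'\<^sup>2 + 2 * q + 2 / k)"
proof -
  have e2: "e\<^sup>2 \<le> e'\<^sup>2" using e by (intro power_mono) auto
  have \<beta>e: "\<beta> * e \<le> \<beta> * e'" using e \<beta> by (intro mult_left_mono) auto
  have "\<bar>t\<bar> * sqrt (4 * q + 8 * l) \<le> \<bar>t\<bar> * sqrt (4 * q + 8 * l')"
    using l by (intro mult_left_mono real_sqrt_le_mono) auto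
  moreover have "\<bar>t\<bar> ^ 3 * sqrt (4 * \<beta>\<^sup>2 + 12 * \<beta> * e) \<le> \<bar>t\<bar> ^ 3 * sqrt (4 * \<beta>\<^sup>2 + 12 * \<beta> * e')"
    using \<beta>e by (intro mult_left_mono real_sqrt_le_mono) auto
  moreover have "t\<^sup>2 * sqrt (8 * \<beta> * e + 4 * e\<^sup>2) \<le> t\<^sup>2 * sqrt (8 * \<beta> * e' + 4 * e'\<^sup>2)"
    using \<beta>e e2 by (intro mult_left_mono real_sqrt_le_mono) auto
  moreover have "t\<^sup>2 / 2 * (p + e\<^sup>2 + 2 * q + 2 / k) \<le> t\<^sup>2 / 2 * (p' + e'\<^sup>2 + 2 * q + 2 / k)"
    using p e2 by (intro mult_left_mono) auto
  ultimately show ?thesis by linarith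
qed

section \<open>Sequences of samples\<close>

locale sample_sequence = perturbed_uniform U G D \<delta> C \<rho>\<^sub>0
  for U :: "'a::euclidean_space set" and G D :: "'a \<Rightarrow> real" and \<delta> C \<rho>\<^sub>0 :: real +
  fixes a r :: "nat \<Rightarrow> real" and b :: real
  assumes sequence_nonneg: "x \<in> U \<Longrightarrow> 0 \<le> 1 + a n * G x"
    and r_pos: "0 < r n" and r_lim: "r \<longlonglongrightarrow> 0" and a_lim: "a \<longlonglongrightarrow> 0"
    and b_gt: "- real DIM('a) / 2 < b"
    and many_edges: "filterlim (\<lambda>n. (real n)\<^sup>2 * r n ^ DIM('a)) at_top sequentially"
    and sparse: "(\<lambda>n. real n * r n ^ (DIM('a) + 1)) \<longlonglongrightarrow> 0"
begin

lemma sample: "perturbed_sample U G D \<delta> C \<rho>\<^sub>0 (a n)"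
  by (intro perturbed_sample.intro perturbed_uniform_axioms perturbed_sample_axioms.intro sequence_nonneg)

definition Pn :: "nat \<Rightarrow> (nat \<Rightarrow> 'a) measure" where
  "Pn n = Pi\<^sub>M {0<..n} (\<lambda>_. perturbed_sample.Q U G (a n))"

definition Y :: "nat \<Rightarrow> (nat \<Rightarrow> 'a) \<Rightarrow> real" where
  "Y n = perturbed_sample.normalised U G (a n) (r n) b n"

definition g\<^sub>2 :: real where "g\<^sub>2 = (\<integral>x. (G x)\<^sup>2 \<partial>lborel)"
definition g\<^sub>3 :: real where "g\<^sub>3 = (\<integral>x. \<bar>G x\<bar> ^ 3 \<partial>lborel)"
text \<open>\<open>c\<^sub>0\<close> is the constant in \<open>T_scale\<close>;
  \<open>c\<^sub>1 * r^d\<close> is the squared mass of the kernel over the mass of its square;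
  \<open>c\<^sub>2\<close> converts a relative change of the kernel mean into a shift of the
  normalised statistic and is the constant in front of \<open>\<gamma>\<close> in the limit.\<close>

definition c\<^sub>0 :: real where "c\<^sub>0 = sqrt (real DIM('a) * unit_ball_vol (real DIM('a)) / (2 * (2 * b + real DIM('a))))"
definition c\<^sub>1 :: real where "c\<^sub>1 = real DIM('a) * unit_ball_vol (real DIM('a)) * (2 * b + real DIM('a)) / (b + real DIM('a))\<^sup>2"
definition c\<^sub>2 :: real where "c\<^sub>2 = real DIM('a) * unit_ball_vol (real DIM('a)) / (2 * (b + real DIM('a)) * c\<^sub>0)"
text \<open>\<open>edges\<close> has the order of the square root of the expected number of edges.\<close>

definition edges :: "nat \<Rightarrow> real" where "edges n = real n * r n powr (real DIM('a) / 2)"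

lemma exponent_pos: "0 < 2 * b + real DIM('a)" "0 < b + real DIM('a)"
  using b_gt by (auto simp: field_simps)

lemma dk_pos: "0 < real DIM('a) * unit_ball_vol (real DIM('a))"
  by simp

lemma c0_pos: "0 < c\<^sub>0" and c1_pos: "0 < c\<^sub>1" and c2_pos: "0 < c\<^sub>2"
proof -
  show c0: "0 < c\<^sub>0" unfolding c\<^sub>0_def using exponent_pos by simp
  show "0 < c\<^sub>1" unfolding c\<^sub>1_def using exponent_pos by simp
  show "0 < c\<^sub>2" unfolding c\<^sub>2_def using exponent_pos c0 by simp
qed

lemma g2_nonneg: "0 \<le> g\<^sub>2" and g3_nonneg: "0 \<le> g\<^sub>3"
  unfolding g\<^sub>2_def g\<^sub>3_def by simp_all

lemma T_scale_eq: "T_scale TYPE('a) (r n) b n = c\<^sub>0 * real n * r n powr (b + real DIM('a) / 2)"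
  unfolding T_scale_def c\<^sub>0_def ..

lemma edges_power2: "(edges n)\<^sup>2 = (real n)\<^sup>2 * r n ^ DIM('a)"
proof -
  have "(r n powr (real DIM('a) / 2))\<^sup>2 = r n ^ DIM('a)"
    using r_pos[of n] by (simp add: power2_eq_square powr_add[symmetric] powr_realpow[symmetric])
  then show ?thesis by (simp add: edges_def power_mult_distrib)
qed

lemma edges_nonneg: "0 \<le> edges n" unfolding edges_def by simp

lemma edges_lim: "filterlim edges at_top sequentially"
proof -
  have "edges = (\<lambda>n. sqrt ((real n)\<^sup>2 * r n ^ DIM('a)))"
    using edges_nonneg by (simp add: fun_eq_iff edges_power2[symmetric])
  then show ?thesis using filterlim_compose[OF sqrt_at_top many_edges] by simp
qed

lemma r_powr_lim: "0 < p \<Longrightarrow> (\<lambda>n. r n powr p) \<longlonglongrightarrow> 0"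
  by (rule tendsto_zero_powrI[OF r_lim tendsto_const]) (auto intro!: always_eventually less_imp_le r_pos)

lemma eventually_r_less: "0 < e \<Longrightarrow> eventually (\<lambda>n. r n < e) sequentially"
  using order_tendstoD(2)[OF r_lim] .

lemma eventually_a_le: "eventually (\<lambda>n. \<bar>a n\<bar> \<le> 1) sequentially"
  using order_tendstoD(2)[OF tendsto_rabs_zero[OF a_lim], of 1] by (auto elim!: eventually_mono)

lemma eventually_a2_le: "eventually (\<lambda>n. 1 + (a n)\<^sup>2 * g\<^sub>2 \<le> 2) sequentially"
proof -
  have "(\<lambda>n. (a n)\<^sup>2 * g\<^sub>2) \<longlonglongrightarrow> 0\<^sup>2 * g\<^sub>2" by (intro tendsto_intros a_lim)
  then have "(\<lambda>n. (a n)\<^sup>2 * g\<^sub>2) \<longlonglongrightarrow> 0" by simp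
  from order_tendstoD(2)[OF this, of 1] show ?thesis by (auto elim!: eventually_mono)
qed

text \<open>Collects what the bounds at fixed \<open>n\<close> require. The last condition says that
  the squared L2 norm of the density is at most 2.\<close>

definition regular :: "nat \<Rightarrow> bool" where
  "regular n \<longleftrightarrow> 1 \<le> n \<and> r n < \<delta> \<and> r n < \<rho>\<^sub>0 \<and> \<bar>a n\<bar> \<le> 1 \<and> 1 + (a n)\<^sup>2 * g\<^sub>2 \<le> 2"

lemma eventually_regular: "eventually regular sequentially"
  using eventually_ge_at_top[of 1] eventually_r_less[OF delta_pos] eventually_r_less[OF rho0_pos]
    eventually_a_le eventually_a2_le
  by eventually_elim (simp add: regular_def)

lemma prob_space_Pn: "prob_space (Pn n)"
proof -
  interpret S: perturbed_sample U G D \<delta> C \<rho>\<^sub>0 "a n" by (rule sample)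
  show ?thesis unfolding Pn_def by (rule S.prob_space_P)
qed

lemma Y_eq: "Y n x = (ustat (edge_weight (r n) b) n x
    - real n * (real n - 1) / 2 * conv_form (radial (r n) b) (perturbed_sample.f U G (a n)) (perturbed_sample.f U G (a n)))
    / T_scale TYPE('a) (r n) b n"
proof -
  interpret S: perturbed_sample U G D \<delta> C \<rho>\<^sub>0 "a n" by (rule sample)
  show ?thesis unfolding Y_def S.normalised_def ..
qed

lemma ustat_measurable_Pn: "ustat (edge_weight (r n) b) n \<in> borel_measurable (Pn n)"
proof -
  interpret S: perturbed_sample U G D \<delta> C \<rho>\<^sub>0 "a n" by (rule sample)
  have "(\<lambda>(x, y). radial (r n) b (x - y)) \<in> borel_measurable (S.Q \<Otimes>\<^sub>M S.Q)" by measurable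
  then show ?thesis unfolding Pn_def
    by (intro S.ustat_measurable) (simp add: edge_weight_eq_radial[abs_def])
qed

lemma Y_measurable: "Y n \<in> borel_measurable (Pn n)"
  unfolding Y_eq[abs_def] using ustat_measurable_Pn[of n] by measurable

text \<open>Explicit version of \<open>linear_error\<close>. The first term vanishes by
  \<open>sparse\<close>; the second is \<open>edges n * (a n)^2\<close> times
  \<open>r n powr (d/2)\<close> up to constants, with \<open>d\<close> the dimension.\<close>

definition lin :: "nat \<Rightarrow> real" where
  "lin n = c\<^sub>1 * (C * (real n * r n ^ (DIM('a) + 1)) + real n * r n ^ DIM('a) * (a n)\<^sup>2 * (4 * (1 + g\<^sub>3) + g\<^sub>3))"

lemma F3_le: "regular n \<Longrightarrow> perturbed_sample.F3 U G (a n) \<le> 4 * (1 + g\<^sub>3)"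
proof -
  assume n: "regular n"
  interpret S: perturbed_sample U G D \<delta> C \<rho>\<^sub>0 "a n" by (rule sample)
  have "\<bar>a n\<bar> ^ 3 * g\<^sub>3 \<le> 1 * g\<^sub>3"
    using n g3_nonneg by (intro mult_right_mono power_le_one) (auto simp: regular_def)
  then show ?thesis using S.f3_integral by (simp add: S.F3_def g\<^sub>3_def)
qed

lemma linear_error_le:
  assumes n: "regular n"
  shows "perturbed_sample.linear_error U G C (a n) (r n) b n \<le> lin n"
proof -
  interpret S: perturbed_sample U G D \<delta> C \<rho>\<^sub>0 "a n" by (rule sample)
  have ratio: "(radial_mass TYPE('a) (r n) b)\<^sup>2 / radial_mass TYPE('a) (r n) (2 * b) = c\<^sub>1 * r n ^ DIM('a)"
  proof -
    define K s\<^sub>1 s\<^sub>2 u v where "K = real DIM('a) * unit_ball_vol (real DIM('a))"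
      and "s\<^sub>1 = b + real DIM('a)" and "s\<^sub>2 = 2 * b + real DIM('a)"
      and "u = r n powr (b + real DIM('a))" and "v = r n powr (2 * b + real DIM('a))"
    have pos: "0 < K" "0 < s\<^sub>1" "0 < s\<^sub>2" "0 < v"
      using exponent_pos dk_pos r_pos[of n] by (simp_all add: K_def s\<^sub>1_def s\<^sub>2_def v_def)
    have uv: "u\<^sup>2 = v * r n ^ DIM('a)"
      using r_pos[of n] by (simp add: u_def v_def power2_eq_square powr_add[symmetric] powr_realpow[symmetric] algebra_simps)
    have "(K / s\<^sub>1 * u)\<^sup>2 / (K / s\<^sub>2 * v) = K * s\<^sub>2 / s\<^sub>1\<^sup>2 * r n ^ DIM('a)"
      unfolding power_mult_distrib power_divide uv using pos by (simp add: field_simps power2_eq_square)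
    then show ?thesis
      unfolding radial_mass_def c\<^sub>1_def K_def s\<^sub>1_def s\<^sub>2_def u_def v_def .
  qed
  have "S.linear_error (r n) b n
      = c\<^sub>1 * (C * (real n * r n ^ (DIM('a) + 1)) + real n * r n ^ DIM('a) * (a n)\<^sup>2 * (S.F3 + S.G3))"
    unfolding S.linear_error_def ratio by (simp add: algebra_simps)
  also have "\<dots> \<le> lin n"
    unfolding lin_def using F3_le[OF n] c1_pos r_pos[of n]
    by (intro mult_left_mono add_left_mono) (auto simp: S.G3_def g\<^sub>3_def)
  finally show ?thesis .
qed

lemma second_moment_Y:
  assumes n: "regular n"
  shows "integrable (Pn n) (\<lambda>x. (Y n x)\<^sup>2)" and "(\<integral>x. (Y n x)\<^sup>2 \<partial>Pn n) \<le> 4 + 8 * lin n"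
proof -
  interpret S: perturbed_sample U G D \<delta> C \<rho>\<^sub>0 "a n" by (rule sample)
  have n': "r n < \<delta>" "r n < \<rho>\<^sub>0" "1 \<le> n" using n by (auto simp: regular_def)
  note * = S.normalised_power2[OF r_pos n'(1,2) b_gt n'(3)]
  show "integrable (Pn n) (\<lambda>x. (Y n x)\<^sup>2)" unfolding Y_def Pn_def by (rule *)
  have "S.F2 \<le> 2" using n unfolding S.F2_def S.f2_integral regular_def g\<^sub>2_def by simp
  then show "(\<integral>x. (Y n x)\<^sup>2 \<partial>Pn n) \<le> 4 + 8 * lin n"
    using *(3) linear_error_le[OF n] unfolding Y_def Pn_def by linarith
qed

text \<open>The weight of one pair relative to the scale is of order \<open>1 / edges n\<close>, and
  \<open>many_edges\<close> makes it vanish; the weight of one point is of order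
  \<open>r n powr (d/6)\<close>.\<close>

lemma char_Y_approx:
  assumes n: "regular n" and \<epsilon>: "0 < \<epsilon>" "\<epsilon> < 1"
  defines "q \<equiv> \<epsilon> powr (2 * b + real DIM('a))"
    and "\<beta>\<^sub>n \<equiv> max 1 (\<epsilon> powr b) / c\<^sub>0 / edges n"
    and "e \<equiv> max 1 (\<epsilon> powr b) / c\<^sub>0 * (unit_ball_vol (real DIM('a)) + 4 * (1 + g\<^sub>3)) * r n powr (real DIM('a) / 6)"
  shows "cmod ((\<integral>x. iexp (t * Y n x) \<partial>Pn n) - complex_of_real (exp (- (t\<^sup>2 / 2))))
    \<le> \<bar>t\<bar> * sqrt (4 * q + 8 * lin n)
      + (\<bar>t\<bar> ^ 3 * sqrt (4 * \<beta>\<^sub>n\<^sup>2 + 12 * \<beta>\<^sub>n * e) + t\<^sup>2 * sqrt (8 * \<beta>\<^sub>n * e + 4 * e\<^sup>2) + 2 * t ^ 4 / n)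
      + t\<^sup>2 / 2 * ((C * r n + \<bar>a n\<bar> * (1 + g\<^sub>2) + (a n)\<^sup>2 * g\<^sub>2) + e\<^sup>2 + 2 * q + 2 / n)"
proof -
  interpret S: perturbed_sample U G D \<delta> C \<rho>\<^sub>0 "a n" by (rule sample)
  have n': "r n < \<delta>" "r n < \<rho>\<^sub>0" "1 \<le> n" using n by (auto simp: regular_def)
  have F2: "S.F2 \<le> 2" using n unfolding S.F2_def S.f2_integral regular_def g\<^sub>2_def by simp
  let ?B = "max 1 (\<epsilon> powr b) * r n powr b" and ?T = "T_scale TYPE('a) (r n) b n"
  let ?e = "real n * (?B * ((unit_ball_vol (real DIM('a)) + S.F3) * r n powr (2 / 3 * DIM('a)))) / ?T"
  let ?m = "radial_mass TYPE('a) (r n) (2 * b)"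
  let ?\<rho> = "conv_form (radial (r n) (2 * b)) S.f S.f / ?m"
  have Bpos: "0 < max 1 (\<epsilon> powr b)" by (simp add: less_max_iff_disj)
  have beta: "?B / ?T = \<beta>\<^sub>n"
    unfolding T_scale_eq \<beta>\<^sub>n_def edges_def using n' r_pos[of n] c0_pos
    by (simp add: powr_add)
  have e0: "0 \<le> ?e"
    using n' r_pos[of n] c0_pos S.F3_nonneg Bpos unfolding T_scale_eq
    by (intro divide_nonneg_nonneg mult_nonneg_nonneg add_nonneg_nonneg) auto
  have e_le: "?e \<le> e"
  proof -
    \<comment> \<open>Here the L3 assumption pays off: \<open>2/3 - 1/2 = 1/6\<close> leaves a
      positive power.\<close>
    have "r n powr (2 / 3 * DIM('a)) / r n powr (real DIM('a) / 2) = r n powr (real DIM('a) / 6)"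
      by (simp add: powr_diff[symmetric])
    then have "?e = max 1 (\<epsilon> powr b) / c\<^sub>0 * (unit_ball_vol (real DIM('a)) + S.F3) * r n powr (real DIM('a) / 6)"
      unfolding T_scale_eq powr_add using n' r_pos[of n] c0_pos by (simp add: field_simps)
    also have "\<dots> \<le> e"
      unfolding e_def using F3_le[OF n] c0_pos Bpos by (intro mult_right_mono mult_left_mono) auto
    finally show ?thesis .
  qed
  have beta0: "0 \<le> \<beta>\<^sub>n" unfolding \<beta>\<^sub>n_def using c0_pos edges_nonneg[of n] Bpos by simp
  \<comment> \<open>For the variance the crude bound of order \<open>a n\<close> on the cross terms
    is enough, in contrast to the mean, where they must cancel.\<close>
  have rho: "\<bar>?\<rho> - 1\<bar> \<le> C * r n + \<bar>a n\<bar> * (1 + g\<^sub>2) + (a n)\<^sup>2 * g\<^sub>2"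
  proof -
    have b2: "- real DIM('a) < 2 * b" using b_gt by (simp add: field_simps)
    have m: "0 < ?m" by (rule radial_mass_pos[OF r_pos b2])
    note k = integrable_radial[OF r_pos[of n] b2] radial_nonneg[of "r n" "2 * b", where 'a='a]
    have mI: "I \<in> borel_measurable borel" by measurable
    note mG = G_borel
    have II: "\<bar>conv_form (radial (r n) (2 * b)) I I - ?m\<bar> \<le> ?m * (C * r n)"
      by (rule conv_form_I_I[OF r_pos b2 n'(2)])
    have IG: "\<bar>conv_form (radial (r n) (2 * b)) I G\<bar> \<le> (1 + g\<^sub>2) / 2 * ?m"
      using conv_form_bound[OF mI mG I2_integrable G2_integrable k] integral_radial[OF r_pos[of n] b2]
      by (simp add: g\<^sub>2_def I2_integral)
    have GI: "\<bar>conv_form (radial (r n) (2 * b)) G I\<bar> \<le> (1 + g\<^sub>2) / 2 * ?m"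
      using conv_form_bound[OF mG mI G2_integrable I2_integrable k] integral_radial[OF r_pos[of n] b2]
      by (simp add: g\<^sub>2_def I2_integral add.commute)
    have GG: "\<bar>conv_form (radial (r n) (2 * b)) G G\<bar> \<le> g\<^sub>2 * ?m"
      using conv_form_bound[OF mG mG G2_integrable G2_integrable k] integral_radial[OF r_pos[of n] b2]
      by (simp add: g\<^sub>2_def)
    have "\<bar>conv_form (radial (r n) (2 * b)) S.f S.f - ?m\<bar>
        \<le> ?m * (C * r n) + \<bar>a n\<bar> * ((1 + g\<^sub>2) / 2 * ?m + (1 + g\<^sub>2) / 2 * ?m) + (a n)\<^sup>2 * (g\<^sub>2 * ?m)"
    proof -
      let ?IG = "conv_form (radial (r n) (2 * b)) I G" and ?GI = "conv_form (radial (r n) (2 * b)) G I"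
      have "\<bar>a n * (?IG + ?GI)\<bar> \<le> \<bar>a n\<bar> * ((1 + g\<^sub>2) / 2 * ?m + (1 + g\<^sub>2) / 2 * ?m)"
        unfolding abs_mult using IG GI by (intro mult_left_mono) linarith+
      moreover have "\<bar>(a n)\<^sup>2 * conv_form (radial (r n) (2 * b)) G G\<bar> \<le> (a n)\<^sup>2 * (g\<^sub>2 * ?m)"
        using GG by (simp add: abs_mult mult_left_mono)
      ultimately show ?thesis using II unfolding S.conv_form_f_f[OF k] by linarith
    qed
    also have "\<dots> = (C * r n + \<bar>a n\<bar> * (1 + g\<^sub>2) + (a n)\<^sup>2 * g\<^sub>2) * ?m" by (simp add: field_simps)
    finally have "\<bar>conv_form (radial (r n) (2 * b)) S.f S.f - ?m\<bar> / ?m \<le> C * r n + \<bar>a n\<bar> * (1 + g\<^sub>2) + (a n)\<^sup>2 * g\<^sub>2"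
      using m by (simp add: pos_divide_le_eq)
    moreover have "\<bar>?\<rho> - 1\<bar> = \<bar>conv_form (radial (r n) (2 * b)) S.f S.f - ?m\<bar> / ?m"
      using m by (simp add: diff_divide_distrib[symmetric] abs_divide field_simps)
    ultimately show ?thesis by simp
  qed
  have "cmod ((\<integral>x. iexp (t * Y n x) \<partial>Pn n) - complex_of_real (exp (- (t\<^sup>2 / 2))))
    \<le> \<bar>t\<bar> * sqrt (4 * q + 8 * S.linear_error (r n) b n)
      + (\<bar>t\<bar> ^ 3 * sqrt (4 * \<beta>\<^sub>n\<^sup>2 + 12 * \<beta>\<^sub>n * ?e) + t\<^sup>2 * sqrt (8 * \<beta>\<^sub>n * ?e + 4 * ?e\<^sup>2) + 2 * t ^ 4 / n)
      + t\<^sup>2 / 2 * (\<bar>?\<rho> - 1\<bar> + ?e\<^sup>2 + 2 * q + 2 / n)"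
    using S.char_normalised_approx[OF r_pos n'(1,2) b_gt n'(3) \<epsilon> F2, of t]
    unfolding Y_def Pn_def q_def beta .
  also have "\<dots> \<le> \<bar>t\<bar> * sqrt (4 * q + 8 * lin n)
      + (\<bar>t\<bar> ^ 3 * sqrt (4 * \<beta>\<^sub>n\<^sup>2 + 12 * \<beta>\<^sub>n * e) + t\<^sup>2 * sqrt (8 * \<beta>\<^sub>n * e + 4 * e\<^sup>2) + 2 * t ^ 4 / n)
      + t\<^sup>2 / 2 * ((C * r n + \<bar>a n\<bar> * (1 + g\<^sub>2) + (a n)\<^sup>2 * g\<^sub>2) + e\<^sup>2 + 2 * q + 2 / n)"
    by (rule char_bound_mono[OF linear_error_le[OF n] e0 e_le beta0 rho])
  finally show ?thesis .
qed

text \<open>Order of limits: \<open>\<epsilon>\<close> is chosen first, so that the terms with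
  \<open>q\<close> stay below the tolerance, and \<open>n\<close> grows with
  \<open>\<epsilon>\<close> fixed. The quantities \<open>?\<beta>\<close> and \<open>?e\<close>
  contain \<open>\<epsilon> powr b\<close>, which may blow up as \<open>\<epsilon>\<close> tends to
  0.\<close>

lemma char_Y_tendsto:
  assumes lin0: "(\<lambda>n. real n * r n ^ DIM('a) * (a n)\<^sup>2) \<longlonglongrightarrow> 0"
  shows "(\<lambda>n. \<integral>x. iexp (t * Y n x) \<partial>Pn n) \<longlonglongrightarrow> complex_of_real (exp (- (t\<^sup>2 / 2)))"
proof (rule LIMSEQ_I)
  fix \<eta> :: real assume \<eta>: "0 < \<eta>"
  have "(\<lambda>k. \<bar>t\<bar> * sqrt (4 * inverse (real (Suc k))) + t\<^sup>2 / 2 * (2 * inverse (real (Suc k)))) \<longlonglongrightarrow> \<bar>t\<bar> * sqrt (4 * 0) + t\<^sup>2 / 2 * (2 * 0)"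
    by (intro tendsto_intros LIMSEQ_inverse_real_of_nat)
  then have "eventually (\<lambda>k. \<bar>t\<bar> * sqrt (4 * inverse (real (Suc k))) + t\<^sup>2 / 2 * (2 * inverse (real (Suc k))) < \<eta>) sequentially"
    using \<eta> by (intro order_tendstoD(2)) auto
  with eventually_ge_at_top[of 1] have "eventually (\<lambda>k. 1 \<le> k \<and> \<bar>t\<bar> * sqrt (4 * inverse (real (Suc k))) + t\<^sup>2 / 2 * (2 * inverse (real (Suc k))) < \<eta>) sequentially"
    by eventually_elim simp
  then obtain k where k: "1 \<le> k" "\<bar>t\<bar> * sqrt (4 * inverse (real (Suc k))) + t\<^sup>2 / 2 * (2 * inverse (real (Suc k))) < \<eta>"
    using eventually_happens'[OF sequentially_bot] by blast
  \<comment> \<open>The variance share \<open>q\<close> is picked first and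
    \<open>\<epsilon>\<close> recovered from it by taking a root; \<open>k >= 1\<close> ensures
    \<open>q < 1\<close>, hence \<open>\<epsilon> < 1\<close>.\<close>
  define q where "q = inverse (real (Suc k))"
  have q: "0 < q" "q < 1" "\<bar>t\<bar> * sqrt (4 * q) + t\<^sup>2 / 2 * (2 * q) < \<eta>"
    using k by (auto simp: q_def field_simps)
  define \<epsilon> where "\<epsilon> = q powr (1 / (2 * b + real DIM('a)))"
  have \<epsilon>: "0 < \<epsilon>" "\<epsilon> < 1" "\<epsilon> powr (2 * b + real DIM('a)) = q"
  proof -
    show "0 < \<epsilon>" using q by (simp add: \<epsilon>_def)
    have "\<epsilon> < 1 powr (1 / (2 * b + real DIM('a)))"
      unfolding \<epsilon>_def using q exponent_pos by (intro powr_less_mono2) auto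
    then show "\<epsilon> < 1" by simp
    show "\<epsilon> powr (2 * b + real DIM('a)) = q" using q exponent_pos by (simp add: \<epsilon>_def powr_powr)
  qed
  let ?\<beta> = "\<lambda>n. max 1 (\<epsilon> powr b) / c\<^sub>0 / edges n"
  let ?e = "\<lambda>n. max 1 (\<epsilon> powr b) / c\<^sub>0 * (unit_ball_vol (real DIM('a)) + 4 * (1 + g\<^sub>3)) * r n powr (real DIM('a) / 6)"
  let ?R = "\<lambda>n. \<bar>t\<bar> * sqrt (4 * q + 8 * lin n)
      + (\<bar>t\<bar> ^ 3 * sqrt (4 * (?\<beta> n)\<^sup>2 + 12 * ?\<beta> n * ?e n) + t\<^sup>2 * sqrt (8 * ?\<beta> n * ?e n + 4 * (?e n)\<^sup>2) + 2 * t ^ 4 / n)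
      + t\<^sup>2 / 2 * ((C * r n + \<bar>a n\<bar> * (1 + g\<^sub>2) + (a n)\<^sup>2 * g\<^sub>2) + (?e n)\<^sup>2 + 2 * q + 2 / n)"
  have lin: "lin \<longlonglongrightarrow> 0"
  proof -
    have "lin \<longlonglongrightarrow> c\<^sub>1 * (C * 0 + 0 * (4 * (1 + g\<^sub>3) + g\<^sub>3))"
      unfolding lin_def[abs_def] by (intro tendsto_intros sparse lin0)
    then show ?thesis by simp
  qed
  have \<beta>: "?\<beta> \<longlonglongrightarrow> 0" by (rule tendsto_divide_0[OF tendsto_const filterlim_at_top_imp_at_infinity[OF edges_lim]])
  have e: "?e \<longlonglongrightarrow> 0" by (rule tendsto_mult_right_zero[OF r_powr_lim]) simp
  have n0: "(\<lambda>n. c / real n) \<longlonglongrightarrow> 0" for c by (rule lim_const_over_n)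
  have "?R \<longlonglongrightarrow> \<bar>t\<bar> * sqrt (4 * q + 8 * 0)
      + (\<bar>t\<bar> ^ 3 * sqrt (4 * 0\<^sup>2 + 12 * 0 * 0) + t\<^sup>2 * sqrt (8 * 0 * 0 + 4 * 0\<^sup>2) + 0)
      + t\<^sup>2 / 2 * ((C * 0 + \<bar>0\<bar> * (1 + g\<^sub>2) + 0\<^sup>2 * g\<^sub>2) + 0\<^sup>2 + 2 * q + 0)"
    by (intro tendsto_add tendsto_mult tendsto_const tendsto_real_sqrt tendsto_power tendsto_rabs lin \<beta> e n0 r_lim a_lim)
  then have "eventually (\<lambda>n. ?R n < \<eta>) sequentially"
    using q(3) by (intro order_tendstoD(2)) auto
  with eventually_regular
  have "eventually (\<lambda>n. cmod ((\<integral>x. iexp (t * Y n x) \<partial>Pn n) - complex_of_real (exp (- (t\<^sup>2 / 2)))) < \<eta>) sequentially"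
  proof eventually_elim
    case (elim n)
    show ?case
      by (rule order_le_less_trans[OF char_Y_approx[OF elim(1) \<epsilon>(1,2), of t, unfolded \<epsilon>(3)] elim(2)])
  qed
  then show "\<exists>no. \<forall>n\<ge>no. cmod ((\<integral>x. iexp (t * Y n x) \<partial>Pn n) - complex_of_real (exp (- (t\<^sup>2 / 2)))) < \<eta>"
    by (simp add: eventually_sequentially)
qed

text \<open>Normalised difference between the means under the perturbed and the uniform density;
  \<open>bias\<close> below is the one between the uniform mean and its closed approximation, a pure
  boundary effect.\<close>

definition shift :: "nat \<Rightarrow> real" where
  "shift n = real n * (real n - 1) / 2
    * (conv_form (radial (r n) b) (perturbed_sample.f U G (a n)) (perturbed_sample.f U G (a n)) - conv_form (radial (r n) b) I I)
    / T_scale TYPE('a) (r n) b n"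

definition bias :: "nat \<Rightarrow> real" where
  "bias n = real n * (real n - 1) / 2 * (conv_form (radial (r n) b) I I - radial_mass TYPE('a) (r n) b)
    / T_scale TYPE('a) (r n) b n"

lemma pair_count_scale:
  assumes "1 \<le> n"
  shows "real n * (real n - 1) / 2 * z / T_scale TYPE('a) (r n) b n
    = edges n * (1 - 1 / n) * c\<^sub>2 * (z / radial_mass TYPE('a) (r n) b)"
proof -
  define N K s\<^sub>1 u v where "N = real n" and "K = real DIM('a) * unit_ball_vol (real DIM('a))"
    and "s\<^sub>1 = b + real DIM('a)" and "u = r n powr (b + real DIM('a) / 2)" and "v = r n powr (real DIM('a) / 2)"
  have pos: "0 < N" "0 < K" "0 < s\<^sub>1" "0 < u" "0 < v"
    using assms exponent_pos dk_pos r_pos[of n] by (simp_all add: N_def K_def s\<^sub>1_def u_def v_def)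
  have uv: "r n powr (b + real DIM('a)) = u * v"
    by (simp add: u_def v_def powr_add[symmetric] algebra_simps)
  have "N * (N - 1) / 2 * z / (c\<^sub>0 * N * u) = N * v * (1 - 1 / N) * (K / (2 * s\<^sub>1 * c\<^sub>0)) * (z / (K / s\<^sub>1 * (u * v)))"
    using pos c0_pos by (simp add: field_simps)
  then show ?thesis
    unfolding T_scale_eq edges_def c\<^sub>2_def radial_mass_def uv unfolding N_def K_def s\<^sub>1_def u_def v_def .
qed

text \<open>The product \<open>edges n * (a n)^2\<close> is kept apart from the convergent factor,
  so that the statement serves whether this product converges or diverges. The limit of the factor
  comes from the approximate identity, as the kernel shrinks to the origin.\<close>

lemma shift_tendsto:
  obtains \<psi> where "\<psi> \<longlonglongrightarrow> c\<^sub>2 * g\<^sub>2" "eventually (\<lambda>n. shift n = edges n * (a n)\<^sup>2 * \<psi> n) sequentially"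
proof
  let ?\<phi> = "\<lambda>n. conv_form (radial (r n) b) G G / radial_mass TYPE('a) (r n) b"
  define \<psi> where "\<psi> n = (1 - 1 / n) * c\<^sub>2 * ?\<phi> n" for n :: nat
  have b': "- real DIM('a) < b" using exponent_pos by simp
  have "?\<phi> \<longlonglongrightarrow> g\<^sub>2"
  proof (rule LIMSEQ_I)
    fix e :: real assume e: "0 < e"
    obtain d where d: "0 < d" "\<And>k. integrable lborel k \<Longrightarrow> (\<And>z. 0 \<le> k z) \<Longrightarrow> (\<And>z. k z \<noteq> 0 \<Longrightarrow> norm z \<le> d) \<Longrightarrow>
      \<bar>conv_form k G G - (\<integral>x. (G x)\<^sup>2 \<partial>lborel) * (\<integral>z. k z \<partial>lborel)\<bar> \<le> e / 2 * (\<integral>z. k z \<partial>lborel)"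
      using conv_form_approx_identity[OF G_integrable G2_integrable, of "e / 2"] e by auto
    have "eventually (\<lambda>n. norm (?\<phi> n - g\<^sub>2) < e) sequentially"
      using eventually_r_less[OF d(1)]
    proof eventually_elim
      case (elim n)
      let ?m = "radial_mass TYPE('a) (r n) b"
      have m: "0 < ?m" by (rule radial_mass_pos[OF r_pos b'])
      have "\<bar>conv_form (radial (r n) b) G G - g\<^sub>2 * ?m\<bar> \<le> e / 2 * ?m"
        using d(2)[OF integrable_radial[OF r_pos b'], of n] radial_support[of "r n" b] elim
        unfolding integral_radial[OF r_pos b'] g\<^sub>2_def by fastforce
      then have "\<bar>conv_form (radial (r n) b) G G - g\<^sub>2 * ?m\<bar> / ?m \<le> e / 2" using m by (simp add: pos_divide_le_eq)
      moreover have "?\<phi> n - g\<^sub>2 = (conv_form (radial (r n) b) G G - g\<^sub>2 * ?m) / ?m" using m by (simp add: field_simps)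
      then have "\<bar>?\<phi> n - g\<^sub>2\<bar> = \<bar>conv_form (radial (r n) b) G G - g\<^sub>2 * ?m\<bar> / ?m" using m by (simp add: abs_divide)
      ultimately show ?case using e unfolding real_norm_def by linarith
    qed
    then show "\<exists>no. \<forall>n\<ge>no. norm (?\<phi> n - g\<^sub>2) < e" by (simp add: eventually_sequentially)
  qed
  then have "\<psi> \<longlonglongrightarrow> (1 - 0) * c\<^sub>2 * g\<^sub>2"
    unfolding \<psi>_def[abs_def] by (intro tendsto_intros lim_const_over_n)
  then show "\<psi> \<longlonglongrightarrow> c\<^sub>2 * g\<^sub>2" by simp
  show "eventually (\<lambda>n. shift n = edges n * (a n)\<^sup>2 * \<psi> n) sequentially"
    using eventually_regular
  proof eventually_elim
    case (elim n)
    interpret S: perturbed_sample U G D \<delta> C \<rho>\<^sub>0 "a n" by (rule sample)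
    have n: "1 \<le> n" "r n < \<delta>" using elim by (auto simp: regular_def)
    note k = integrable_radial[OF r_pos[of n] b'] radial_nonneg[of "r n" b, where 'a='a]
    have GI: "conv_form (radial (r n) b) G I = 0" by (rule conv_form_G_I[OF r_pos b' n(2)])
    have IG: "conv_form (radial (r n) b) I G = 0"
      using conv_form_commute[OF integrable_conv_form[OF G_borel _ G2_integrable I2_integrable k]] GI by simp
    have "conv_form (radial (r n) b) S.f S.f - conv_form (radial (r n) b) I I = (a n)\<^sup>2 * conv_form (radial (r n) b) G G"
      unfolding S.conv_form_f_f[OF k] GI IG by simp
    then show ?case
      unfolding shift_def \<psi>_def by (simp only: pair_count_scale[OF n(1)]) (simp add: mult_ac)
  qed
qed

text \<open>The boundary changes the mean by a relative amount of order \<open>r n\<close>, which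
  the normalisation magnifies by \<open>edges n\<close>; the square of \<open>edges n * r n\<close>
  is the assumed null sequence.\<close>

lemma bias_tendsto:
  assumes "(\<lambda>n. (real n)\<^sup>2 * r n ^ (DIM('a) + 2)) \<longlonglongrightarrow> 0"
  shows "bias \<longlonglongrightarrow> 0"
proof (rule Lim_null_comparison)
  have b': "- real DIM('a) < b" using exponent_pos by simp
  have er: "edges n * r n = sqrt ((real n)\<^sup>2 * r n ^ (DIM('a) + 2))" for n
  proof -
    have "(edges n * r n)\<^sup>2 = (real n)\<^sup>2 * r n ^ (DIM('a) + 2)"
      unfolding power_mult_distrib edges_power2 by (simp add: power2_eq_square mult_ac)
    then show ?thesis using edges_nonneg[of n] r_pos[of n] by (simp add: real_sqrt_unique)
  qed
  have "(\<lambda>n. sqrt ((real n)\<^sup>2 * r n ^ (DIM('a) + 2))) \<longlonglongrightarrow> sqrt 0" by (intro tendsto_intros assms)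
  then have "(\<lambda>n. edges n * r n) \<longlonglongrightarrow> 0" unfolding er by simp
  from tendsto_mult_right_zero[OF this, of "c\<^sub>2 * \<bar>C\<bar>"]
  show "(\<lambda>n. c\<^sub>2 * \<bar>C\<bar> * (edges n * r n)) \<longlonglongrightarrow> 0" .
  show "eventually (\<lambda>n. norm (bias n) \<le> c\<^sub>2 * \<bar>C\<bar> * (edges n * r n)) sequentially"
    using eventually_regular
  proof eventually_elim
    case (elim n)
    have n: "1 \<le> n" "r n < \<rho>\<^sub>0" using elim by (auto simp: regular_def)
    let ?m = "radial_mass TYPE('a) (r n) b"
    let ?z = "conv_form (radial (r n) b) I I - ?m"
    have m: "0 < ?m" by (rule radial_mass_pos[OF r_pos b'])
    have "\<bar>?z\<bar> \<le> ?m * (C * r n)" by (rule conv_form_I_I[OF r_pos b' n(2)])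
    also have "\<dots> \<le> ?m * (\<bar>C\<bar> * r n)" using m r_pos[of n] by (intro mult_left_mono mult_right_mono) auto
    finally have z: "\<bar>?z / ?m\<bar> \<le> \<bar>C\<bar> * r n" using m by (simp add: abs_divide pos_divide_le_eq mult.commute)
    have N: "0 \<le> 1 - 1 / real n" "1 - 1 / real n \<le> 1" using n by auto
    have "norm (bias n) = edges n * (1 - 1 / real n) * c\<^sub>2 * \<bar>?z / ?m\<bar>"
      unfolding bias_def pair_count_scale[OF n(1)] using N edges_nonneg[of n] c2_pos by (simp add: abs_mult)
    also have "\<dots> \<le> edges n * 1 * c\<^sub>2 * (\<bar>C\<bar> * r n)"
      using N z edges_nonneg[of n] c2_pos by (intro mult_mono mult_nonneg_nonneg) auto
    finally show ?case by (simp add: mult_ac)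
  qed
qed

text \<open>The null sequence \<open>\<beta>\<close> is 0 for \<open>T_e\<close> and
  \<open>bias\<close> for \<open>T_a\<close>. Convergence of \<open>edges n * (a n)^2\<close>
  already makes the linear part negligible, because the relevant quantity has an extra factor
  \<open>r n powr (d/2)\<close>, with \<open>d\<close> the dimension.\<close>

theorem weak_convergence:
  assumes \<gamma>: "(\<lambda>n. edges n * (a n)\<^sup>2) \<longlonglongrightarrow> \<gamma>" and \<beta>: "\<beta> \<longlonglongrightarrow> 0"
  shows "weak_conv_m (\<lambda>n. distr (Pn n) borel (\<lambda>x. (Y n x + (shift n + \<beta> n))\<^sup>2))
    (distr std_normal_distribution borel (\<lambda>z. (z + c\<^sub>2 * \<gamma> * g\<^sub>2)\<^sup>2))"
proof (rule weak_conv_m_shifted_power2[OF prob_space_Pn Y_measurable char_Y_tendsto])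
  have "real n * r n ^ DIM('a) * (a n)\<^sup>2 = edges n * (a n)\<^sup>2 * r n powr (real DIM('a) / 2)" for n
  proof -
    have "r n ^ DIM('a) = r n powr (real DIM('a) / 2) * r n powr (real DIM('a) / 2)"
      using r_pos[of n] by (simp add: powr_add[symmetric] powr_realpow[symmetric])
    then show ?thesis by (simp add: edges_def mult_ac)
  qed
  moreover have "(\<lambda>n. edges n * (a n)\<^sup>2 * r n powr (real DIM('a) / 2)) \<longlonglongrightarrow> \<gamma> * 0"
    by (intro tendsto_mult \<gamma> r_powr_lim) simp
  ultimately show "(\<lambda>n. real n * r n ^ DIM('a) * (a n)\<^sup>2) \<longlonglongrightarrow> 0" by (simp only: mult_zero_right)
  obtain \<psi> where \<psi>: "\<psi> \<longlonglongrightarrow> c\<^sub>2 * g\<^sub>2" "eventually (\<lambda>n. shift n = edges n * (a n)\<^sup>2 * \<psi> n) sequentially"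
    by (rule shift_tendsto)
  have "(\<lambda>n. edges n * (a n)\<^sup>2 * \<psi> n) \<longlonglongrightarrow> \<gamma> * (c\<^sub>2 * g\<^sub>2)" by (intro tendsto_mult \<gamma> \<psi>)
  then have "shift \<longlonglongrightarrow> \<gamma> * (c\<^sub>2 * g\<^sub>2)"
    by (rule Lim_transform_eventually) (use \<psi>(2) in \<open>auto elim!: eventually_mono\<close>)
  from tendsto_add[OF this \<beta>] show "(\<lambda>n. shift n + \<beta> n) \<longlonglongrightarrow> c\<^sub>2 * \<gamma> * g\<^sub>2" by (simp add: mult_ac)
qed

text \<open>With \<open>x = edges n * (a n)^2\<close>, the shift is asymptotically a positive
  multiple of \<open>x\<close>, while the second moment of \<open>Y\<close> is bounded by a constant
  plus a term of smaller order than \<open>x\<close>; it is therefore negligible against the squared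
  shift.\<close>

theorem divergence:
  assumes inf: "filterlim (\<lambda>n. edges n * (a n)\<^sup>2) at_top sequentially" and \<beta>: "\<beta> \<longlonglongrightarrow> 0" and g2: "0 < g\<^sub>2"
  shows "tendsto_infinity_in_prob Pn (\<lambda>n x. (Y n x + (shift n + \<beta> n))\<^sup>2)"
proof -
  let ?x = "\<lambda>n. edges n * (a n)\<^sup>2"
  obtain \<psi> where \<psi>: "\<psi> \<longlonglongrightarrow> c\<^sub>2 * g\<^sub>2" "eventually (\<lambda>n. shift n = ?x n * \<psi> n) sequentially"
    by (rule shift_tendsto)
  have k: "0 < c\<^sub>2 * g\<^sub>2" using c2_pos g2 by simp
  have inv: "(\<lambda>n. inverse (?x n)) \<longlonglongrightarrow> 0" by (rule tendsto_inverse_0_at_top[OF inf])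
  have x1: "eventually (\<lambda>n. 1 \<le> ?x n) sequentially" using inf by (simp add: filterlim_at_top)
  have ratio: "(\<lambda>n. (shift n + \<beta> n) / ?x n) \<longlonglongrightarrow> c\<^sub>2 * g\<^sub>2"
  proof (rule Lim_transform_eventually)
    show "(\<lambda>n. \<psi> n + \<beta> n * inverse (?x n)) \<longlonglongrightarrow> c\<^sub>2 * g\<^sub>2"
      using tendsto_add[OF \<psi>(1) tendsto_mult[OF \<beta> inv]] by simp
    show "eventually (\<lambda>n. \<psi> n + \<beta> n * inverse (?x n) = (shift n + \<beta> n) / ?x n) sequentially"
      using \<psi>(2) x1
    proof eventually_elim
      case (elim n)
      then have nz: "?x n \<noteq> 0" by auto
      show ?case
        by (simp only: elim(1) add_divide_distrib nonzero_mult_div_cancel_left[OF nz] divide_inverse[of "\<beta> n"])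
    qed
  qed
  have "filterlim (\<lambda>n. (shift n + \<beta> n) / ?x n * ?x n) at_top sequentially"
    by (rule filterlim_tendsto_pos_mult_at_top[OF ratio k inf])
  then have c: "filterlim (\<lambda>n. shift n + \<beta> n) at_top sequentially"
    by (rule filterlim_cong[THEN iffD1, OF refl refl, rotated])
       (use x1 in eventually_elim, auto)
  have V: "(\<lambda>n. (4 + 8 * lin n) / (shift n + \<beta> n)\<^sup>2) \<longlonglongrightarrow> 0"
  proof (rule Lim_transform_eventually)
    let ?K = "4 * (1 + g\<^sub>3) + g\<^sub>3"
    \<comment> \<open>This is \<open>4 + 8 * lin n\<close> divided by the square of
      \<open>?x n\<close>, written as a sum of visibly vanishing terms.\<close>
    let ?v = "\<lambda>n. 4 * (inverse (?x n))\<^sup>2 + 8 * c\<^sub>1 * C * (real n * r n ^ (DIM('a) + 1)) * (inverse (?x n))\<^sup>2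
      + 8 * c\<^sub>1 * ?K * r n powr (real DIM('a) / 2) * inverse (?x n)"
    have "(\<lambda>n. ?v n / ((shift n + \<beta> n) / ?x n)\<^sup>2) \<longlonglongrightarrow> (4 * 0\<^sup>2 + 8 * c\<^sub>1 * C * 0 * 0\<^sup>2 + 8 * c\<^sub>1 * ?K * 0 * 0) / (c\<^sub>2 * g\<^sub>2)\<^sup>2"
      using k by (intro tendsto_intros inv sparse r_powr_lim ratio) auto
    then show "(\<lambda>n. ?v n / ((shift n + \<beta> n) / ?x n)\<^sup>2) \<longlonglongrightarrow> 0" by simp
    show "eventually (\<lambda>n. ?v n / ((shift n + \<beta> n) / ?x n)\<^sup>2 = (4 + 8 * lin n) / (shift n + \<beta> n)\<^sup>2) sequentially"
      using x1
    proof eventually_elim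
      case (elim n)
      have "r n ^ DIM('a) = r n powr (real DIM('a) / 2) * r n powr (real DIM('a) / 2)"
        using r_pos[of n] by (simp add: powr_add[symmetric] powr_realpow[symmetric])
      then have "real n * r n ^ DIM('a) * (a n)\<^sup>2 = ?x n * r n powr (real DIM('a) / 2)"
        by (simp add: edges_def mult_ac)
      then have l: "lin n = c\<^sub>1 * (C * (real n * r n ^ (DIM('a) + 1)) + ?x n * r n powr (real DIM('a) / 2) * ?K)"
        unfolding lin_def by simp
      define X where "X = ?x n"
      have "1 \<le> X" using elim by (simp only: X_def)
      then have X: "X \<noteq> 0" by simp
      have "?v n * X\<^sup>2 = 4 + 8 * lin n"
        unfolding l X_def[symmetric] using X by (simp add: field_simps power2_eq_square)
      then show ?case unfolding X_def[symmetric] using X by (simp add: power_divide)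
    qed
  qed
  show ?thesis
  proof (rule shifted_power2_tendsto_infinity[OF prob_space_Pn Y_measurable _ c V])
    show "eventually (\<lambda>n. integrable (Pn n) (\<lambda>x. (Y n x)\<^sup>2) \<and> (\<integral>x. (Y n x)\<^sup>2 \<partial>Pn n) \<le> 4 + 8 * lin n) sequentially"
      using eventually_regular by eventually_elim (use second_moment_Y in auto)
  qed
qed

end

text \<open>Divergence in probability depends on the laws only, which allows passing from the given
  probability spaces to the product spaces.\<close>

lemma tendsto_infinity_in_prob_cong:
  assumes T: "eventually (\<lambda>n. T n \<in> borel_measurable (M n) \<and> S n \<in> borel_measurable (P n)
      \<and> distr (M n) borel (T n) = distr (P n) borel (S n)) sequentially"
    and S: "tendsto_infinity_in_prob P S"
  shows "tendsto_infinity_in_prob M T"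
  unfolding tendsto_infinity_in_prob_def
proof (intro allI impI)
  fix K :: real assume "K > 0"
  then have "(\<lambda>n. measure (P n) {\<omega> \<in> space (P n). S n \<omega> > K}) \<longlonglongrightarrow> 1"
    using S by (simp add: tendsto_infinity_in_prob_def)
  moreover have "eventually (\<lambda>n. measure (P n) {\<omega> \<in> space (P n). S n \<omega> > K} = measure (M n) {\<omega> \<in> space (M n). T n \<omega> > K}) sequentially"
    using T
  proof eventually_elim
    case (elim n)
    have "measure (distr (M n) borel (T n)) {K<..} = measure (M n) {\<omega> \<in> space (M n). T n \<omega> > K}"
      using elim by (subst measure_distr) (auto intro!: arg_cong2[where f=measure])
    moreover have "measure (distr (P n) borel (S n)) {K<..} = measure (P n) {\<omega> \<in> space (P n). S n \<omega> > K}"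
      using elim by (subst measure_distr) (auto intro!: arg_cong2[where f=measure])
    ultimately show ?case using elim by simp
  qed
  ultimately show "(\<lambda>n. measure (M n) {\<omega> \<in> space (M n). T n \<omega> > K}) \<longlonglongrightarrow> 1"
    by (rule Lim_transform_eventually)
qed

section \<open>From Lebesgue measurable data to Borel data\<close>

lemma borel_core:
  fixes W :: "'a::euclidean_space set" and g :: "'a \<Rightarrow> real"
  assumes W: "W \<in> sets lebesgue" and g: "g \<in> borel_measurable (lebesgue_on W)"
  obtains U where "U \<subseteq> W" "U \<in> sets borel" "AE x in lborel. x \<in> W \<longleftrightarrow> x \<in> U"
    "(\<lambda>x. indicator U x * g x) \<in> borel_measurable borel"
proof -
  have "(indicator W :: 'a \<Rightarrow> real) \<in> borel_measurable lebesgue" using W by (rule borel_measurable_indicator)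
  from completion_ex_borel_measurable_real[OF this]
  obtain i :: "'a \<Rightarrow> real" where i: "i \<in> borel_measurable lborel" "AE x in lborel. indicator W x = i x" by auto
  have "(\<lambda>x. indicator W x * g x) \<in> borel_measurable lebesgue"
    using g W by (subst (asm) borel_measurable_restrict_space_iff) (auto simp: mult.commute)
  from completion_ex_borel_measurable_real[OF this]
  obtain j where j: "j \<in> borel_measurable lborel" "AE x in lborel. indicator W x * g x = j x" by auto
  from i(2) j(2) have "AE x in lborel. indicator W x = i x \<and> indicator W x * g x = j x" by eventually_elim simp
  then obtain N where N: "N \<in> null_sets lborel" "{x \<in> space lborel. \<not> (indicator W x = i x \<and> indicator W x * g x = j x)} \<subseteq> N"
    unfolding eventually_ae_filter by blast
  \<comment> \<open>Removing the common exceptional null set makes \<open>g\<close> itself Borel on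
    \<open>U\<close>, not just a modification of it, and keeps \<open>U\<close> inside
    \<open>W\<close>; pointwise assumptions on \<open>W\<close> are thus inherited.\<close>
  define U where "U = {x. i x = 1} - N"
  have ib: "i \<in> borel_measurable borel" and jb: "j \<in> borel_measurable borel" using i j by auto
  have U: "U \<in> sets borel"
  proof -
    have "{x \<in> space borel. i x = 1} \<in> sets borel" using ib by measurable
    then show ?thesis using N(1) by (auto simp: U_def null_sets_def)
  qed
  have "indicator W x = i x \<and> indicator W x * g x = j x" if "x \<notin> N" for x
    using N(2) that unfolding subset_iff mem_Collect_eq space_lborel space_borel by blast
  then have good: "indicator W x = i x" "indicator W x * g x = j x" if "x \<notin> N" for x
    using that by blast+
  have sub: "U \<subseteq> W"
  proof
    fix x assume "x \<in> U"
    then have "i x = 1" "x \<notin> N" by (auto simp: U_def)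
    then show "x \<in> W" using good(1)[of x] by (cases "x \<in> W") auto
  qed
  have "AE x in lborel. x \<notin> N" using N(1) by (rule AE_not_in)
  then have AE: "AE x in lborel. x \<in> W \<longleftrightarrow> x \<in> U"
  proof eventually_elim
    case (elim x)
    then show ?case using good(1)[OF elim] sub by (cases "x \<in> W") (auto simp: U_def)
  qed
  have eq: "(\<lambda>x. indicator U x * g x) = (\<lambda>x. indicator U x * j x)"
  proof
    fix x show "indicator U x * g x = indicator U x * j x"
      using good(2)[of x] sub by (cases "x \<in> U") (auto simp: U_def)
  qed
  have "(\<lambda>x. indicator U x * g x) \<in> borel_measurable borel" unfolding eq using U jb by measurable
  with sub U AE show ?thesis by (rule that)
qed

context
  fixes W U :: "'a::euclidean_space set"
  assumes W: "W \<in> sets lebesgue" and U: "U \<in> sets borel" and AE: "AE x in lborel. x \<in> W \<longleftrightarrow> x \<in> U"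
begin

lemma
  fixes \<phi> :: "'a \<Rightarrow> real"
  assumes \<phi>: "(\<lambda>x. indicator U x * \<phi> x) \<in> borel_measurable borel"
  shows integral_lebesgue_on_core: "(\<integral>x. \<phi> x \<partial>lebesgue_on W) = (\<integral>x. indicator U x * \<phi> x \<partial>lborel)"
    and integrable_lebesgue_on_core: "integrable (lebesgue_on W) \<phi> \<Longrightarrow> integrable lborel (\<lambda>x. indicator U x * \<phi> x)"
proof -
  have AE': "AE x in lebesgue. indicator W x *\<^sub>R \<phi> x = indicator U x * \<phi> x"
    using AE_completion[OF AE] by eventually_elim (auto simp: indicator_def)
  have m: "(\<lambda>x. indicator U x * \<phi> x) \<in> borel_measurable lborel" using \<phi> by simp
  have m1: "(\<lambda>x. indicator U x * \<phi> x) \<in> borel_measurable lebesgue" by (rule measurable_completion[OF m])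
  have m2: "(\<lambda>x. indicator W x *\<^sub>R \<phi> x) \<in> borel_measurable lebesgue"
    by (rule borel_measurable_AE[OF m1]) (use AE' in \<open>auto elim!: eventually_mono\<close>)
  show "(\<integral>x. \<phi> x \<partial>lebesgue_on W) = (\<integral>x. indicator U x * \<phi> x \<partial>lborel)"
    using W integral_cong_AE[OF m2 m1 AE'] by (simp add: integral_restrict_space integral_completion[OF m])
  show "integrable lborel (\<lambda>x. indicator U x * \<phi> x)" if "integrable (lebesgue_on W) \<phi>"
    using that W integrable_cong_AE[OF m2 m1 AE'] by (simp add: integrable_restrict_space integrable_completion[OF m])
qed

lemma emeasure_core: "A \<in> sets borel \<Longrightarrow> emeasure lebesgue (A \<inter> W) = emeasure lborel (A \<inter> U)"
proof -
  assume A: "A \<in> sets borel"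
  have "emeasure lebesgue (A \<inter> W) = emeasure lebesgue (A \<inter> U)"
    using A U W by (intro emeasure_eq_AE) (use AE_completion[OF AE] in \<open>auto elim!: eventually_mono\<close>)
  then show ?thesis using A U by simp
qed

lemma distr_lebesgue_on_core: "distr (lebesgue_on W) borel (\<lambda>x. x) = density lborel (indicator U)"
proof (rule measure_eqI)
  fix A assume "A \<in> sets (distr (lebesgue_on W) borel (\<lambda>x. x))"
  then have A: "A \<in> sets borel" by simp
  have id: "(\<lambda>x. x) \<in> measurable (lebesgue_on W) borel"
    by (intro measurable_restrict_space1 measurable_completion) simp
  have "emeasure (distr (lebesgue_on W) borel (\<lambda>x. x)) A = emeasure (lebesgue_on W) (A \<inter> W)"
    using A by (subst emeasure_distr[OF id]) (auto simp: space_restrict_space)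
  also have "\<dots> = emeasure lebesgue (A \<inter> W)" using W by (subst emeasure_restrict_space) auto
  also have "\<dots> = emeasure lborel (U \<inter> A)" using emeasure_core[OF A] by (simp add: Int_commute)
  also have "\<dots> = emeasure (density lborel (indicator U)) A"
    using A U by (simp add: emeasure_restricted)
  finally show "emeasure (distr (lebesgue_on W) borel (\<lambda>x. x)) A = emeasure (density lborel (indicator U)) A" .
qed simp

text \<open>The factors live on Lebesgue sigma-algebras. Since the integrand is Borel, the product
  measure can be pushed forward along the identity to the Borel product, where densities are
  available.\<close>

lemma integral_edge_weight_core:
  assumes fin: "emeasure lborel U < \<infinity>"
  shows "(LINT (x, y)|(lebesgue_on W \<Otimes>\<^sub>M lebesgue_on W). edge_weight r b x y)
    = conv_form (radial r b) (indicator U) (indicator U)"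
proof -
  have id: "(\<lambda>x. x) \<in> measurable (lebesgue_on W) borel"
    by (intro measurable_restrict_space1 measurable_completion) simp
  have [measurable]: "U \<in> sets borel" by (rule U)
  have Ui: "(indicator U :: 'a \<Rightarrow> ennreal) \<in> borel_measurable lborel" using U by simp
  have sf: "sigma_finite_measure (density lborel (indicator U :: 'a \<Rightarrow> ennreal))"
  proof -
    have "finite_measure (density lborel (indicator U :: 'a \<Rightarrow> ennreal))"
      by (rule finite_measureI) (use fin U in \<open>simp add: emeasure_restricted\<close>)
    then show ?thesis by (rule finite_measure.axioms(1))
  qed
  have meas: "(\<lambda>(x, y). edge_weight r b x y) \<in> borel_measurable (borel \<Otimes>\<^sub>M (borel :: 'a measure))"
    unfolding edge_weight_def by measurable
  have "density lborel (indicator U) \<Otimes>\<^sub>M density lborel (indicator U)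
      = distr (lebesgue_on W \<Otimes>\<^sub>M lebesgue_on W) (borel \<Otimes>\<^sub>M borel) (\<lambda>(x, y). (x, y))"
    using pair_measure_distr[OF id id] sf by (simp add: distr_lebesgue_on_core)
  moreover have "density lborel (indicator U) \<Otimes>\<^sub>M density lborel (indicator U)
      = density (lborel \<Otimes>\<^sub>M lborel) (\<lambda>(x, y). indicator U x * indicator U y :: ennreal)"
    by (intro pair_measure_density Ui sf sigma_finite_lborel)
  moreover have "(\<lambda>(x, y). indicator U x * indicator U y :: ennreal) = (\<lambda>(x, y). ennreal (indicator U x * indicator U y))"
    by (auto simp: fun_eq_iff split: split_indicator)
  ultimately have eq: "distr (lebesgue_on W \<Otimes>\<^sub>M lebesgue_on W) (borel \<Otimes>\<^sub>M borel) (\<lambda>(x, y). (x, y))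
      = density (lborel \<Otimes>\<^sub>M lborel) (\<lambda>(x, y). ennreal (indicator U x * indicator U y))" by simp
  have mid: "(\<lambda>(x, y). (x, y)) \<in> measurable (lebesgue_on W \<Otimes>\<^sub>M lebesgue_on W) (borel \<Otimes>\<^sub>M borel)"
    unfolding case_prod_unfold
    by (intro measurable_Pair measurable_compose[OF measurable_fst id] measurable_compose[OF measurable_snd id])
  have "(LINT (x, y)|(lebesgue_on W \<Otimes>\<^sub>M lebesgue_on W). edge_weight r b x y)
      = (\<integral>(x, y). edge_weight r b x y \<partial>distr (lebesgue_on W \<Otimes>\<^sub>M lebesgue_on W) (borel \<Otimes>\<^sub>M borel) (\<lambda>(x, y). (x, y)))"
    by (subst integral_distr[OF mid meas]) (simp add: case_prod_unfold)
  also have "\<dots> = conv_form (radial r b) (indicator U) (indicator U)"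
    unfolding eq unfolding conv_form_def case_prod_unfold edge_weight_eq_radial
    by (subst integral_density) auto
  finally show ?thesis .
qed

end

text \<open>The constants are read off from the hypotheses: the gap is the distance of the support
  to the boundary, the strip constant is a natural number above the upper limit, valid up to some
  radius \<open>\<rho>\<^sub>0\<close>.\<close>

lemma perturbed_uniform_core:
  fixes W U :: "'a::euclidean_space set" and g :: "'a \<Rightarrow> real"
  assumes W: "W \<in> sets lebesgue" and vol: "measure lebesgue W = 1"
    and U: "U \<subseteq> W" "U \<in> sets borel" "AE x in lborel. x \<in> W \<longleftrightarrow> x \<in> U"
    and G: "(\<lambda>x. indicator U x * g x) \<in> borel_measurable borel"
    and g3: "integrable (lebesgue_on W) (\<lambda>x. \<bar>g x\<bar> ^ 3)" and mean: "(LINT x|lebesgue_on W. g x) = 0"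
    and supp: "setdist {x \<in> W. g x \<noteq> 0} (frontier W) > 0"
    and boundary: "Limsup (at_right 0)
           (\<lambda>\<rho>. ereal (measure lebesgue {x \<in> W. infdist x (frontier W) \<le> \<rho>} / \<rho>)) < \<infinity>"
  obtains \<delta> C \<rho>\<^sub>0 where "perturbed_uniform U (\<lambda>x. indicator U x * g x) (\<lambda>x. infdist x (frontier W)) \<delta> C \<rho>\<^sub>0"
proof -
  note core = W U(2,3)
  have fin: "emeasure lebesgue W \<noteq> \<infinity>" using vol by (auto simp: measure_def)
  then have eW: "emeasure lebesgue W = 1" using vol by (simp add: emeasure_eq_ennreal_measure)
  have eU: "emeasure lborel U = 1" using emeasure_core[OF core, of UNIV] eW by simp
  have lW: "W \<in> lmeasurable" using W fin by (auto simp: fmeasurable_def less_top)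
  have "W \<noteq> {}" "W \<noteq> UNIV" using eW by (auto simp: emeasure_lborel_UNIV)
  then have fne: "frontier W \<noteq> {}" by (simp add: frontier_eq_empty)
  obtain k where k: "Limsup (at_right 0) (\<lambda>\<rho>. ereal (measure lebesgue {x \<in> W. infdist x (frontier W) \<le> \<rho>} / \<rho>)) < ereal (real k)"
    using less_PInf_Ex_of_nat[THEN iffD1, OF less_imp_neq[OF boundary]] by (rule exE)
  from Limsup_lessD[OF this]
  have "eventually (\<lambda>\<rho>. measure lebesgue {x \<in> W. infdist x (frontier W) \<le> \<rho>} / \<rho> < real k) (at_right 0)" by simp
  then obtain \<rho>\<^sub>0 where \<rho>0: "0 < \<rho>\<^sub>0" "\<And>\<rho>. 0 < \<rho> \<Longrightarrow> \<rho> < \<rho>\<^sub>0 \<Longrightarrow> measure lebesgue {x \<in> W. infdist x (frontier W) \<le> \<rho>} / \<rho> < real k"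
    unfolding eventually_at_right_field by auto
  show ?thesis
  proof (rule that[of "setdist {x \<in> W. g x \<noteq> 0} (frontier W)" "real k" \<rho>\<^sub>0], unfold_locales)
    show "U \<in> sets borel" "emeasure lborel U = 1" "(\<lambda>x. indicator U x * g x) \<in> borel_measurable borel"
      "0 < setdist {x \<in> W. g x \<noteq> 0} (frontier W)" "0 < \<rho>\<^sub>0" by fact+
    show "indicator U x * g x = 0" if "x \<notin> U" for x using that by simp
    have a: "\<bar>indicator U x * g x\<bar> ^ 3 = indicator U x * \<bar>g x\<bar> ^ 3" for x by (simp split: split_indicator)
    have "(\<lambda>x. \<bar>indicator U x * g x\<bar> ^ 3) \<in> borel_measurable borel" using G by measurable
    then have "(\<lambda>x. indicator U x * \<bar>g x\<bar> ^ 3) \<in> borel_measurable borel" unfolding a .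
    from integrable_lebesgue_on_core[OF core this g3]
    show "integrable lborel (\<lambda>x. \<bar>indicator U x * g x\<bar> ^ 3)" unfolding a .
    show "(\<integral>x. indicator U x * g x \<partial>lborel) = 0"
      using integral_lebesgue_on_core[OF core G] mean by simp
    show "(\<lambda>x. infdist x (frontier W)) \<in> borel_measurable borel"
      by (intro borel_measurable_continuous_onI continuous_intros)
    show "AE y in lborel. norm (x - y) \<le> r \<longrightarrow> y \<in> U" if x: "x \<in> U" and r: "r < infdist x (frontier W)" for x r
    proof -
      \<comment> \<open>A ball is connected: if it met both \<open>W\<close> and its complement, it
        would contain a boundary point at distance at most \<open>r\<close> from its centre.\<close>
      have sub: "y \<in> W" if y: "norm (x - y) \<le> r" for y
      proof (rule ccontr)
        assume "y \<notin> W"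
        have "0 \<le> r" using y norm_ge_zero[of "x - y"] by linarith
        then have "x \<in> cball x r \<inter> W" "y \<in> cball x r - W"
          using x U(1) y \<open>y \<notin> W\<close> by (auto simp: dist_norm)
        then have "cball x r \<inter> frontier W \<noteq> {}" using connected_Int_frontier[OF connected_cball] by blast
        then obtain v where v: "v \<in> frontier W" "dist x v \<le> r" by auto
        then show False using infdist_le[OF v(1), of x] r by simp
      qed
      show ?thesis using U(3) by eventually_elim (use sub in auto)
    qed
    show "setdist {x \<in> W. g x \<noteq> 0} (frontier W) \<le> infdist x (frontier W)" if "indicator U x * g x \<noteq> 0" for x
    proof -
      have "x \<in> U" "g x \<noteq> 0" using that by (auto split: split_indicator_asm)
      then have "x \<in> {x \<in> W. g x \<noteq> 0}" using U(1) by auto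
      then show ?thesis unfolding infdist_eq_setdist by (intro setdist_subset_left) auto
    qed
    show "measure lborel {x \<in> U. infdist x (frontier W) \<le> \<rho>} \<le> real k * \<rho>" if \<rho>: "0 < \<rho>" "\<rho> < \<rho>\<^sub>0" for \<rho>
    proof -
      have cl: "closed {x. infdist x (frontier W) \<le> \<rho>}"
        by (intro closed_Collect_le continuous_intros)
      have mU: "{x \<in> U. infdist x (frontier W) \<le> \<rho>} \<in> sets borel"
      proof -
        have "U \<inter> {x. infdist x (frontier W) \<le> \<rho>} \<in> sets borel" using cl U(2) by auto
        then show ?thesis by (simp add: Int_def)
      qed
      have mW: "{x \<in> W. infdist x (frontier W) \<le> \<rho>} \<in> lmeasurable"
      proof -
        have "{x. infdist x (frontier W) \<le> \<rho>} \<in> sets lebesgue" using cl by auto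
        from fmeasurable_Int_fmeasurable[OF lW this] show ?thesis by (simp add: Int_def)
      qed
      have "measure lborel {x \<in> U. infdist x (frontier W) \<le> \<rho>} = measure lebesgue {x \<in> U. infdist x (frontier W) \<le> \<rho>}"
        using mU by simp
      also have "\<dots> \<le> measure lebesgue {x \<in> W. infdist x (frontier W) \<le> \<rho>}"
        using mU U(1) by (intro measure_mono_fmeasurable mW) auto
      also have "\<dots> \<le> real k * \<rho>" using \<rho>0(2)[OF \<rho>] \<rho> by (simp add: divide_less_eq)
      finally show ?thesis .
    qed
  qed
qed

section \<open>Assembly of the result\<close>

lemma limit_constant:
  fixes K s t :: real
  assumes "0 < K" "0 < s" "0 < t"
  shows "K / (2 * s * sqrt (K / (2 * t))) = sqrt (K * t) / (sqrt 2 * s)"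
proof -
  have "K = sqrt K * sqrt K" "2 = sqrt 2 * sqrt (2::real)" using assms by simp_all
  then show ?thesis
    using assms unfolding real_sqrt_divide real_sqrt_mult
    by (simp add: field_simps)
qed

theorem theorem4p2:
  fixes W :: "'a::euclidean_space set"
    and g :: "'a \<Rightarrow> real"
    and r a :: "nat \<Rightarrow> real"
    and \<beta> :: real
    and M :: "nat \<Rightarrow> 'b measure"
    and X :: "nat \<Rightarrow> nat \<Rightarrow> 'b \<Rightarrow> 'a"
  assumes W_meas: "W \<in> sets lebesgue" and W_vol: "measure lebesgue W = 1"
    and r_pos: "\<And>n. n \<ge> 1 \<Longrightarrow> 0 < r n" and r_lim: "r \<longlonglongrightarrow> 0"
    and g_meas: "g \<in> borel_measurable (lebesgue_on W)"
    and g_L3: "integrable (lebesgue_on W) (\<lambda>x. \<bar>g x\<bar> ^ 3)"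
    and g_nonzero: "\<not> (AE x in lebesgue_on W. g x = 0)"
    and g_mean: "(LINT x|lebesgue_on W. g x) = 0"
    and a_pos: "\<And>n. n \<ge> 1 \<Longrightarrow> 0 < a n" and a_lim: "a \<longlonglongrightarrow> 0"
    and dens_nonneg: "\<And>n x. n \<ge> 1 \<Longrightarrow> x \<in> W \<Longrightarrow> 0 \<le> 1 + a n * g x"
    and prob: "\<And>n. n \<ge> 1 \<Longrightarrow> prob_space (M n)"
    and indep: "\<And>n. n \<ge> 1 \<Longrightarrow> prob_space.indep_vars (M n) (\<lambda>_. borel) (X n) {1..n}"
    and dens: "\<And>n i. n \<ge> 1 \<Longrightarrow> i \<in> {1..n} \<Longrightarrow>
           has_lebesgue_density (M n) (X n i) (\<lambda>x. indicator W x * (1 + a n * g x))"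
    and beta: "\<beta> > - real DIM('a) / 2"
    and supp: "setdist {x \<in> W. g x \<noteq> 0} (frontier W) > 0"
    and boundary: "Limsup (at_right 0)
           (\<lambda>\<rho>. ereal (measure lebesgue {x \<in> W. infdist x (frontier W) \<le> \<rho>} / \<rho>)) < \<infinity>"
    and many_edges: "filterlim (\<lambda>n. (real n)\<^sup>2 * r n ^ DIM('a)) at_top sequentially"
    and sparse: "(\<lambda>n. real n * r n ^ (DIM('a) + 1)) \<longlonglongrightarrow> 0"
  shows
    "(\<forall>\<gamma>\<ge>0. (\<lambda>n. real n * r n powr (real DIM('a) / 2) * (a n)\<^sup>2) \<longlonglongrightarrow> \<gamma> \<longrightarrow>
        weak_conv_m (\<lambda>n. distr (M n) borel (\<lambda>\<omega>. T_e W (r n) \<beta> n (\<lambda>i. X n i \<omega>)))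
                    (limit_law W g \<beta> \<gamma>))
   \<and> (filterlim (\<lambda>n. real n * r n powr (real DIM('a) / 2) * (a n)\<^sup>2) at_top sequentially \<longrightarrow>
        tendsto_infinity_in_prob M (\<lambda>n \<omega>. T_e W (r n) \<beta> n (\<lambda>i. X n i \<omega>)))
   \<and> ((\<lambda>n. (real n)\<^sup>2 * r n ^ (DIM('a) + 2)) \<longlonglongrightarrow> 0 \<longrightarrow>
        (\<forall>\<gamma>\<ge>0. (\<lambda>n. real n * r n powr (real DIM('a) / 2) * (a n)\<^sup>2) \<longlonglongrightarrow> \<gamma> \<longrightarrow>
           weak_conv_m (\<lambda>n. distr (M n) borel (\<lambda>\<omega>. T_a (r n) \<beta> n (\<lambda>i. X n i \<omega>)))
                       (limit_law W g \<beta> \<gamma>))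
      \<and> (filterlim (\<lambda>n. real n * r n powr (real DIM('a) / 2) * (a n)\<^sup>2) at_top sequentially \<longrightarrow>
           tendsto_infinity_in_prob M (\<lambda>n \<omega>. T_a (r n) \<beta> n (\<lambda>i. X n i \<omega>))))"
proof -
  obtain U where U: "U \<subseteq> W" "U \<in> sets borel" "AE x in lborel. x \<in> W \<longleftrightarrow> x \<in> U"
    and Gb: "(\<lambda>x. indicator U x * g x) \<in> borel_measurable borel"
    using borel_core[OF W_meas g_meas] by metis
  note core = W_meas U(2,3)
  define G where "G x = indicator U x * g x" for x
  define D where "D x = infdist x (frontier W)" for x
  obtain \<delta> C \<rho>\<^sub>0 where pu: "perturbed_uniform U G D \<delta> C \<rho>\<^sub>0"
    unfolding G_def D_def by (rule perturbed_uniform_core[OF W_meas W_vol U Gb g_L3 g_mean supp boundary])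
  \<comment> \<open>nothing is assumed about \<open>n = 0\<close>, so the sequences are altered there\<close>
  define r' a' where "r' n = r (max 1 n)" and "a' n = a (max 1 n)" for n
  have r'_eq: "r' n = r n" and a'_eq: "a' n = a n" if "1 \<le> n" for n using that by (simp_all add: r'_def a'_def max_def)
  have ev1: "eventually (\<lambda>n::nat. 1 \<le> n) sequentially" by (rule eventually_ge_at_top)
  have ev_r: "eventually (\<lambda>n. r n = r' n) sequentially" using ev1 by eventually_elim (simp add: r'_eq)
  have ev_a: "eventually (\<lambda>n. a n = a' n) sequentially" using ev1 by eventually_elim (simp add: a'_eq)
  interpret S: sample_sequence U G D \<delta> C \<rho>\<^sub>0 a' r' \<beta>
  proof (intro sample_sequence.intro sample_sequence_axioms.intro pu)
    show "0 \<le> 1 + a' n * G x" if "x \<in> U" for x n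
      using dens_nonneg[of "max 1 n" x] that U(1) by (auto simp: a'_def G_def)
    show "0 < r' n" for n unfolding r'_def by (intro r_pos) simp
    show "r' \<longlonglongrightarrow> 0" by (rule Lim_transform_eventually[OF r_lim ev_r])
    show "a' \<longlonglongrightarrow> 0" by (rule Lim_transform_eventually[OF a_lim ev_a])
    show "- real DIM('a) / 2 < \<beta>" by (rule beta)
    show "filterlim (\<lambda>n. (real n)\<^sup>2 * r' n ^ DIM('a)) at_top sequentially"
      by (rule filterlim_cong[THEN iffD1, OF refl refl _ many_edges]) (use ev_r in eventually_elim, simp)
    show "(\<lambda>n. real n * r' n ^ (DIM('a) + 1)) \<longlonglongrightarrow> 0"
      by (rule Lim_transform_eventually[OF sparse]) (use ev_r in eventually_elim, simp)
  qed
  have g2: "S.g\<^sub>2 = (LINT x|lebesgue_on W. (g x)\<^sup>2)"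
  proof -
    have e: "(G x)\<^sup>2 = indicator U x * (g x)\<^sup>2" for x by (simp add: G_def split: split_indicator)
    have "(\<lambda>x. (G x)\<^sup>2) \<in> borel_measurable borel" using S.G_borel by measurable
    then show ?thesis unfolding S.g\<^sub>2_def e by (rule integral_lebesgue_on_core[OF core, symmetric])
  qed
  have g2_pos: "0 < S.g\<^sub>2"
  proof (rule ccontr)
    assume "\<not> 0 < S.g\<^sub>2"
    then have "(\<integral>x. (G x)\<^sup>2 \<partial>lborel) = 0" using S.g2_nonneg unfolding S.g\<^sub>2_def by linarith
    then have "AE x in lborel. (G x)\<^sup>2 = 0"
      using integral_nonneg_eq_0_iff_AE[OF S.G2_integrable] by simp
    with U(3) have "AE x in lborel. x \<in> W \<longrightarrow> g x = 0"
      by eventually_elim (auto simp: G_def)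
    then have "AE x in lebesgue_on W. g x = 0"
      using W_meas by (subst AE_restrict_space_iff) (auto intro: AE_completion)
    with g_nonzero show False by simp
  qed
  have eU: "emeasure lborel U < \<infinity>" by (simp add: S.U_vol)
  \<comment> \<open>With \<open>k\<close> and \<open>j\<close> the means under the perturbed and the
    uniform density, the right-hand sides are \<open>Y\<close> plus \<open>shift\<close> plus 0 and
    \<open>Y\<close> plus \<open>shift\<close> plus \<open>bias\<close>. Both identities survive
    zero denominators because the affected quotients are then 0.\<close>
  have split: "(l - 1 / 2 * m * (m - 1) * j) / t = (l - m * (m - 1) / 2 * k) / t + (m * (m - 1) / 2 * (k - j) / t + 0)"
    for l m j k t :: real
    by (cases "t = 0") (simp_all add: field_simps)
  have split': "(l - q / (2 * s) * m * (m - 1) * p) / t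
      = (l - m * (m - 1) / 2 * k) / t + (m * (m - 1) / 2 * (k - j) / t + m * (m - 1) / 2 * (j - q / s * p) / t)"
    for l m q s p j t k :: real
    by (cases "t = 0"; cases "s = 0") (simp_all add: field_simps)
  have T_e: "T_e W (r n) \<beta> n x = (S.Y n x + (S.shift n + 0))\<^sup>2" if n: "1 \<le> n" for n x
    unfolding T_e_def S.Y_eq S.shift_def length_power_eq_ustat integral_edge_weight_core[OF core eU] r'_eq[OF n]
    by (rule arg_cong2[where f=power, OF split refl])
  have T_a: "T_a (r n) \<beta> n x = (S.Y n x + (S.shift n + S.bias n))\<^sup>2" if n: "1 \<le> n" for n x
    unfolding T_a_def S.Y_eq S.shift_def S.bias_def length_power_eq_ustat r'_eq[OF n] radial_mass_def
    by (rule arg_cong2[where f=power, OF split' refl])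
  \<comment> \<open>The densities on \<open>W\<close> and on its Borel core differ on a null set
    only, so the laws agree on Borel sets.\<close>
  have law: "distr (M n) borel (X n i) = perturbed_sample.Q U G (a' n)" if n: "1 \<le> n" and i: "i \<in> {1..n}" for n i
  proof -
    interpret P: perturbed_sample U G D \<delta> C \<rho>\<^sub>0 "a' n" by (rule S.sample)
    have Pf: "P.f x = indicator U x + a n * G x" for x unfolding P.f_def by (simp add: a'_eq[OF n])
    note d = dens[OF n i, unfolded has_lebesgue_density_def]
    show ?thesis
    proof (rule measure_eqI)
      fix A assume "A \<in> sets (distr (M n) borel (X n i))"
      then have A: "A \<in> sets borel" by simp
      have "emeasure (distr (M n) borel (X n i)) A = (\<integral>\<^sup>+x\<in>A. ennreal (indicator W x * (1 + a n * g x)) \<partial>lebesgue)"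
        using d A by (simp add: emeasure_distr)
      also have "\<dots> = (\<integral>\<^sup>+x\<in>A. ennreal (P.f x) \<partial>lebesgue)"
        by (rule nn_integral_cong_AE, use AE_completion[OF U(3)] in eventually_elim)
           (auto simp: Pf G_def split: split_indicator)
      also have "\<dots> = emeasure P.Q A"
        using A by (simp add: nn_integral_completion P.Q_def emeasure_density)
      finally show "emeasure (distr (M n) borel (X n i)) A = emeasure P.Q A" .
    qed simp
  qed
  have transfer: "(\<lambda>\<omega>. (S.Y n (\<lambda>i. X n i \<omega>) + c)\<^sup>2) \<in> borel_measurable (M n)"
      "distr (M n) borel (\<lambda>\<omega>. (S.Y n (\<lambda>i. X n i \<omega>) + c)\<^sup>2) = distr (S.Pn n) borel (\<lambda>x. (S.Y n x + c)\<^sup>2)"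
    if n: "1 \<le> n" for n c
  proof -
    have X: "X n i \<in> borel_measurable (M n)" if "i \<in> {1..n}" for i
      using dens[OF n that] by (simp add: has_lebesgue_density_def)
    have F: "(\<lambda>x. (S.Y n x + c)\<^sup>2) \<in> borel_measurable (Pi\<^sub>M {0<..n} (\<lambda>_. perturbed_sample.Q U G (a' n)))"
      using S.Y_measurable[of n] unfolding S.Pn_def by measurable
    have cong: "(S.Y n x + c)\<^sup>2 = (S.Y n y + c)\<^sup>2" if "\<And>i. i \<in> {0<..n} \<Longrightarrow> x i = y i" for x y
      unfolding S.Y_eq using ustat_cong[OF that] by simp
    note * = distr_iid_sample[OF n prob[OF n] indep[OF n] X law[OF n] F cong]
    show "(\<lambda>\<omega>. (S.Y n (\<lambda>i. X n i \<omega>) + c)\<^sup>2) \<in> borel_measurable (M n)" by (rule *)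
    show "distr (M n) borel (\<lambda>\<omega>. (S.Y n (\<lambda>i. X n i \<omega>) + c)\<^sup>2) = distr (S.Pn n) borel (\<lambda>x. (S.Y n x + c)\<^sup>2)"
      unfolding S.Pn_def by (rule *)
  qed
  have limit: "limit_law W g \<beta> \<gamma> = distr std_normal_distribution borel (\<lambda>z. (z + S.c\<^sub>2 * \<gamma> * S.g\<^sub>2)\<^sup>2)" for \<gamma>
  proof -
    have "S.c\<^sub>2 = sqrt (real DIM('a) * unit_ball_vol (real DIM('a)) * (2 * \<beta> + real DIM('a))) / (sqrt 2 * (\<beta> + real DIM('a)))"
      unfolding S.c\<^sub>2_def S.c\<^sub>0_def by (rule limit_constant[OF S.dk_pos S.exponent_pos(2,1)])
    then show ?thesis unfolding limit_law_def g2 by simp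
  qed
  have edges: "S.edges n * (a' n)\<^sup>2 = real n * r n powr (real DIM('a) / 2) * (a n)\<^sup>2" if "1 \<le> n" for n
    using that by (simp add: S.edges_def r'_eq a'_eq)
  have ev_edges: "eventually (\<lambda>n. real n * r n powr (real DIM('a) / 2) * (a n)\<^sup>2 = S.edges n * (a' n)\<^sup>2) sequentially"
    using ev1 by eventually_elim (simp add: edges)
  \<comment> \<open>Stated for a generic statistic \<open>T\<close> with null sequence
    \<open>c\<close>, so that each regime is treated once: \<open>c\<close> is 0 for
    \<open>T_e\<close> and \<open>S.bias\<close> for \<open>T_a\<close>.\<close>
  have weak: "weak_conv_m (\<lambda>n. distr (M n) borel (\<lambda>\<omega>. T n (\<lambda>i. X n i \<omega>))) (limit_law W g \<beta> \<gamma>)"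
    if "(\<lambda>n. real n * r n powr (real DIM('a) / 2) * (a n)\<^sup>2) \<longlonglongrightarrow> \<gamma>" and c: "c \<longlonglongrightarrow> 0"
      and T: "\<And>n x. 1 \<le> n \<Longrightarrow> T n x = (S.Y n x + (S.shift n + c n))\<^sup>2" for T c \<gamma>
  proof -
    have "(\<lambda>n. S.edges n * (a' n)\<^sup>2) \<longlonglongrightarrow> \<gamma>" by (rule Lim_transform_eventually[OF that(1) ev_edges])
    from S.weak_convergence[OF this c] show ?thesis
      unfolding limit
      by (rule weak_conv_m_cong_eventually[rotated]) (use ev1 in eventually_elim, simp add: T transfer)
  qed
  have diverge: "tendsto_infinity_in_prob M (\<lambda>n \<omega>. T n (\<lambda>i. X n i \<omega>))"
    if "filterlim (\<lambda>n. real n * r n powr (real DIM('a) / 2) * (a n)\<^sup>2) at_top sequentially" and c: "c \<longlonglongrightarrow> 0"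
      and T: "\<And>n x. 1 \<le> n \<Longrightarrow> T n x = (S.Y n x + (S.shift n + c n))\<^sup>2" for T c
  proof -
    have "filterlim (\<lambda>n. S.edges n * (a' n)\<^sup>2) at_top sequentially"
      by (rule filterlim_cong[THEN iffD1, OF refl refl ev_edges that(1)])
    from S.divergence[OF this c g2_pos] show ?thesis
    proof (rule tendsto_infinity_in_prob_cong[rotated])
      show "eventually (\<lambda>n. (\<lambda>\<omega>. T n (\<lambda>i. X n i \<omega>)) \<in> borel_measurable (M n)
          \<and> (\<lambda>x. (S.Y n x + (S.shift n + c n))\<^sup>2) \<in> borel_measurable (S.Pn n)
          \<and> distr (M n) borel (\<lambda>\<omega>. T n (\<lambda>i. X n i \<omega>)) = distr (S.Pn n) borel (\<lambda>x. (S.Y n x + (S.shift n + c n))\<^sup>2)) sequentially"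
        using ev1
      proof eventually_elim
        case (elim n)
        have "(\<lambda>x. (S.Y n x + (S.shift n + c n))\<^sup>2) \<in> borel_measurable (S.Pn n)"
          using S.Y_measurable[of n] by measurable
        then show ?case using transfer[OF elim] by (simp add: T[OF elim])
      qed
    qed
  qed
  have bias: "S.bias \<longlonglongrightarrow> 0" if "(\<lambda>n. (real n)\<^sup>2 * r n ^ (DIM('a) + 2)) \<longlonglongrightarrow> 0"
    by (rule S.bias_tendsto, rule Lim_transform_eventually[OF that]) (use ev_r in eventually_elim, simp)
  show ?thesis
    using weak[OF _ tendsto_const T_e] diverge[OF _ tendsto_const T_e] weak[OF _ bias T_a] diverge[OF _ bias T_a] by auto
qed

end
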